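(* Fix a field $\Bbbk$. Let $L\in\mathcal L(n)$ be a finite atomic lattice and suppose that $P\in\mathcal L(n)$ satisfies $P>L$ in $\mathcal L(n)$, that $P$ is rigid, and that $P$ has the same (total) Betti numbers as $L$. Then for every finite atomic lattice $L'$ with $B(L)\cong B(L')$ as posets, the minimal free resolution of any monomial ideal with lcm-lattice $L'$ is supported on $B(P)$. In other words, $P$ is a rigid deformation of $L'$: any monomial ideal with lcm-lattice $P$ is a rigid deformation of any monomial ideal with lcm-lattice $L'$.
   Context: Lattices. $\mathcal L(n)$ is the set of finite atomic lattices with $n$ ordered atoms, partially ordered by: $P\ge Q$ if there is a join-preserving map $P\to Q$ which is a bijection on atoms (respecting the ordering of atoms). The lcm-lattice of a monomial ideal is the set of least common multiples of subsets of its minimal generators, ordered by divisibility, with minimum $\hat 0=1$; every finite atomic lattice is isomorphic to the lcm-lattice of some monomial ideal, and homological terms for a lattice refer to monomial ideals over $\Bbbk$ having it as lcm-lattice. Betti poset. For a finite poset $Q$ with minimum $\hat0$ and $p\in Q$, $\Delta_p=\Delta_p^Q$ is the order complex of the open interval $(\hat 0,p)$ and $h_i(\Delta_p)=\dim_\Bbbk\widetilde H_i(\Delta_p,\Bbbk)$; the order complex of an empty poset is $\{\varnothing\}$, with $\widetilde H_{-1}=\Bbbk$. $B(Q)=\{p\in Q:h_i(\Delta_p)\ne0\text{ for some }i\}$. The total Betti numbers of a finite atomic lattice $L$ are $\beta_0=1$ and $\beta_i(L)=\sum_{p\in L\setminus\{\hat0\}}h_{i-2}(\Delta_p)$ for $i\geq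 1$, which are the Betti numbers of $R/I$ for any monomial ideal $I$ with lcm-lattice $L$. Rigidity. A finite atomic lattice $L$ (or a monomial ideal with lcm-lattice $L$) is rigid if: (R1) for every $p\in L$, $h_i(\Delta_p)$ is nonzero for at most one $i$, and for that $i$ it equals $1$; (R2) if $p\ne q\in L$ satisfy $h_i(\Delta_p)=h_i(\Delta_q)=1$ for some common $i$, then $p,q$ are incomparable. The sequence $\mathcal D(Q)$. For a finite poset $Q$ with minimum $\hat 0$ put $\mathcal D_0=\widetilde H_{-1}(\{\varnothing\},\Bbbk)\cong\Bbbk$ and, for $\ell\ge1$, $\mathcal D_\ell=\bigoplus_{p\in Q\setminus\{\hat0\}}\mathcal D_{\ell,p}$ with $\mathcal D_{\ell,p}=\widetilde H_{\ell-2}(\Delta_p,\Bbbk)$. Write $p\lessdot q$ if $q$ covers $p$, let $\Delta_{\lceil p\rceil}$ be the order complex of $(\hat0,p]$, so $\Delta_q=\bigcup_{p\lessdot q}\Delta_{\lceil p\rceil}$, and set $\Delta_{q,p}=\Delta_{\lceil p\rceil}\cap\bigcup_{b\lessdot q,\,b\ne p}\Delta_{\lceil b\rceil}\subset\Delta_p$. For $i\ge2$, $\varphi_i:\mathcal D_i\to\mathcal D_{i-1}$ is given on $\mathcal D_{i,q}$ by $\sum_{p\lessdot q}\varphi_i^{q,p}$, where $\varphi_i^{q,p}:\mathcal D_{i,q}\to\mathcal D_{i-1,p}$ is the composition of the Mayer–Vietoris connecting map $\widetilde H_{i-2}(\Delta_q,\Bbbk)\to\widetilde H_{i-3}(\Delta_{q,p},\Bbbk)$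 for $\Delta_q=\Delta_{\lceil p\rceil}\cup\bigcup_{b\lessdot q,\,b\neq p}\Delta_{\lceil b\rceil}$ (a cycle $z=z'+z''$ with $z'$ supported on $\Delta_{\lceil p\rceil}$ and $z''$ on the other subcomplex is sent to the class of the boundary of $z'$) with the map $\widetilde H_{i-3}(\Delta_{q,p},\Bbbk)\to\widetilde H_{i-3}(\Delta_p,\Bbbk)$ induced by inclusion. $\varphi_1:\mathcal D_1\to\mathcal D_0$ is the identity of $\widetilde H_{-1}(\{\varnothing\},\Bbbk)$ on each summand $\mathcal D_{1,a}$, $a$ an atom. "Supported on". Let $N$ be a monomial ideal in a polynomial ring $S$ over $\Bbbk$. The minimal free resolution of $N$ is supported on a finite poset $Q$ with minimum $\hat 0$ if there is an order-preserving map $\eta$ from $Q$ to the monomials of $S$ (ordered by divisibility), with $\eta(\hat0)=1$, such that the sequence with $F_0=S$, $F_i=\bigoplus_{q\in Q\setminus\{\hat0\}}S(-\deg\eta(q))\otimes_\Bbbk\mathcal D_{i,q}$ for $i\ge1$, and differential with components $\frac{\eta(q)}{\eta(p)}\otimes\varphi_i^{q,p}$ for $p\lessdot q$, is a minimal free resolution of $S/N$. Rigid deformation. A monomial ideal $J$ is a rigid deformation of a monomial ideal $I$ if $J$ is rigid and the minimal free resolution of $J$ can be relabeled to minimally resolve $I$. Relabeling means: for some order-preserving map $g$ from $B(L_J)$ ($L_J$ the lcm-lattice of $J$) to the monomials of the ring of $I$, replace each homogeneous basis element of multidegree (monomial) $m$ by one of multidegree $g(m)$, and each matrix entry $c\cdot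 m/m'$ ($c\in\Bbbk$) of the differential by $c\cdot g(m)/g(m')$. *)

theory Defs
  imports
    "HOL-Library.Poly_Mapping"
    "HOL-Library.Function_Algebras"
    "HOL-Library.Lub_Glb"
begin

text \<open>
  A finite poset is a finite set \<open>Q :: 'a set\<close> over a type of class \<open>order\<close>, with the induced
  order. Sums, differences and zero of functions (chains, exponent vectors, elements of free
  modules) are the pointwise ones of \<open>Function_Algebras\<close>.
\<close>

subsection \<open>Posets and finite atomic lattices\<close>

definition pbot :: "'a::order set \<Rightarrow> 'a" where
  "pbot Q = (LEAST x. x \<in> Q)"

definition covers :: "'a::order set \<Rightarrow> 'a \<Rightarrow> 'a \<Rightarrow> bool" where
  "covers Q q p \<longleftrightarrow> p \<in> Q \<and> q \<in> Q \<and> p < q \<and> \<not> (\<exists>x\<in>Q. p < x \<and> x < q)"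

definition atoms :: "'a::order set \<Rightarrow> 'a set" where
  "atoms Q = {a. covers Q a (pbot Q)}"

definition finite_lattice :: "'a::order set \<Rightarrow> bool" where
  "finite_lattice L \<longleftrightarrow> finite L \<and> L \<noteq> {} \<and>
     (\<forall>x\<in>L. \<forall>y\<in>L. (\<exists>j. isLub L {x, y} j) \<and> (\<exists>m. isGlb L {x, y} m))"

definition finite_atomic_lattice :: "'a::order set \<Rightarrow> bool" where
  "finite_atomic_lattice L \<longleftrightarrow> finite_lattice L \<and>
     (\<forall>x\<in>L. \<exists>A \<subseteq> atoms L. isLub L A x)"

definition poset_iso :: "'a::order set \<Rightarrow> 'b::order set \<Rightarrow> ('a \<Rightarrow> 'b) \<Rightarrow> bool" where
  "poset_iso A B f \<longleftrightarrow> bij_betw f A B \<and> (\<forall>x\<in>A. \<forall>y\<in>A. x \<le> y \<longleftrightarrow> f x \<le> f y)"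

definition poset_isomorphic :: "'a::order set \<Rightarrow> 'b::order set \<Rightarrow> bool" where
  "poset_isomorphic A B \<longleftrightarrow> (\<exists>f. poset_iso A B f)"

text \<open>
  Members of \<open>\<L>(n)\<close> are pairs of a lattice \<open>L\<close> and an enumeration \<open>a 0, \<dots>, a (n - 1)\<close> of its
  atoms, identified up to isomorphism preserving the enumeration. Accordingly the strict order
  is \<open>\<ge>\<close> together with not being isomorphic in this sense.
\<close>

definition atom_ordered_lattice :: "nat \<Rightarrow> 'a::order set \<Rightarrow> (nat \<Rightarrow> 'a) \<Rightarrow> bool" where
  "atom_ordered_lattice n L a \<longleftrightarrow> finite_atomic_lattice L \<and> bij_betw a {..<n} (atoms L)"

definition join_preserving :: "'a::order set \<Rightarrow> 'b::order set \<Rightarrow> ('a \<Rightarrow> 'b) \<Rightarrow> bool" where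
  "join_preserving P Q f \<longleftrightarrow> f ` P \<subseteq> Q \<and>
     (\<forall>X j. X \<subseteq> P \<longrightarrow> isLub P X j \<longrightarrow> isLub Q (f ` X) (f j))"

definition lat_ge ::
  "nat \<Rightarrow> 'a::order set \<Rightarrow> (nat \<Rightarrow> 'a) \<Rightarrow> 'b::order set \<Rightarrow> (nat \<Rightarrow> 'b) \<Rightarrow> bool" where
  "lat_ge n P a Q b \<longleftrightarrow> (\<exists>f. join_preserving P Q f \<and> (\<forall>i<n. f (a i) = b i))"

definition lat_eq ::
  "nat \<Rightarrow> 'a::order set \<Rightarrow> (nat \<Rightarrow> 'a) \<Rightarrow> 'b::order set \<Rightarrow> (nat \<Rightarrow> 'b) \<Rightarrow> bool" where
  "lat_eq n P a Q b \<longleftrightarrow> (\<exists>f. poset_iso P Q f \<and> (\<forall>i<n. f (a i) = b i))"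

definition lat_gt ::
  "nat \<Rightarrow> 'a::order set \<Rightarrow> (nat \<Rightarrow> 'a) \<Rightarrow> 'b::order set \<Rightarrow> (nat \<Rightarrow> 'b) \<Rightarrow> bool" where
  "lat_gt n P a Q b \<longleftrightarrow> lat_ge n P a Q b \<and> \<not> lat_eq n P a Q b"


subsection \<open>Reduced simplicial homology of order complexes\<close>

text \<open>
  Complexes are sets of finite sets and contain the empty face, which has dimension \<open>-1\<close>. All
  faces are chains of the ambient order, and the vertices of a face are listed increasingly;
  so \<open>x\<close> has position \<open>card {y \<in> \<tau>. y < x}\<close> in the face \<open>insert x \<tau>\<close>.
\<close>

definition order_complex :: "'a::order set \<Rightarrow> 'a set set" where
  "order_complex A = {\<sigma>. finite \<sigma> \<and> \<sigma> \<subseteq> A \<and> Complete_Partial_Order.chain (\<le>) \<sigma>}"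

definition chains :: "'a set set \<Rightarrow> int \<Rightarrow> ('a set \<Rightarrow> 'k::field) set" where
  "chains K i = {c. \<forall>\<sigma>. c \<sigma> \<noteq> 0 \<longrightarrow> \<sigma> \<in> K \<and> int (card \<sigma>) = i + 1}"

definition bdry :: "('a::order set \<Rightarrow> 'k::field) \<Rightarrow> 'a set \<Rightarrow> 'k" where
  "bdry c \<tau> = (\<Sum>x | x \<notin> \<tau> \<and> c (insert x \<tau>) \<noteq> 0.
      (-1) ^ card {y \<in> \<tau>. y < x} * c (insert x \<tau>))"

definition cycles :: "'a::order set set \<Rightarrow> int \<Rightarrow> ('a set \<Rightarrow> 'k::field) set" where
  "cycles K i = {z \<in> chains K i. bdry z = 0}"

definition boundaries :: "'a::order set set \<Rightarrow> int \<Rightarrow> ('a set \<Rightarrow> 'k::field) set" where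
  "boundaries K i = bdry ` chains K (i + 1)"

definition hclass ::
  "'a::order set set \<Rightarrow> int \<Rightarrow> ('a set \<Rightarrow> 'k::field) \<Rightarrow> ('a set \<Rightarrow> 'k) set" where
  "hclass K i z = (\<lambda>b. z + b) ` boundaries K i"

definition homology :: "'a::order set set \<Rightarrow> int \<Rightarrow> ('a set \<Rightarrow> 'k::field) set set" where
  "homology K i = hclass K i ` cycles K i"

definition lincomb :: "(('b \<Rightarrow> 'k) \<Rightarrow> 'k) \<Rightarrow> ('b \<Rightarrow> 'k) set \<Rightarrow> 'b \<Rightarrow> 'k::field" where
  "lincomb u b = (\<lambda>\<sigma>. \<Sum>x\<in>b. u x * x \<sigma>)"

text \<open>
  A basis of the vector space \<open>homology K i\<close> is given by a set of cycles representing it; the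
  uniqueness requirement forces distinct members to have distinct classes.
\<close>

definition homology_basis ::
  "'a::order set set \<Rightarrow> int \<Rightarrow> ('a set \<Rightarrow> 'k::field) set \<Rightarrow> bool" where
  "homology_basis K i b \<longleftrightarrow> finite b \<and> b \<subseteq> cycles K i \<and>
     (\<forall>\<xi>\<in>homology K i. \<exists>!u. (\<forall>x. x \<notin> b \<longrightarrow> u x = 0) \<and> \<xi> = hclass K i (lincomb u b))"

definition hbasis :: "'a::order set set \<Rightarrow> int \<Rightarrow> ('a set \<Rightarrow> 'k::field) set" where
  "hbasis K i = (SOME b. homology_basis K i b)"

definition hcoord ::
  "'a::order set set \<Rightarrow> int \<Rightarrow> ('a set \<Rightarrow> 'k::field) set \<Rightarrow> ('a set \<Rightarrow> 'k) \<Rightarrow> 'k" where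
  "hcoord K i \<xi> = (THE u. (\<forall>x. x \<notin> hbasis K i \<longrightarrow> u x = 0) \<and>
      \<xi> = hclass K i (lincomb u (hbasis K i)))"

definition hdim :: "'k::field itself \<Rightarrow> 'a::order set set \<Rightarrow> int \<Rightarrow> nat" where
  "hdim k K i = card (hbasis K i :: ('a set \<Rightarrow> 'k) set)"


subsection \<open>Betti posets, Betti numbers and rigidity\<close>

definition Delta :: "'a::order set \<Rightarrow> 'a \<Rightarrow> 'a set set" where
  "Delta Q p = order_complex {x \<in> Q. pbot Q < x \<and> x < p}"

definition Delta_closed :: "'a::order set \<Rightarrow> 'a \<Rightarrow> 'a set set" where
  "Delta_closed Q p = order_complex {x \<in> Q. pbot Q < x \<and> x \<le> p}"

definition betti_poset :: "'k::field itself \<Rightarrow> 'a::order set \<Rightarrow> 'a set" where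
  "betti_poset k Q = {p \<in> Q. \<exists>i. hdim k (Delta Q p) i \<noteq> 0}"

definition betti :: "'k::field itself \<Rightarrow> 'a::order set \<Rightarrow> nat \<Rightarrow> nat" where
  "betti k L i = (if i = 0 then 1 else \<Sum>p\<in>L - {pbot L}. hdim k (Delta L p) (int i - 2))"

text \<open>
  \<open>Delta L (pbot L)\<close> consists of the empty face, so the minimum belongs to the Betti poset. It
  accounts for the zeroth Betti number and not, as the atoms do, for the first one; therefore it
  takes no part in the second condition, which no lattice with an atom could satisfy otherwise.
\<close>

definition rigid :: "'k::field itself \<Rightarrow> 'a::order set \<Rightarrow> bool" where
  "rigid k L \<longleftrightarrow>
     (\<forall>p\<in>L. \<forall>i. hdim k (Delta L p) i \<noteq> 0 \<longrightarrow>
        hdim k (Delta L p) i = 1 \<and> (\<forall>j. hdim k (Delta L p) j \<noteq> 0 \<longrightarrow> j = i)) \<and>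
     (\<forall>p\<in>L - {pbot L}. \<forall>q\<in>L - {pbot L}. \<forall>i.
        p \<noteq> q \<and> hdim k (Delta L p) i = 1 \<and> hdim k (Delta L q) i = 1 \<longrightarrow>
        \<not> p \<le> q \<and> \<not> q \<le> p)"


subsection \<open>The maps between the homology groups\<close>

text \<open>Connecting map of the Mayer--Vietoris sequence of \<open>K1 \<union> K2\<close>, in degree \<open>i\<close>.\<close>

definition mv_connect ::
  "'a::order set set \<Rightarrow> 'a set set \<Rightarrow> int \<Rightarrow> ('a set \<Rightarrow> 'k::field) set \<Rightarrow> ('a set \<Rightarrow> 'k) set" where
  "mv_connect K1 K2 i \<xi> = (THE \<zeta>. \<exists>z z' z''. z \<in> \<xi> \<and> z = z' + z'' \<and>
      z' \<in> chains K1 i \<and> z'' \<in> chains K2 i \<and> \<zeta> = hclass (K1 \<inter> K2) (i - 1) (bdry z'))"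

text \<open>Map into the homology of the larger complex \<open>K\<close> induced by inclusion.\<close>

definition h_incl ::
  "'a::order set set \<Rightarrow> int \<Rightarrow> ('a set \<Rightarrow> 'k::field) set \<Rightarrow> ('a set \<Rightarrow> 'k) set" where
  "h_incl K i \<xi> = (THE \<zeta>. \<exists>z\<in>\<xi>. \<zeta> = hclass K i z)"

definition phi ::
  "'a::order set \<Rightarrow> nat \<Rightarrow> 'a \<Rightarrow> 'a \<Rightarrow> ('a set \<Rightarrow> 'k::field) set \<Rightarrow> ('a set \<Rightarrow> 'k) set" where
  "phi Q i q p \<xi> = h_incl (Delta Q p) (int i - 3)
     (mv_connect (Delta_closed Q p) (\<Union>b\<in>{b. covers Q q b \<and> b \<noteq> p}. Delta_closed Q b)
        (int i - 2) \<xi>)"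


subsection \<open>Monomial ideals\<close>

text \<open>
  Monomials are exponent vectors \<open>'v \<Rightarrow> nat\<close> with \<open>'v\<close> a finite type of variables. Divisibility is
  then the pointwise order, the monomial \<open>1\<close> is \<open>0\<close>, the quotient of a monomial by a divisor is
  the difference, and the least common multiple of a finite set \<open>X\<close> is the pointwise maximum,
  that is \<open>Sup X\<close> (with \<open>Sup {} = 0\<close>).
\<close>

type_synonym 'v monom = "'v \<Rightarrow> nat"
type_synonym ('v, 'k) mpoly = "('v \<Rightarrow> nat) \<Rightarrow>\<^sub>0 'k"

definition monomial_ideal :: "('v, 'k::field) mpoly set \<Rightarrow> bool" where
  "monomial_ideal N \<longleftrightarrow> (\<exists>M. N = module.span (*) ((\<lambda>m. Poly_Mapping.single m 1) ` M))"

definition min_gens :: "('v, 'k::field) mpoly set \<Rightarrow> 'v monom set" where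
  "min_gens N = {m. Poly_Mapping.single m 1 \<in> N \<and>
     (\<forall>m'. Poly_Mapping.single m' 1 \<in> N \<and> m' \<le> m \<longrightarrow> m' = m)}"

definition lcm_lattice :: "('v, 'k::field) mpoly set \<Rightarrow> 'v monom set" where
  "lcm_lattice N = Sup ` Pow (min_gens N)"


subsection \<open>Multigraded free complexes and minimal free resolutions\<close>

text \<open>
  A complex of multigraded free modules with homogeneous bases \<open>gens i\<close>: the basis element \<open>e\<close> of
  \<open>F\<^sub>i\<close> has multidegree \<open>mdeg i e\<close>, and the entry of the \<open>i\<close>-th differential from \<open>e\<close> to the basis
  element \<open>e'\<close> of \<open>F\<^sub>i\<^sub>-\<^sub>1\<close> is the scalar \<open>coef i e e'\<close> times the quotient of the multidegrees.
  Elements of \<open>F\<^sub>i\<close> are coordinate vectors.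
\<close>

record ('e, 'v, 'k) based_complex =
  gens :: "nat \<Rightarrow> 'e set"
  mdeg :: "nat \<Rightarrow> 'e \<Rightarrow> 'v \<Rightarrow> nat"
  coef :: "nat \<Rightarrow> 'e \<Rightarrow> 'e \<Rightarrow> 'k"

definition free_mod ::
  "('e, 'v, 'k::field) based_complex \<Rightarrow> nat \<Rightarrow> ('e \<Rightarrow> ('v, 'k) mpoly) set" where
  "free_mod F i = {f. \<forall>e. e \<notin> gens F i \<longrightarrow> f e = 0}"

definition diffl :: "('e, 'v, 'k::field) based_complex \<Rightarrow> nat \<Rightarrow>
    ('e \<Rightarrow> ('v, 'k) mpoly) \<Rightarrow> 'e \<Rightarrow> ('v, 'k) mpoly" where
  "diffl F i f = (\<lambda>e'. if e' \<in> gens F (i - 1) then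
      \<Sum>e\<in>gens F i. f e * Poly_Mapping.single (mdeg F i e - mdeg F (i - 1) e') (coef F i e e')
    else 0)"

text \<open>
  \<open>F\<close> is a minimal free resolution of \<open>S/N\<close> with \<open>F\<^sub>0 = S\<close>. The last condition says that the
  images of the differentials lie in \<open>\<mm>F\<^sub>i\<^sub>-\<^sub>1\<close>, \<open>\<mm>\<close> being the ideal of the polynomials with constant
  term \<open>0\<close>.
\<close>

definition minimal_free_resolution ::
  "('e, 'v, 'k::field) based_complex \<Rightarrow> ('v, 'k) mpoly set \<Rightarrow> bool" where
  "minimal_free_resolution F N \<longleftrightarrow>
     (\<forall>i. finite (gens F i)) \<and>
     (\<forall>i\<ge>1. \<forall>e\<in>gens F i. \<forall>e'\<in>gens F (i - 1).
        coef F i e e' \<noteq> 0 \<longrightarrow> mdeg F (i - 1) e' \<le> mdeg F i e) \<and>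
     (\<exists>e0. gens F 0 = {e0} \<and> mdeg F 0 e0 = 0 \<and>
        (\<lambda>f. f e0) ` diffl F 1 ` free_mod F 1 = N) \<and>
     (\<forall>i\<ge>1. diffl F (i + 1) ` free_mod F (i + 1) = {f \<in> free_mod F i. diffl F i f = 0}) \<and>
     (\<forall>i\<ge>1. \<forall>f\<in>free_mod F i. \<forall>e. Poly_Mapping.lookup (diffl F i f e) 0 = 0)"


subsection \<open>Resolutions supported on a poset\<close>

text \<open>
  The basis of \<open>F\<^sub>i\<close> consists of the pairs \<open>(q, z)\<close> with \<open>z\<close> in the chosen basis of \<open>\<D>\<^sub>i\<^sub>,\<^sub>q\<close>. For
  \<open>i = 0\<close> the only summand is \<open>\<D>\<^sub>0\<close>, placed at \<open>q = pbot Q\<close>; the complex of the empty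
  face used for it is \<open>{{}}\<close>.
\<close>

definition poset_complex :: "'a::order set \<Rightarrow> ('a \<Rightarrow> 'v monom) \<Rightarrow>
    ('a \<times> ('a set \<Rightarrow> 'k::field), 'v, 'k) based_complex" where
  "poset_complex Q \<eta> = \<lparr>
     gens = (\<lambda>i. if i = 0 then {pbot Q} \<times> hbasis {{}} (-1)
        else SIGMA q : Q - {pbot Q}. hbasis (Delta Q q) (int i - 2)),
     mdeg = (\<lambda>i (q, z). \<eta> q),
     coef = (\<lambda>i (q, z) (p, w).
        if \<not> covers Q q p then 0
        else if i = 1 then hcoord {{}} (-1) (hclass {{}} (-1) z) w
        else hcoord (Delta Q p) (int i - 3) (phi Q i q p (hclass (Delta Q q) (int i - 2) z)) w)
   \<rparr>"

definition supported_on :: "('v, 'k::field) mpoly set \<Rightarrow> 'a::order set \<Rightarrow> bool" where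
  "supported_on N Q \<longleftrightarrow> (\<exists>\<eta> :: 'a \<Rightarrow> 'v monom. mono_on Q \<eta> \<and> \<eta> (pbot Q) = 0 \<and>
     minimal_free_resolution (poset_complex Q \<eta>) N)"


subsection \<open>Rigid deformations\<close>

definition relabel ::
  "('w monom \<Rightarrow> 'v monom) \<Rightarrow> ('e, 'w, 'k) based_complex \<Rightarrow> ('e, 'v, 'k) based_complex" where
  "relabel g F = \<lparr>gens = gens F, mdeg = (\<lambda>i e. g (mdeg F i e)), coef = coef F\<rparr>"

text \<open>
  The minimal free resolution is unique up to multigraded isomorphism, so it may be taken in any
  homogeneous bases; here these are indexed by natural numbers.
\<close>

definition rigid_deformation ::
  "('w, 'k::field) mpoly set \<Rightarrow> ('v, 'k) mpoly set \<Rightarrow> bool" where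
  "rigid_deformation J I \<longleftrightarrow> rigid TYPE('k) (lcm_lattice J) \<and>
     (\<exists>(F :: (nat, 'w, 'k) based_complex) (g :: 'w monom \<Rightarrow> 'v monom).
        minimal_free_resolution F J \<and>
        mono_on (betti_poset TYPE('k) (lcm_lattice J)) g \<and>
        minimal_free_resolution (relabel g F) I)"

end

theory Submission
  imports Defs "HOL-Library.Countable_Set"
begin

text \<open>
  All homology is computed at the level of chains, using that removing an element with acyclic
  link, or more generally passing to a subposet all of whose lower (or all of whose upper) fibres
  are acyclic, does not change the homology of an order complex. In particular the order complex of
  a down-set of a poset has the homology of its intersection with the Betti poset.

  Rigidity of \<open>P\<close> equips \<open>Q = B(P)\<close> with a strictly increasing rank such that the chains below an
  element of rank \<open>i\<close> have at most \<open>i - 1\<close> elements, while the only homology is a line in the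
  degree \<open>i - 2\<close> of the longest chains. So it is spanned by one cycle without boundaries to divide
  out, the maps \<open>\<phi>\<close> take a cycle to its links, and \<open>\<D>(U)\<close> is exact for every down-set \<open>U\<close> of \<open>Q\<close>
  whose order complex is acyclic. By multigrading, a labelling of \<open>Q\<close> gives a minimal resolution as
  soon as the elements whose label divides a given monomial of the ideal form an acyclic down-set and
  no nonzero entry connects equal labels.

  The map \<open>f\<close> from \<open>P\<close> to \<open>L\<close> has an upper adjoint \<open>g\<close> with \<open>f \<circ> g = id\<close>, so that \<open>(0, y)\<close> in \<open>L\<close> has
  the homology of its preimage. Attaching the elements of the fibre over \<open>y\<close> one after another to this
  preimage yields an acyclic complex, which bounds the Betti numbers of \<open>L\<close> at \<open>y\<close> by those of \<open>P\<close>
  on the fibre. As the total Betti numbers agree, equality holds throughout; this forces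
  \<open>f ` B(P) \<subseteq> B(L)\<close> and the vanishing of all entries between elements with equal image.
\<close>

section \<open>Chains, cones and links\<close>

text \<open>The labels taken from \<open>I\<close> see only the Betti poset of \<open>L'\<close>. An
  interval of the lcm-lattice of \<open>I\<close> corresponds in \<open>B(L)\<close> to a down-set
  that need not come from an interval of \<open>L\<close>, so acyclicity has to be carried from
  arbitrary down-sets of \<open>B(L)\<close> to their preimages in \<open>B(P)\<close>. This is
  where \<open>f\<close> mapping \<open>B(P)\<close> into \<open>B(L)\<close> is essential: it
  allows a comparison inside a poset that contains both the preimage and the copy of the down-set
  under \<open>g\<close>. Rigidity says only that comparable elements differ in homological degree;
  that the degree grows along the order has to be derived. Then \<open>B(P)\<close> behaves like a
  cell complex: the cone over the cycle of an element of rank \<open>i\<close> acts as a cell of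
  dimension \<open>i - 1\<close>, matrix entries are incidence numbers, and exactness is the
  comparison of cellular with simplicial homology. The two ideals of the deformation are resolved by
  one statement, applied to two retractions defined on the lcm-lattice of \<open>J\<close>: the
  identity and the map to \<open>L\<close>. The two complexes differ in their labels only, which is
  what relabelling asks for.\<close>

abbreviation ochains :: "'a::order set \<Rightarrow> int \<Rightarrow> ('a set \<Rightarrow> 'k::field) set" where
  "ochains A i \<equiv> chains (order_complex A) i"

text \<open>The incidence sign in \<open>bdry\<close>: the factor with which the face
  \<open>\<tau>\<close> occurs in the boundary of \<open>insert x \<tau>\<close>.\<close>

definition sg :: "'a::order \<Rightarrow> 'a set \<Rightarrow> 'k::field" where
  "sg x \<tau> = (-1) ^ card {y \<in> \<tau>. y < x}"

text \<open>The join with the vertex \<open>q\<close>. The sign is that of the face obtained by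
  deleting \<open>q\<close>, so that \<open>w\<close> reappears with coefficient 1 in the boundary
  and \<open>link\<close> is a left inverse on chains not involving \<open>q\<close>.\<close>

definition cone :: "'a::order \<Rightarrow> ('a set \<Rightarrow> 'k::field) \<Rightarrow> 'a set \<Rightarrow> 'k" where
  "cone q w \<sigma> = (if q \<in> \<sigma> then sg q (\<sigma> - {q}) * w (\<sigma> - {q}) else 0)"

definition link :: "'a::order \<Rightarrow> ('a set \<Rightarrow> 'k::field) \<Rightarrow> 'a set \<Rightarrow> 'k" where
  "link q c \<tau> = (if q \<in> \<tau> then 0 else sg q \<tau> * c (insert q \<tau>))"

definition avoid :: "'a \<Rightarrow> ('a set \<Rightarrow> 'k::zero) \<Rightarrow> 'a set \<Rightarrow> 'k" where
  "avoid q c \<sigma> = (if q \<in> \<sigma> then 0 else c \<sigma>)"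

text \<open>The vertex set of the link of \<open>q\<close> in the order complex of
  \<open>A\<close>.\<close>

definition comparables :: "'a::order set \<Rightarrow> 'a \<Rightarrow> 'a set" where
  "comparables A q = {x \<in> A. x < q \<or> q < x}"

text \<open>Pointwise scaling over an arbitrary field makes every function space, chain spaces
  included, an instance of the abstract vector spaces with \<open>span\<close> and
  \<open>dim\<close>.\<close>

definition fscale :: "'k::field \<Rightarrow> ('b \<Rightarrow> 'k) \<Rightarrow> 'b \<Rightarrow> 'k" where
  "fscale a f = (\<lambda>x. a * f x)"

lemma fscale_apply [simp]: "fscale a f x = a * f x"
  by (simp add: fscale_def)

interpretation fs: vector_space "fscale :: 'k::field \<Rightarrow> ('b \<Rightarrow> 'k) \<Rightarrow> 'b \<Rightarrow> 'k"
  by unfold_locales (auto simp: fun_eq_iff algebra_simps)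

lemma sum_apply: "(\<Sum>x\<in>S. f x) y = (\<Sum>x\<in>S. f x y)"
  for f :: "'c \<Rightarrow> 'b \<Rightarrow> 'k::comm_monoid_add"
  by (induction S rule: infinite_finite_induct) auto

lemma sg_square [simp]: "sg x \<tau> * (sg x \<tau> :: 'k::field) = 1"
  by (simp add: sg_def flip: power_add mult_2)

lemma sg_square' [simp]: "sg x \<tau> * ((sg x \<tau> :: 'k::field) * a) = a"
  by (simp flip: mult.assoc)

lemma sg_nonzero [simp]: "(sg x \<tau> :: 'k::field) \<noteq> 0"
  by (simp add: sg_def)

text \<open>Inserting the smaller vertex \<open>q\<close> moves \<open>x\<close> up by one position,
  whereas inserting \<open>x\<close> does not move \<open>q\<close>. This single sign change makes
  two deletions anticommute.\<close>

lemma sg_swap_less: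
  assumes "q < x" "finite \<rho>" "x \<notin> \<rho>" "q \<notin> \<rho>"
  shows "sg x (insert q \<rho>) * sg q (insert x \<rho>) = - ((sg q \<rho> :: 'k::field) * sg x \<rho>)"
proof -
  have "{y \<in> insert q \<rho>. y < x} = insert q {y \<in> \<rho>. y < x}"
    "{y \<in> insert x \<rho>. y < q} = {y \<in> \<rho>. y < q}"
    using assms by (auto simp: less_le_not_le)
  then show ?thesis
    using assms by (simp add: sg_def)
qed

lemma sg_swap:
  assumes "q < x \<or> x < q" "finite \<rho>" "x \<notin> \<rho>" "q \<notin> \<rho>"
  shows "sg x (insert q \<rho>) * sg q (insert x \<rho>) = - ((sg q \<rho> :: 'k::field) * sg x \<rho>)"
  using assms sg_swap_less[of q x \<rho>, where 'k='k] sg_swap_less[of x q \<rho>, where 'k='k]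
  by (auto simp: mult.commute)

section \<open>Chain spaces and linearity of the boundary\<close>

lemma ochainsI:
  assumes "\<And>\<sigma>. c \<sigma> \<noteq> 0 \<Longrightarrow> finite \<sigma> \<and> \<sigma> \<subseteq> A \<and> (\<forall>x\<in>\<sigma>. \<forall>y\<in>\<sigma>. x \<le> y \<or> y \<le> x) \<and> int (card \<sigma>) = i + 1"
  shows "c \<in> ochains A i"
  using assms by (auto simp: chains_def order_complex_def chain_def)

lemma ochainsD:
  assumes "c \<in> ochains A i" "c \<sigma> \<noteq> 0"
  shows "finite \<sigma>" "\<sigma> \<subseteq> A" "\<And>x y. x \<in> \<sigma> \<Longrightarrow> y \<in> \<sigma> \<Longrightarrow> x \<le> y \<or> y \<le> x" "int (card \<sigma>) = i + 1"
  using assms by (auto simp: chains_def order_complex_def chain_def)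

lemma ochains_zero [simp]: "0 \<in> ochains A i"
  by (simp add: chains_def)

lemma chains_subspace: "fs.subspace (chains K i :: ('a set \<Rightarrow> 'k::field) set)"
proof (rule fs.subspaceI)
  fix c d :: "'a set \<Rightarrow> 'k" assume "c \<in> chains K i" "d \<in> chains K i"
  then have "c \<sigma> = 0 \<and> d \<sigma> = 0" if "\<not> (\<sigma> \<in> K \<and> int (card \<sigma>) = i + 1)" for \<sigma>
    using that by (auto simp: chains_def)
  then show "c + d \<in> chains K i"
    by (fastforce simp: chains_def)
qed (auto simp: chains_def)

lemma ochains_add: "c \<in> ochains A i \<Longrightarrow> d \<in> ochains A i \<Longrightarrow> c + d \<in> ochains A i"
  and ochains_diff: "c \<in> ochains A i \<Longrightarrow> d \<in> ochains A i \<Longrightarrow> c - d \<in> ochains A i"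
  and ochains_minus: "c \<in> ochains A i \<Longrightarrow> - c \<in> ochains A i"
  and ochains_scale: "c \<in> ochains A i \<Longrightarrow> fscale a c \<in> ochains A i"
  using fs.subspace_add[OF chains_subspace] fs.subspace_diff[OF chains_subspace]
    fs.subspace_neg[OF chains_subspace] fs.subspace_scale[OF chains_subspace] by blast+

lemma ochains_sum: "(\<And>x. x \<in> S \<Longrightarrow> f x \<in> ochains A i) \<Longrightarrow> (\<Sum>x\<in>S. f x) \<in> ochains A i"
  using fs.subspace_sum[OF chains_subspace] by blast

lemma ochains_mono: "c \<in> ochains A i \<Longrightarrow> A \<subseteq> B \<Longrightarrow> c \<in> ochains B i"
  by (auto simp: chains_def order_complex_def)

lemma ochains_Int: "c \<in> ochains A i \<Longrightarrow> c \<in> ochains B j \<Longrightarrow> c \<in> ochains (A \<inter> B) i"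
  by (auto simp: chains_def order_complex_def)

lemma bdry_eq_sum:
  assumes "finite A" "\<And>\<sigma>. c \<sigma> \<noteq> 0 \<Longrightarrow> \<sigma> \<subseteq> A"
  shows "bdry c \<tau> = (\<Sum>x\<in>A - \<tau>. sg x \<tau> * c (insert x \<tau>))"
  unfolding bdry_def sg_def
  by (rule sum.mono_neutral_left) (use assms in auto)

lemma bdry_ochain:
  assumes "finite A" "c \<in> ochains A i"
  shows "bdry c \<tau> = (\<Sum>x\<in>A - \<tau>. sg x \<tau> * c (insert x \<tau>))"
  by (rule bdry_eq_sum) (use assms ochainsD in blast)+

lemma bdry_zero [simp]: "bdry 0 = 0"
  by (simp add: bdry_def fun_eq_iff)

lemma bdry_add:
  assumes "finite A" "c \<in> ochains A i" "d \<in> ochains A i"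
  shows "bdry (c + d) = bdry c + bdry d"
  using assms by (simp add: fun_eq_iff bdry_ochain[of A _ i] ochains_add distrib_left sum.distrib)

lemma bdry_scale:
  assumes "finite A" "c \<in> ochains A i"
  shows "bdry (fscale a c) = fscale a (bdry c)"
  using assms
  by (simp add: fun_eq_iff bdry_ochain[of A _ i] ochains_scale sum_distrib_left mult.left_commute)

lemma bdry_minus:
  assumes "finite A" "c \<in> ochains A i"
  shows "bdry (- c) = - bdry c"
  using assms by (simp add: fun_eq_iff bdry_ochain[of A _ i] ochains_minus sum_negf)

lemma bdry_diff:
  assumes "finite A" "c \<in> ochains A i" "d \<in> ochains A i"
  shows "bdry (c - d) = bdry c - bdry d"
  using assms
  by (simp add: fun_eq_iff bdry_ochain[of A _ i] ochains_diff right_diff_distrib sum_subtractf)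

lemma bdry_sum:
  assumes "finite A" "\<And>x. x \<in> S \<Longrightarrow> f x \<in> ochains A i"
  shows "bdry (\<Sum>x\<in>S. f x) = (\<Sum>x\<in>S. bdry (f x))"
  using assms(2)
proof (induction S rule: infinite_finite_induct)
  case (infinite S)
  then show ?case
    by (metis sum.infinite bdry_zero)
next
  case empty
  show ?case
    by (metis sum.empty bdry_zero)
next
  case (insert x S)
  have "bdry (sum f (insert x S)) = bdry (f x + sum f S)"
    using sum.insert[OF insert.hyps, of f] by (rule arg_cong)
  also have "\<dots> = bdry (f x) + bdry (sum f S)"
    by (rule bdry_add[of A _ i]) (use assms(1) insert in \<open>auto intro: ochains_sum\<close>)
  also have "bdry (sum f S) = (\<Sum>x\<in>S. bdry (f x))"
    using insert by blast
  also have "bdry (f x) + (\<Sum>x\<in>S. bdry (f x)) = (\<Sum>x\<in>insert x S. bdry (f x))"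
    by (rule sum.insert[OF insert.hyps, symmetric])
  finally show ?case .
qed

lemma bdry_in_ochains:
  assumes "finite A" "c \<in> ochains A i"
  shows "bdry c \<in> ochains A (i - 1)"
proof (rule ochainsI)
  fix \<tau> assume nz: "bdry c \<tau> \<noteq> 0"
  have "\<exists>x\<in>A - \<tau>. c (insert x \<tau>) \<noteq> 0"
    by (rule ccontr) (use nz in \<open>simp add: bdry_ochain[OF assms]\<close>)
  then obtain x where x: "x \<in> A - \<tau>" "c (insert x \<tau>) \<noteq> 0"
    by blast
  note * = ochainsD[OF assms(2) x(2)]
  have fin: "finite \<tau>"
    using *(1) by simp
  with * x show "finite \<tau> \<and> \<tau> \<subseteq> A \<and> (\<forall>x\<in>\<tau>. \<forall>y\<in>\<tau>. x \<le> y \<or> y \<le> x) \<and> int (card \<tau>) = i - 1 + 1"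
    by auto
qed

lemma bdry_in_ochains':
  "finite A \<Longrightarrow> c \<in> ochains A (i + 1) \<Longrightarrow> bdry c \<in> ochains A i"
  using bdry_in_ochains[of A c "i + 1"] by simp

section \<open>Boundaries of cones and links\<close>

lemma comparables_subset: "comparables A q \<subseteq> A - {q}"
  by (auto simp: comparables_def)

lemma cone_in_ochains:
  assumes "q \<in> A" "w \<in> ochains (comparables A q) i"
  shows "cone q w \<in> ochains A (i + 1)"
proof (rule ochainsI)
  fix \<sigma> assume "cone q w \<sigma> \<noteq> 0"
  then have q: "q \<in> \<sigma>" and w: "w (\<sigma> - {q}) \<noteq> 0"
    by (auto simp: cone_def split: if_splits)
  note * = ochainsD[OF assms(2) w]
  have "\<sigma> = insert q (\<sigma> - {q})"
    using q by auto
  moreover have fin: "finite \<sigma>"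
    using *(1) by simp
  moreover have "card \<sigma> = Suc (card (\<sigma> - {q}))"
    using fin q by (metis card_Suc_Diff1)
  moreover have "\<sigma> \<subseteq> A"
    using *(2) assms(1) by (auto simp: comparables_def)
  moreover have "x \<le> y \<or> y \<le> x" if "x \<in> \<sigma>" "y \<in> \<sigma>" for x y
  proof (cases "x = q \<or> y = q")
    case True
    then show ?thesis
      using *(2) that by (auto simp: comparables_def less_le_not_le)
  next
    case False
    then show ?thesis using *(3) that by auto
  qed
  ultimately show "finite \<sigma> \<and> \<sigma> \<subseteq> A \<and> (\<forall>x\<in>\<sigma>. \<forall>y\<in>\<sigma>. x \<le> y \<or> y \<le> x) \<and> int (card \<sigma>) = i + 1 + 1"
    using *(4) by auto
qed

lemma link_in_ochains:
  assumes "c \<in> ochains A i"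
  shows "link q c \<in> ochains (comparables A q) (i - 1)"
proof (rule ochainsI)
  fix \<tau> assume "link q c \<tau> \<noteq> 0"
  then have q: "q \<notin> \<tau>" and c: "c (insert q \<tau>) \<noteq> 0"
    by (auto simp: link_def split: if_splits)
  note * = ochainsD[OF assms c]
  have fin: "finite \<tau>"
    using *(1) by simp
  have "x < q \<or> q < x" if "x \<in> \<tau>" for x
    using that q *(3)[of x q] by (metis insertI1 insertI2 order_le_less)
  with fin * q show "finite \<tau> \<and> \<tau> \<subseteq> comparables A q \<and> (\<forall>x\<in>\<tau>. \<forall>y\<in>\<tau>. x \<le> y \<or> y \<le> x) \<and>
      int (card \<tau>) = i - 1 + 1"
    by (auto simp: comparables_def)
qed

lemma avoid_in_ochains: "c \<in> ochains A i \<Longrightarrow> avoid q c \<in> ochains (A - {q}) i"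
  by (rule ochainsI) (auto simp: avoid_def dest: ochainsD split: if_splits)

lemma cone_link_avoid: "c = cone q (link q c) + avoid q c"
  by (auto simp: fun_eq_iff cone_def link_def avoid_def insert_absorb)

lemma link_cone: "(\<And>\<sigma>. w \<sigma> \<noteq> 0 \<Longrightarrow> q \<notin> \<sigma>) \<Longrightarrow> link q (cone q w) = w"
  by (auto simp: fun_eq_iff cone_def link_def)

lemma link_cone_comparables: "w \<in> ochains (comparables A q) i \<Longrightarrow> link q (cone q w) = w"
  using ochainsD(2)[of w "comparables A q" i] by (intro link_cone) (auto simp: comparables_def)

lemma link_add: "link q (c + d) = link q c + link q d"
  and link_diff: "link q (c - d) = link q c - link q d"
  and link_zero [simp]: "link q 0 = 0"
  and link_scale: "link q (fscale a c) = fscale a (link q c)"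
  by (auto simp: fun_eq_iff link_def algebra_simps)

lemma link_sum: "link q (\<Sum>x\<in>S. f x) = (\<Sum>x\<in>S. link q (f x))"
  by (auto simp: fun_eq_iff link_def sum_apply sum_distrib_left)

lemma cone_add: "cone q (c + d) = cone q c + cone q d"
  and cone_zero [simp]: "cone q 0 = 0"
  and cone_minus: "cone q (- c) = - cone q c"
  by (auto simp: fun_eq_iff cone_def algebra_simps)

lemma link_eq_0: "c \<in> ochains A i \<Longrightarrow> q \<notin> A \<Longrightarrow> link q c = 0"
  using ochainsD(2)[of c A i] unfolding fun_eq_iff link_def zero_fun_apply
  by (metis insert_subset mult_zero_right)

text \<open>On faces avoiding \<open>q\<close> only the deletion of \<open>q\<close> contributes,
  and its sign cancels against that of the cone. On faces containing \<open>q\<close> every other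
  deletion anticommutes with joining \<open>q\<close>, whence the minus sign.\<close>

lemma bdry_cone:
  assumes "finite A" "q \<in> A" "w \<in> ochains (comparables A q) i"
  shows "bdry (cone q w) = w - cone q (bdry w)"
proof
  fix \<tau>
  have cone: "cone q w \<in> ochains A (i + 1)"
    by (rule cone_in_ochains) fact+
  have w: "w \<in> ochains A i"
    by (rule ochains_mono[OF assms(3)]) (use comparables_subset in auto)
  have noq: "w \<sigma> = 0" if "q \<in> \<sigma>" for \<sigma>
    using ochainsD(2)[OF assms(3), of \<sigma>] that by (auto simp: comparables_def)
  show "bdry (cone q w) \<tau> = (w - cone q (bdry w)) \<tau>"
  proof (cases "q \<in> \<tau>")
    case False
    have "bdry (cone q w) \<tau> = (\<Sum>x\<in>A - \<tau>. if x = q then w \<tau> else 0)"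
      unfolding bdry_ochain[OF assms(1) cone]
      using False by (intro sum.cong) (auto simp: cone_def)
    also have "\<dots> = w \<tau>"
      using False assms(1,2) by simp
    finally show ?thesis
      using False by (simp add: cone_def)
  next
    case True
    define \<rho> where "\<rho> = \<tau> - {q}"
    have \<tau>: "\<tau> = insert q \<rho>" "q \<notin> \<rho>"
      using True by (auto simp: \<rho>_def)
    have "bdry (cone q w) \<tau> = (\<Sum>x\<in>A - \<tau>. - (sg q \<rho> * (sg x \<rho> * w (insert x \<rho>))))"
      unfolding bdry_ochain[OF assms(1) cone]
    proof (rule sum.cong[OF refl])
      fix x assume x: "x \<in> A - \<tau>"
      have "insert x \<tau> - {q} = insert x \<rho>"
        using x \<tau> by auto
      then have *: "sg x \<tau> * cone q w (insert x \<tau>) = (sg x (insert q \<rho>) * sg q (insert x \<rho>)) * w (insert x \<rho>)"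
        using \<tau> by (simp add: cone_def)
      show "sg x \<tau> * cone q w (insert x \<tau>) = - (sg q \<rho> * (sg x \<rho> * w (insert x \<rho>)))"
      \<comment> \<open>The sign rule needs \<open>x\<close> comparable with \<open>q\<close>, which
        is known only where \<open>w\<close> does not vanish.\<close>
      proof (cases "w (insert x \<rho>) = 0")
        case False
        then have "q < x \<or> x < q" "finite \<rho>"
          using ochainsD(1,2)[OF assms(3) False] by (auto simp: comparables_def)
        then show ?thesis
          unfolding * using x \<tau> by (subst sg_swap) auto
      qed (simp add: *)
    qed
    also have "\<dots> = - (sg q \<rho> * (\<Sum>x\<in>A - \<tau>. sg x \<rho> * w (insert x \<rho>)))"
      by (simp add: sum_negf sum_distrib_left)
    also have "(\<Sum>x\<in>A - \<tau>. sg x \<rho> * w (insert x \<rho>)) = (\<Sum>x\<in>A - \<rho>. sg x \<rho> * w (insert x \<rho>))"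
      using assms(1) \<tau> by (intro sum.mono_neutral_left) (auto simp: noq)
    also have "\<dots> = bdry w \<rho>"
      by (rule bdry_ochain[OF assms(1) w, symmetric])
    finally have "bdry (cone q w) \<tau> = - (sg q \<rho> * bdry w \<rho>)" .
    then show ?thesis
      using True by (simp add: noq cone_def[of q "bdry w"] \<rho>_def)
  qed
qed

lemma finite_comparables: "finite A \<Longrightarrow> finite (comparables A q)"
  by (simp add: comparables_def)

text \<open>The formula for cones, applied to the splitting of \<open>c\<close> into faces
  containing \<open>q\<close> and faces avoiding it. Many later arguments compare the two kinds of
  faces in this identity.\<close>

lemma bdry_decompose:
  assumes "finite A" "q \<in> A" "c \<in> ochains A i"
  shows "bdry c = link q c - cone q (bdry (link q c)) + bdry (avoid q c)"
proof -
  have l: "link q c \<in> ochains (comparables A q) (i - 1)"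
    by (rule link_in_ochains) fact
  have "cone q (link q c) \<in> ochains A i"
    using cone_in_ochains[OF assms(2) l] by simp
  moreover have "avoid q c \<in> ochains A i"
    by (rule ochains_mono[OF avoid_in_ochains]) (use assms in auto)
  ultimately have "bdry (cone q (link q c) + avoid q c) = bdry (cone q (link q c)) + bdry (avoid q c)"
    by (rule bdry_add[OF assms(1)])
  also have "bdry (cone q (link q c)) = link q c - cone q (bdry (link q c))"
    by (rule bdry_cone[OF assms(1,2) l])
  finally have "bdry (cone q (link q c) + avoid q c) =
      link q c - cone q (bdry (link q c)) + bdry (avoid q c)" .
  moreover have "bdry c = bdry (cone q (link q c) + avoid q c)"
    by (rule arg_cong[OF cone_link_avoid])
  ultimately show ?thesis
    by (metis (no_types))
qed

text \<open>The component of \<open>bdry_decompose\<close> on faces containing \<open>q\<close>. In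
  particular, links of cycles are cycles.\<close>

lemma link_bdry:
  assumes "finite A" "c \<in> ochains A i"
  shows "link q (bdry c) = - bdry (link q c)"
proof (cases "q \<in> A")
  case True
  have l: "link q c \<in> ochains (comparables A q) (i - 1)"
    by (rule link_in_ochains) fact
  have bl: "bdry (link q c) \<in> ochains (comparables A q) (i - 1 - 1)"
    by (rule bdry_in_ochains[OF finite_comparables]) fact+
  have "link q (link q c) = 0"
    by (rule link_eq_0[OF l]) (simp add: comparables_def)
  moreover have "link q (bdry (avoid q c)) = 0"
    by (rule link_eq_0[OF bdry_in_ochains[OF _ avoid_in_ochains]]) (use assms in auto)
  moreover have "link q (cone q (bdry (link q c))) = bdry (link q c)"
    by (rule link_cone_comparables) fact
  ultimately show ?thesis
    unfolding bdry_decompose[OF assms(1) True assms(2)] by (simp add: link_add link_diff)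
next
  case False
  then show ?thesis
    using link_eq_0[OF assms(2) False] link_eq_0[OF bdry_in_ochains[OF assms] False] by simp
qed

text \<open>Induction on the ambient set replaces the cancellation in a double sum: the link lives
  on \<open>comparables A q\<close> and the rest on \<open>A - {q}\<close>, both smaller, and the
  cone formula settles the mixed terms.\<close>

lemma bdry_bdry:
  assumes "finite A" "c \<in> ochains A i"
  shows "bdry (bdry c) = 0"
  using assms
proof (induction "card A" arbitrary: A c i rule: less_induct)
  case less
  show ?case
  proof (cases "A = {}")
    case True
    then have "bdry c = 0"
      by (auto simp: fun_eq_iff bdry_ochain[OF less.prems])
    then show ?thesis by simp
  next
    case False
    then obtain q where q: "q \<in> A" by blast
    let ?w = "link q c" and ?d = "avoid q c"
    have l: "?w \<in> ochains (comparables A q) (i - 1)"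
      by (rule link_in_ochains) fact
    have lA: "?w \<in> ochains A (i - 1)"
      by (rule ochains_mono[OF l]) (use comparables_subset in auto)
    have d: "?d \<in> ochains (A - {q}) i"
      by (rule avoid_in_ochains) fact
    have dA: "?d \<in> ochains A i"
      by (rule ochains_mono[OF d]) auto
    have bl: "bdry ?w \<in> ochains (comparables A q) (i - 1 - 1)"
      by (rule bdry_in_ochains[OF finite_comparables]) fact+
    have "bdry (bdry ?w) = 0"
      by (rule less.hyps[OF _ _ l])
        (use less.prems q in \<open>auto simp: comparables_def intro!: psubset_card_mono\<close>)
    moreover have "bdry (bdry ?d) = 0"
      by (rule less.hyps[OF _ _ d])
        (use less.prems q in \<open>auto intro!: card_Diff1_less simp del: card_Diff_insert card_Diff_singleton\<close>)
    moreover have "bdry (?w - cone q (bdry ?w) + bdry ?d)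
        = bdry ?w - bdry (cone q (bdry ?w)) + bdry (bdry ?d)"
    proof -
      have c: "cone q (bdry ?w) \<in> ochains A (i - 1)"
        using cone_in_ochains[OF q bl] by simp
      have "bdry ?d \<in> ochains A (i - 1)"
        by (rule bdry_in_ochains) fact+
      then show ?thesis
        using bdry_add[OF less.prems(1) ochains_diff[OF lA c], of "bdry ?d"]
          bdry_diff[OF less.prems(1) lA c] by simp
    qed
    ultimately show ?thesis
      unfolding bdry_decompose[OF less.prems(1) q less.prems(2)]
      by (simp add: bdry_cone[OF less.prems(1) q bl])
  qed
qed

section \<open>Acyclicity and fibres\<close>

text \<open>All degrees are included, also -1: over the empty set the empty face is a cycle that
  bounds nothing, so acyclic sets are nonempty.\<close>

definition acyclic_over :: "'k::field itself \<Rightarrow> 'a::order set \<Rightarrow> bool" where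
  "acyclic_over k A \<longleftrightarrow> (\<forall>i. \<forall>z\<in>(ochains A i :: ('a set \<Rightarrow> 'k) set).
     bdry z = 0 \<longrightarrow> (\<exists>d\<in>ochains A (i + 1). bdry d = z))"

text \<open>Vanishing of the homology of the pair, that is, the inclusion of \<open>X\<close> in \<open>A\<close> induces
  isomorphisms in homology.\<close>

definition rel_acyclic :: "'k::field itself \<Rightarrow> 'a::order set \<Rightarrow> 'a set \<Rightarrow> bool" where
  "rel_acyclic k X A \<longleftrightarrow> X \<subseteq> A \<and> (\<forall>i. \<forall>c\<in>(ochains A i :: ('a set \<Rightarrow> 'k) set).
     bdry c \<in> ochains X (i - 1) \<longrightarrow> (\<exists>d\<in>ochains A (i + 1). c - bdry d \<in> ochains X i))"

lemma acyclic_overD: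
  fixes z :: "'a::order set \<Rightarrow> 'k::field"
  assumes "acyclic_over TYPE('k) A" "z \<in> ochains A i" "bdry z = 0"
  obtains d where "d \<in> ochains A (i + 1)" "bdry d = z"
  using assms unfolding acyclic_over_def by blast

lemma rel_acyclicD:
  fixes c :: "'a::order set \<Rightarrow> 'k::field"
  assumes "rel_acyclic TYPE('k) X A" "c \<in> ochains A i" "bdry c \<in> ochains X (i - 1)"
  obtains d where "d \<in> ochains A (i + 1)" "c - bdry d \<in> ochains X i"
  using assms unfolding rel_acyclic_def by blast

lemma rel_acyclic_refl: "rel_acyclic TYPE('k::field) A A"
  unfolding rel_acyclic_def
proof (intro conjI allI ballI impI)
  fix i and c :: "'a set \<Rightarrow> 'k"
  assume "c \<in> ochains A i"
  then have "c - bdry 0 \<in> ochains A i"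
    by simp
  then show "\<exists>d\<in>ochains A (i + 1). c - bdry d \<in> ochains A i"
    using ochains_zero by blast
qed simp

lemma rel_acyclic_trans:
  assumes "finite Z" "rel_acyclic TYPE('k::field) X Y" "rel_acyclic TYPE('k) Y Z"
  shows "rel_acyclic TYPE('k) X Z"
  unfolding rel_acyclic_def
proof (intro conjI allI ballI impI)
  have XY: "X \<subseteq> Y" and YZ: "Y \<subseteq> Z"
    using assms by (auto simp: rel_acyclic_def)
  then show "X \<subseteq> Z" by simp
  fix i and c :: "'a set \<Rightarrow> 'k"
  assume c: "c \<in> ochains Z i" and bc: "bdry c \<in> ochains X (i - 1)"
  obtain d where d: "d \<in> ochains Z (i + 1)" "c - bdry d \<in> ochains Y i"
    using rel_acyclicD[OF assms(3) c ochains_mono[OF bc XY]] .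
  have bd: "bdry d \<in> ochains Z i"
    using bdry_in_ochains'[OF assms(1) d(1)] .
  have "bdry (c - bdry d) = bdry c"
    using bdry_diff[OF assms(1) c bd] bdry_bdry[OF assms(1) d(1)] by simp
  then obtain e where e: "e \<in> ochains Y (i + 1)" "c - bdry d - bdry e \<in> ochains X i"
    using rel_acyclicD[OF assms(2) d(2)] bc by metis
  have eZ: "e \<in> ochains Z (i + 1)"
    using ochains_mono[OF e(1) YZ] .
  have "c - bdry (d + e) = c - bdry d - bdry e"
    using bdry_add[OF assms(1) d(1) eZ] by (simp add: algebra_simps)
  then show "\<exists>d\<in>ochains Z (i + 1). c - bdry d \<in> ochains X i"
    using e(2) ochains_add[OF d(1) eZ] by metis
qed

lemma acyclic_over_up:
  assumes "finite A" "rel_acyclic TYPE('k::field) X A" "acyclic_over TYPE('k) X"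
  shows "acyclic_over TYPE('k) A"
  unfolding acyclic_over_def
proof (intro allI ballI impI)
  fix i and z :: "'a set \<Rightarrow> 'k"
  assume z: "z \<in> ochains A i" "bdry z = 0"
  have XA: "X \<subseteq> A"
    using assms by (simp add: rel_acyclic_def)
  obtain d where d: "d \<in> ochains A (i + 1)" "z - bdry d \<in> ochains X i"
    using rel_acyclicD[OF assms(2) z(1)] z(2) by (metis ochains_zero)
  have "bdry (z - bdry d) = 0"
    using bdry_diff[OF assms(1) z(1) bdry_in_ochains'[OF assms(1) d(1)]] bdry_bdry[OF assms(1) d(1)] z(2)
    by simp
  then obtain e where e: "e \<in> ochains X (i + 1)" "bdry e = z - bdry d"
    using acyclic_overD[OF assms(3) d(2)] by metis
  have eA: "e \<in> ochains A (i + 1)"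
    using ochains_mono[OF e(1) XA] .
  have "bdry (d + e) = z"
    using bdry_add[OF assms(1) d(1) eA] e(2) by simp
  then show "\<exists>d\<in>ochains A (i + 1). bdry d = z"
    using ochains_add[OF d(1) eA] by blast
qed

text \<open>A chain \<open>d\<close> bounding \<open>z\<close> is a cycle relative to
  \<open>X\<close>, so up to a boundary it lies over \<open>X\<close>. This is injectivity of the
  map that the inclusion induces on homology.\<close>

lemma rel_acyclic_bounds:
  fixes z :: "'a::order set \<Rightarrow> 'k::field"
  assumes "finite A" "rel_acyclic TYPE('k) X A" "z \<in> ochains X i"
    and d: "d \<in> ochains A (i + 1)" "bdry d = z"
  obtains e where "e \<in> ochains X (i + 1)" "bdry e = z"
proof -
  obtain e where e: "e \<in> ochains A (i + 1 + 1)" "d - bdry e \<in> ochains X (i + 1)"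
    using rel_acyclicD[OF assms(2) d(1)] assms(3) d(2) by (metis add_diff_cancel_right')
  have "bdry (d - bdry e) = z"
    using bdry_diff[OF assms(1) d(1) bdry_in_ochains'[OF assms(1) e(1)]] bdry_bdry[OF assms(1) e(1)] d(2)
    by simp
  with e(2) show thesis by (rule that)
qed

lemma acyclic_over_down:
  assumes "finite A" "rel_acyclic TYPE('k::field) X A" "acyclic_over TYPE('k) A"
  shows "acyclic_over TYPE('k) X"
  unfolding acyclic_over_def
proof (intro allI ballI impI)
  fix i and z :: "'a set \<Rightarrow> 'k"
  assume z: "z \<in> ochains X i" "bdry z = 0"
  have XA: "X \<subseteq> A"
    using assms by (simp add: rel_acyclic_def)
  obtain d where d: "d \<in> ochains A (i + 1)" "bdry d = z"
    using acyclic_overD[OF assms(3) ochains_mono[OF z(1) XA] z(2)] .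
  show "\<exists>d\<in>ochains X (i + 1). bdry d = z"
    using rel_acyclic_bounds[OF assms(1,2) z(1) d] by metis
qed

text \<open>Adding the boundary of \<open>cone q v\<close> changes the link at \<open>q\<close> by
  \<open>bdry v\<close>, at the price of adding \<open>v\<close> to the faces avoiding
  \<open>q\<close>. It is the elementary move that pushes chains off \<open>q\<close> or improves
  their links.\<close>

lemma bdry_add_cone:
  assumes "finite A" "q \<in> A" "c \<in> ochains A i" "v \<in> ochains (comparables A q) i"
  shows "bdry (cone q v) \<in> ochains A i"
    and "c + bdry (cone q v) = cone q (link q c - bdry v) + (avoid q c + v)"
    and "avoid q c + v \<in> ochains (A - {q}) i"
proof -
  show "bdry (cone q v) \<in> ochains A i"
    by (rule bdry_in_ochains'[OF assms(1) cone_in_ochains[OF assms(2,4)]])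
  have "c + bdry (cone q v) = (cone q (link q c) + avoid q c) + (v - cone q (bdry v))"
    unfolding bdry_cone[OF assms(1,2,4)] using cone_link_avoid[of c q] by argo
  also have "\<dots> = cone q (link q c - bdry v) + (avoid q c + v)"
    using cone_add[of q "link q c" "- bdry v"] by (simp add: cone_minus)
  finally show "c + bdry (cone q v) = cone q (link q c - bdry v) + (avoid q c + v)" .
  show "avoid q c + v \<in> ochains (A - {q}) i"
    by (intro ochains_add avoid_in_ochains ochains_mono[OF assms(4)] assms(3) comparables_subset)
qed

text \<open>The link at \<open>q\<close> of a relative cycle is a cycle, hence of the form
  \<open>bdry v\<close> by assumption, and the cone over \<open>v\<close> pushes the chain off
  \<open>q\<close>.\<close>

lemma rel_acyclic_remove:
  assumes "finite A" "q \<in> A" "acyclic_over TYPE('k::field) (comparables A q)"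
  shows "rel_acyclic TYPE('k) (A - {q}) A"
  unfolding rel_acyclic_def
proof (intro conjI allI ballI impI)
  fix i and c :: "'a set \<Rightarrow> 'k"
  assume c: "c \<in> ochains A i" and bc: "bdry c \<in> ochains (A - {q}) (i - 1)"
  have l: "link q c \<in> ochains (comparables A q) (i - 1)"
    by (rule link_in_ochains) fact
  have "link q (bdry c) = 0"
    by (rule link_eq_0[OF bc]) simp
  then have "bdry (link q c) = 0"
    using link_bdry[OF assms(1) c, of q] by simp
  then obtain v where v: "v \<in> ochains (comparables A q) (i - 1 + 1)" "bdry v = link q c"
    using acyclic_overD[OF assms(3) l] by metis
  then have v': "v \<in> ochains (comparables A q) i" by simp
  note * = bdry_add_cone[OF assms(1,2) c v']
  have cv: "cone q v \<in> ochains A (i + 1)"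
    by (rule cone_in_ochains[OF assms(2) v'])
  have "c - bdry (- cone q v) = avoid q c + v"
    using *(2) bdry_minus[OF assms(1) cv] by (simp add: v(2))
  then show "\<exists>d\<in>ochains A (i + 1). c - bdry d \<in> ochains (A - {q}) i"
    using *(3) ochains_minus[OF cv] by metis
qed auto

text \<open>Here \<open>q\<close> stays. The link of a relative cycle is a relative cycle and can be
  moved into \<open>X\<close>; then the cone part lies over \<open>A \<inter> X\<close>, and what
  remains avoids \<open>q\<close> and is treated in \<open>A - {q}\<close>.\<close>

lemma rel_acyclic_insert:
  assumes "finite A" "q \<in> A" "q \<in> X"
    and "rel_acyclic TYPE('k::field) (comparables A q \<inter> X) (comparables A q)"
    and "rel_acyclic TYPE('k) ((A - {q}) \<inter> X) (A - {q})"
  shows "rel_acyclic TYPE('k) (A \<inter> X) A"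
  unfolding rel_acyclic_def
proof (intro conjI allI ballI impI)
  fix i and c :: "'a set \<Rightarrow> 'k"
  assume c: "c \<in> ochains A i" and bc: "bdry c \<in> ochains (A \<inter> X) (i - 1)"
  let ?L = "comparables A q"
  have l: "link q c \<in> ochains ?L (i - 1)"
    by (rule link_in_ochains) fact
  have "bdry (link q c) = - link q (bdry c)"
    using link_bdry[OF assms(1) c] by simp
  also have "\<dots> \<in> ochains (comparables (A \<inter> X) q) (i - 1 - 1)"
    by (intro ochains_minus link_in_ochains bc)
  also have "comparables (A \<inter> X) q = ?L \<inter> X"
    by (auto simp: comparables_def)
  finally obtain v where v: "v \<in> ochains ?L (i - 1 + 1)" "link q c - bdry v \<in> ochains (?L \<inter> X) (i - 1)"
    using rel_acyclicD[OF assms(4) l] by metis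
  then have v': "v \<in> ochains ?L i" by simp
  define x where "x = link q c - bdry v"
  define c' where "c' = avoid q c + v"
  note * = bdry_add_cone[OF assms(1,2) c v', folded x_def c'_def]
  have cx: "cone q x \<in> ochains (A \<inter> X) i"
  proof -
    have "?L \<inter> X = comparables (A \<inter> X) q"
      by (auto simp: comparables_def)
    then show ?thesis
      using cone_in_ochains[of q "A \<inter> X" x "i - 1"] v(2) assms(2,3) by (simp add: x_def)
  qed
  have cxA: "cone q x \<in> ochains A i"
    by (rule ochains_mono[OF cx]) auto
  have c'A: "c' \<in> ochains A i"
    by (rule ochains_mono[OF *(3)]) auto
  have cv: "cone q v \<in> ochains A (i + 1)"
    by (rule cone_in_ochains[OF assms(2) v'])
  have eq: "c + bdry (cone q v) = cone q x + c'"
    by (rule *(2))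
  have "bdry (c + bdry (cone q v)) = bdry c"
    using bdry_add[OF assms(1) c *(1)] bdry_bdry[OF assms(1) cv] by simp
  then have "bdry c' = bdry c - bdry (cone q x)"
    unfolding eq using bdry_add[OF assms(1) cxA c'A] by (simp add: eq_diff_eq add.commute)
  also have "\<dots> \<in> ochains (A \<inter> X) (i - 1)"
    by (intro ochains_diff bc bdry_in_ochains cx) (use assms(1) in auto)
  finally have "bdry c' \<in> ochains ((A - {q}) \<inter> (A \<inter> X)) (i - 1)"
    using bdry_in_ochains[OF _ *(3)] assms(1) by (intro ochains_Int[of _ "A - {q}" "i - 1" "A \<inter> X" "i - 1"]) auto
  then have "bdry c' \<in> ochains ((A - {q}) \<inter> X) (i - 1)"
    by (rule ochains_mono) auto
  then obtain d where d: "d \<in> ochains (A - {q}) (i + 1)" "c' - bdry d \<in> ochains ((A - {q}) \<inter> X) i"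
    using rel_acyclicD[OF assms(5) *(3)] by metis
  have dA: "d \<in> ochains A (i + 1)"
    by (rule ochains_mono[OF d(1)]) auto
  have "c - bdry (d - cone q v) = (c + bdry (cone q v)) - bdry d"
    unfolding bdry_diff[OF assms(1) dA cv] by (rule diff_diff_eq2)
  also have "\<dots> = cone q x + (c' - bdry d)"
    unfolding eq by (rule add_diff_eq[symmetric])
  also have "\<dots> \<in> ochains (A \<inter> X) i"
    by (intro ochains_add cx ochains_mono[OF d(2)]) auto
  finally show "\<exists>d\<in>ochains A (i + 1). c - bdry d \<in> ochains (A \<inter> X) i"
    using ochains_diff[OF dA cv] by blast
qed auto

lemma finite_maximal_exists:
  fixes A :: "'a::order set"
  assumes "finite A" "A \<noteq> {}"
  obtains q where "q \<in> A" "\<And>x. x \<in> A \<Longrightarrow> \<not> q < x"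
  using finite_has_maximal[OF assms] by (metis less_le)

lemma finite_minimal_exists:
  fixes A :: "'a::order set"
  assumes "finite A" "A \<noteq> {}"
  obtains q where "q \<in> A" "\<And>x. x \<in> A \<Longrightarrow> \<not> x < q"
  using finite_has_minimal[OF assms] by (metis less_le)

text \<open>A fibre lemma in the style of Quillen, for both directions of the order at once. An
  element \<open>q\<close> that is last for \<open>R\<close> occurs in no other fibre, so the fibres
  of the remaining elements are the same in \<open>A - {q}\<close> and in the link of
  \<open>q\<close>, and induction applies to both sets.\<close>

lemma rel_acyclic_if_fibers_acyclic:
  assumes "finite A" and R: "R = (<) \<or> R = (>)"
    and "\<And>y. y \<in> A - X \<Longrightarrow> acyclic_over TYPE('k::field) {x \<in> A \<inter> X. R x y}"
  shows "rel_acyclic TYPE('k) (A \<inter> X) A"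
  using assms(1,3)
proof (induction "card A" arbitrary: A rule: less_induct)
  case less
  show ?case
  proof (cases "A = {}")
    case True
    then show ?thesis
      using rel_acyclic_refl[of "{}"] by simp
  next
    case False
    then obtain q where q: "q \<in> A" "\<And>x. x \<in> A \<Longrightarrow> \<not> R q x"
      using R finite_maximal_exists[OF less.prems(1)] finite_minimal_exists[OF less.prems(1)] by metis
    have trans: "R x z" if "R x y" "R y z" for x y z
      using R that by auto
    have L: "comparables A q = {x \<in> A. R x q}"
      using R q by (auto simp: comparables_def)
    have IH1: "rel_acyclic TYPE('k) (comparables A q \<inter> X) (comparables A q)"
    proof (rule less.hyps)
      show "card (comparables A q) < card A"
        using less.prems(1) q(1) by (intro psubset_card_mono) (auto simp: comparables_def)
      fix y assume y: "y \<in> comparables A q - X"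
      then have "{x \<in> comparables A q \<inter> X. R x y} = {x \<in> A \<inter> X. R x y}"
        using trans[of _ y q] by (auto simp: L)
      then show "acyclic_over TYPE('k) {x \<in> comparables A q \<inter> X. R x y}"
        using less.prems(2)[of y] y by (simp add: L)
    qed (use less.prems(1) in \<open>auto intro: finite_comparables\<close>)
    have IH2: "rel_acyclic TYPE('k) ((A - {q}) \<inter> X) (A - {q})"
    proof (rule less.hyps)
      show "card (A - {q}) < card A"
        using less.prems(1) q(1) by (rule card_Diff1_less)
      fix y assume y: "y \<in> A - {q} - X"
      then have "{x \<in> (A - {q}) \<inter> X. R x y} = {x \<in> A \<inter> X. R x y}"
        using q(2) by auto
      then show "acyclic_over TYPE('k) {x \<in> (A - {q}) \<inter> X. R x y}"
        using less.prems(2)[of y] y by simp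
    qed (use less.prems(1) in auto)
    show ?thesis
    proof (cases "q \<in> X")
      case True
      show ?thesis
        by (rule rel_acyclic_insert[OF less.prems(1) q(1) True IH1 IH2])
    next
      case False
      have "comparables A q \<inter> X = {x \<in> A \<inter> X. R x q}"
        by (auto simp: L)
      then have "acyclic_over TYPE('k) (comparables A q \<inter> X)"
        using less.prems(2)[of q] q(1) False by simp
      then have "acyclic_over TYPE('k) (comparables A q)"
        using acyclic_over_up[OF _ IH1] less.prems(1) finite_comparables by blast
      then have "rel_acyclic TYPE('k) (A - {q}) A"
        by (rule rel_acyclic_remove[OF less.prems(1) q(1)])
      moreover have "(A - {q}) \<inter> X = A \<inter> X"
        using False by auto
      ultimately show ?thesis
        using rel_acyclic_trans[OF less.prems(1) IH2] by simp
    qed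
  qed
qed

lemmas rel_acyclic_if_lower_fibers_acyclic = rel_acyclic_if_fibers_acyclic[OF _ disjI1[OF refl]]
  and rel_acyclic_if_upper_fibers_acyclic = rel_acyclic_if_fibers_acyclic[OF _ disjI2[OF refl]]

text \<open>A cycle is bounded by the cone over its part avoiding the apex: the boundary of that
  part is minus the link, which supplies the missing faces.\<close>

lemma acyclic_over_cone:
  assumes "finite A" "q \<in> A" "\<And>x. x \<in> A \<Longrightarrow> x \<le> q \<or> q \<le> x"
  shows "acyclic_over TYPE('k::field) A"
  unfolding acyclic_over_def
proof (intro allI ballI impI)
  fix i and z :: "'a set \<Rightarrow> 'k"
  assume z: "z \<in> ochains A i" "bdry z = 0"
  have L: "comparables A q = A - {q}"
    using assms(3) by (auto simp: comparables_def order_le_less)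
  have a: "avoid q z \<in> ochains (comparables A q) i"
    unfolding L by (rule avoid_in_ochains) fact
  have "bdry (link q z) = 0"
    using link_bdry[OF assms(1) z(1), of q] z(2) by simp
  then have "bdry (avoid q z) = - link q z"
    using bdry_decompose[OF assms(1,2) z(1)] z(2) by (simp add: eq_neg_iff_add_eq_0 add.commute)
  then have "bdry (cone q (avoid q z)) = avoid q z + cone q (link q z)"
    by (simp add: bdry_cone[OF assms(1,2) a] cone_minus)
  then have "bdry (cone q (avoid q z)) = z"
    using cone_link_avoid[of z q] by (simp only: add.commute)
  then show "\<exists>d\<in>ochains A (i + 1). bdry d = z"
    using cone_in_ochains[OF assms(2) a] by blast
qed

section \<open>Transport of chains along order isomorphisms\<close>

definition pull :: "'b set \<Rightarrow> ('b \<Rightarrow> 'a) \<Rightarrow> ('a set \<Rightarrow> 'k::zero) \<Rightarrow> 'b set \<Rightarrow> 'k" where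
  "pull B e c \<sigma> = (if \<sigma> \<subseteq> B then c (e ` \<sigma>) else 0)"

lemma poset_isoD:
  assumes "poset_iso B A e"
  shows "inj_on e B" "e ` B = A" "\<And>x y. x \<in> B \<Longrightarrow> y \<in> B \<Longrightarrow> e x \<le> e y \<longleftrightarrow> x \<le> y"
    "\<And>x y. x \<in> B \<Longrightarrow> y \<in> B \<Longrightarrow> e x < e y \<longleftrightarrow> x < y"
  using assms by (auto simp: poset_iso_def bij_betw_def less_le_not_le)

lemma poset_iso_inv:
  assumes "poset_iso B A e"
  shows "poset_iso A B (inv_into B e)"
  unfolding poset_iso_def
proof (intro conjI ballI)
  show "bij_betw (inv_into B e) A B"
    using assms by (simp add: poset_iso_def bij_betw_inv_into)
  fix x y assume "x \<in> A" "y \<in> A"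
  then show "x \<le> y \<longleftrightarrow> inv_into B e x \<le> inv_into B e y"
    using poset_isoD[OF assms] by (metis f_inv_into_f inv_into_into)
qed

lemma poset_iso_subset:
  assumes "poset_iso B A e" "C \<subseteq> B"
  shows "poset_iso C (e ` C) e"
  using assms by (auto simp: poset_iso_def intro: bij_betw_subset)

lemma pull_in_ochains:
  assumes "poset_iso B A e" "c \<in> ochains A i"
  shows "pull B e c \<in> ochains B i"
proof (rule ochainsI)
  fix \<sigma> assume "pull B e c \<sigma> \<noteq> 0"
  then have s: "\<sigma> \<subseteq> B" "c (e ` \<sigma>) \<noteq> 0"
    by (auto simp: pull_def split: if_splits)
  note * = ochainsD[OF assms(2) s(2)] and iso = poset_isoD[OF assms(1)]
  have inj: "inj_on e \<sigma>"
    using iso(1) s(1) by (rule inj_on_subset)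
  have "finite \<sigma>"
    using *(1) inj by (rule finite_imageD)
  moreover have "x \<le> y \<or> y \<le> x" if "x \<in> \<sigma>" "y \<in> \<sigma>" for x y
    using *(3)[of "e x" "e y"] iso(3) s(1) that by blast
  ultimately show "finite \<sigma> \<and> \<sigma> \<subseteq> B \<and> (\<forall>x\<in>\<sigma>. \<forall>y\<in>\<sigma>. x \<le> y \<or> y \<le> x) \<and> int (card \<sigma>) = i + 1"
    using *(4) s(1) card_image[OF inj] by simp
qed

text \<open>An order isomorphism keeps the position of every vertex in a chain, hence all
  signs.\<close>

lemma bdry_pull:
  assumes "finite B" "poset_iso B A e" "c \<in> ochains A i"
  shows "bdry (pull B e c) = pull B e (bdry c)"
proof
  fix \<tau>
  note iso = poset_isoD[OF assms(2)]
  have A: "finite A"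
    using iso(2) assms(1) by blast
  have p: "bdry (pull B e c) \<tau> = (\<Sum>x\<in>B - \<tau>. sg x \<tau> * pull B e c (insert x \<tau>))"
    by (rule bdry_ochain[OF assms(1) pull_in_ochains[OF assms(2,3)]])
  show "bdry (pull B e c) \<tau> = pull B e (bdry c) \<tau>"
  proof (cases "\<tau> \<subseteq> B")
    case True
    have "A - e ` \<tau> = e ` (B - \<tau>)"
      using iso(1,2) True by (metis inj_on_image_set_diff Diff_subset)
    moreover have "inj_on e (B - \<tau>)"
      using iso(1) by (rule inj_on_subset) auto
    moreover have "sg (e x) (e ` \<tau>) = (sg x \<tau> :: 'c)" if "x \<in> B" for x
    proof -
      have "{y \<in> e ` \<tau>. y < e x} = e ` {y \<in> \<tau>. y < x}"
        using True iso(4) that by auto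
      moreover have "inj_on e {y \<in> \<tau>. y < x}"
        by (rule inj_on_subset[OF iso(1)]) (use True in auto)
      ultimately show ?thesis
        by (simp add: sg_def card_image)
    qed
    ultimately show ?thesis
      unfolding p using True
      by (simp add: pull_def bdry_ochain[OF A assms(3)] sum.reindex)
  qed (simp add: p pull_def)
qed

lemma pull_inv:
  assumes "poset_iso B A e" "c \<in> ochains A i"
  shows "pull A (inv_into B e) (pull B e c) = c"
proof
  fix \<sigma>
  show "pull A (inv_into B e) (pull B e c) \<sigma> = c \<sigma>"
  proof (cases "\<sigma> \<subseteq> A")
    case True
    then have "inv_into B e ` \<sigma> \<subseteq> B" "e ` inv_into B e ` \<sigma> = \<sigma>"
      using poset_isoD(2)[OF assms(1)]
      by (auto intro: inv_into_into image_inv_into_cancel[of e B A \<sigma>, THEN equalityD1, THEN subsetD]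
        image_inv_into_cancel[of e B A \<sigma>, THEN equalityD2, THEN subsetD])
    then show ?thesis
      using True by (simp add: pull_def)
  next
    case False
    then show ?thesis
      using ochainsD(2)[OF assms(2), of \<sigma>] by (auto simp: pull_def)
  qed
qed

lemma pull_inv':
  assumes "poset_iso B A e" "c \<in> ochains B i"
  shows "pull B e (pull A (inv_into B e) c) = c"
proof
  fix \<sigma>
  show "pull B e (pull A (inv_into B e) c) \<sigma> = c \<sigma>"
  proof (cases "\<sigma> \<subseteq> B")
    case True
    then have "e ` \<sigma> \<subseteq> A" "inv_into B e ` e ` \<sigma> = \<sigma>"
      using poset_isoD(1,2)[OF assms(1)] by (auto simp: inv_into_image_cancel)
    then show ?thesis
      using True by (simp add: pull_def)
  next
    case False
    then show ?thesis
      using ochainsD(2)[OF assms(2), of \<sigma>] by (auto simp: pull_def)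
  qed
qed

lemma acyclic_over_iso:
  assumes "finite A" "poset_iso B A e" "acyclic_over TYPE('k::field) A"
  shows "acyclic_over TYPE('k) B"
  unfolding acyclic_over_def
proof (intro allI ballI impI)
  fix i and z :: "'b set \<Rightarrow> 'k"
  assume z: "z \<in> ochains B i" "bdry z = 0"
  have B: "finite B"
    using assms(1,2) by (metis bij_betw_finite poset_iso_def)
  note inv = poset_iso_inv[OF assms(2)]
  have "bdry (pull A (inv_into B e) z) = pull A (inv_into B e) 0"
    using bdry_pull[OF assms(1) inv z(1)] z(2) by simp
  also have "\<dots> = 0"
    by (auto simp: pull_def fun_eq_iff)
  finally obtain d where d: "d \<in> ochains A (i + 1)" "bdry d = pull A (inv_into B e) z"
    using acyclic_overD[OF assms(3) pull_in_ochains[OF inv z(1)]] by metis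
  have "bdry (pull B e d) = z"
    using bdry_pull[OF B assms(2) d(1)] d(2) pull_inv'[OF assms(2) z(1)] by simp
  then show "\<exists>d\<in>ochains B (i + 1). bdry d = z"
    using pull_in_ochains[OF assms(2) d(1)] by blast
qed

section \<open>Dimension of homology\<close>

text \<open>Representatives of a basis of the quotient of \<open>V\<close> by \<open>W\<close>,
  phrased like \<open>homology_basis\<close>, which is the case of cycles modulo boundaries. Unique
  coordinates express spanning and independence at once.\<close>

definition rel_basis :: "('b \<Rightarrow> 'k::field) set \<Rightarrow> ('b \<Rightarrow> 'k) set \<Rightarrow> ('b \<Rightarrow> 'k) set \<Rightarrow> bool" where
  "rel_basis V W b \<longleftrightarrow> finite b \<and> b \<subseteq> V \<and>
     (\<forall>v\<in>V. \<exists>!u. (\<forall>x. x \<notin> b \<longrightarrow> u x = 0) \<and> v - lincomb u b \<in> W)"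

lemma lincomb_eq: "lincomb u b = (\<Sum>x\<in>b. fscale (u x) x)"
  by (simp add: lincomb_def fun_eq_iff sum_apply)

lemma lincomb_in_subspace: "fs.subspace V \<Longrightarrow> b \<subseteq> V \<Longrightarrow> lincomb u b \<in> V"
  unfolding lincomb_eq by (intro fs.subspace_sum fs.subspace_scale) auto

lemma lincomb_diff: "lincomb (\<lambda>x. u x - v x) b = lincomb u b - lincomb v b"
  by (simp add: lincomb_def fun_eq_iff left_diff_distrib sum_subtractf)

lemma ex1_eq: "\<exists>!x. P x \<Longrightarrow> P x \<Longrightarrow> P y \<Longrightarrow> x = y"
  by blast

lemma rel_basis_lincomb_eq_0:
  assumes "fs.subspace V" "fs.subspace W" "rel_basis V W b"
    and "\<And>x. x \<notin> b \<Longrightarrow> u x = 0" "lincomb u b \<in> W"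
  shows "u = (\<lambda>_. 0)"
proof -
  let ?P = "\<lambda>u. (\<forall>x. x \<notin> b \<longrightarrow> u x = 0) \<and> 0 - lincomb u b \<in> W"
  have ex1: "\<exists>!u. ?P u"
    using assms(3) fs.subspace_0[OF assms(1)] by (simp only: rel_basis_def)
  have "?P u"
    using assms(4) fs.subspace_neg[OF assms(2,5)] by simp
  moreover have "?P (\<lambda>_. 0)"
    using fs.subspace_0[OF assms(2)] by (simp add: lincomb_eq)
  ultimately show ?thesis
    by (rule ex1_eq[OF ex1])
qed

lemma finite_dim_basis:
  assumes "fs.subspace W" "W \<subseteq> fs.span F" "finite F"
  obtains \<beta> where "finite \<beta>" "fs.independent \<beta>" "fs.span \<beta> = W" "card \<beta> = fs.dim W"
proof -
  obtain \<beta> where \<beta>: "\<beta> \<subseteq> W" "fs.independent \<beta>" "W \<subseteq> fs.span \<beta>" "card \<beta> = fs.dim W"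
    using fs.basis_exists[of W] by blast
  have "finite \<beta>"
    using fs.independent_span_bound[OF assms(3) \<beta>(2)] \<beta>(1) assms(2) by blast
  moreover have "fs.span \<beta> = W"
    using \<beta>(1,3) fs.span_minimal[OF \<beta>(1) assms(1)] by blast
  ultimately show thesis
    using that \<beta> by blast
qed

text \<open>Representatives of a basis of the quotient and a basis of \<open>W\<close> together form
  a basis of \<open>V\<close>.\<close>

lemma rel_basis_dim:
  fixes V W :: "('b \<Rightarrow> 'k::field) set"
  assumes V: "fs.subspace V" and W: "fs.subspace W" "W \<subseteq> V" "W \<subseteq> fs.span F" "finite F"
    and b: "rel_basis V W b"
  shows "fs.dim V = fs.dim W + card b"
proof -
  obtain \<beta> where \<beta>: "finite \<beta>" "fs.independent \<beta>" "fs.span \<beta> = W" "card \<beta> = fs.dim W"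
    using finite_dim_basis[OF W(1,3,4)] .
  have fb: "finite b" and bV: "b \<subseteq> V"
    using b by (auto simp: rel_basis_def)
  have \<beta>W: "\<beta> \<subseteq> W"
    using \<beta>(3) fs.span_superset by blast
  \<comment> \<open>A common element would lie in \<open>W\<close>, giving the zero class two
    different coordinate vectors.\<close>
  have disj: "b \<inter> \<beta> = {}"
  proof (rule ccontr)
    assume "b \<inter> \<beta> \<noteq> {}"
    then obtain x where x: "x \<in> b" "x \<in> \<beta>" by blast
    let ?u = "\<lambda>y. if y = x then 1 else 0 :: 'k"
    have "lincomb ?u b = (\<Sum>y\<in>b. if y = x then x else 0)"
      unfolding lincomb_eq by (intro sum.cong) auto
    also have "\<dots> = x"
      using x fb by simp
    finally have "lincomb ?u b \<in> W"
      using x \<beta>W by auto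
    then have "?u = (\<lambda>_. 0)"
      by (rule rel_basis_lincomb_eq_0[OF V W(1) b, rotated]) (use x in auto)
    then show False
      by (metis zero_neq_one)
  qed
  have "fs.independent (b \<union> \<beta>)"
  proof (rule fs.independent_if_scalars_zero)
    show "finite (b \<union> \<beta>)" using fb \<beta>(1) by simp
    fix f x assume 0: "(\<Sum>x\<in>b \<union> \<beta>. fscale (f x) x) = 0" and x: "x \<in> b \<union> \<beta>"
    define u where "u = (\<lambda>y. if y \<in> b then f y else 0)"
    have ub: "lincomb u b = (\<Sum>x\<in>b. fscale (f x) x)"
      unfolding lincomb_eq by (intro sum.cong) (auto simp: u_def)
    have sum: "lincomb u b + (\<Sum>x\<in>\<beta>. fscale (f x) x) = 0"
      unfolding ub using 0 sum.union_disjoint[OF fb \<beta>(1) disj, of "\<lambda>x. fscale (f x) x"] by argo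
    have "(\<Sum>x\<in>\<beta>. fscale (f x) x) \<in> W"
      by (intro fs.subspace_sum[OF W(1)] fs.subspace_scale[OF W(1)]) (use \<beta>W in auto)
    then have "- (\<Sum>x\<in>\<beta>. fscale (f x) x) \<in> W"
      by (rule fs.subspace_neg[OF W(1)])
    then have "lincomb u b \<in> W"
      using sum by (simp only: eq_neg_iff_add_eq_0[symmetric])
    then have u0: "u = (\<lambda>_. 0)"
      by (rule rel_basis_lincomb_eq_0[OF V W(1) b, rotated]) (auto simp: u_def)
    then have "lincomb u b = 0"
      by (simp add: lincomb_eq)
    then have "(\<Sum>x\<in>\<beta>. fscale (f x) x) = 0"
      using sum by simp
    then have "f y = 0" if "y \<in> \<beta>" for y
      using fs.independentD[OF \<beta>(2,1) subset_refl _ that] by blast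
    moreover have "f y = 0" if "y \<in> b" for y
      using u0 that by (metis u_def)
    ultimately show "f x = 0"
      using x by blast
  qed
  moreover have "V \<subseteq> fs.span (b \<union> \<beta>)"
  proof
    fix v assume "v \<in> V"
    then obtain u where "v - lincomb u b \<in> W"
      using b unfolding rel_basis_def by blast
    then have "v - lincomb u b \<in> fs.span (b \<union> \<beta>)"
      using \<beta>(3) fs.span_mono[of \<beta> "b \<union> \<beta>"] by blast
    moreover have "lincomb u b \<in> fs.span (b \<union> \<beta>)"
      by (rule lincomb_in_subspace[OF fs.subspace_span]) (use fs.span_superset in blast)
    ultimately have "(v - lincomb u b) + lincomb u b \<in> fs.span (b \<union> \<beta>)"
      by (rule fs.span_add)
    then show "v \<in> fs.span (b \<union> \<beta>)"
      by simp
  qed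
  moreover have "b \<union> \<beta> \<subseteq> V"
    using bV \<beta>W W(2) by blast
  ultimately have "card (b \<union> \<beta>) = fs.dim V"
    by (intro fs.basis_card_eq_dim)
  then show ?thesis
    using card_Un_disjoint[OF fb \<beta>(1) disj] \<beta>(4) by simp
qed

text \<open>A basis of \<open>W\<close> extends to one of \<open>V\<close>; the added vectors
  represent a basis of the quotient.\<close>

lemma rel_basis_exists:
  fixes V W :: "('b \<Rightarrow> 'k::field) set"
  assumes V: "fs.subspace V" "V \<subseteq> fs.span F" "finite F" and W: "fs.subspace W" "W \<subseteq> V"
  obtains b where "rel_basis V W b"
proof -
  obtain \<beta> where \<beta>: "finite \<beta>" "fs.independent \<beta>" "fs.span \<beta> = W" "card \<beta> = fs.dim W"
    using finite_dim_basis[OF W(1) _ V(3)] W(2) V(2) by blast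
  have "\<beta> \<subseteq> V"
    using \<beta>(3) fs.span_superset W(2) by blast
  then obtain B where B: "\<beta> \<subseteq> B" "B \<subseteq> V" "fs.independent B" "V \<subseteq> fs.span B"
    using fs.maximal_independent_subset_extend[OF _ \<beta>(2)] by metis
  have fB: "finite B"
    using fs.independent_span_bound[OF V(3) B(3)] B(2) V(2) by blast
  define b where "b = B - \<beta>"
  have split: "(\<Sum>x\<in>B. g x) = (\<Sum>x\<in>b. g x) + (\<Sum>x\<in>\<beta>. g x)" for g :: "_ \<Rightarrow> 'b \<Rightarrow> 'k"
    unfolding b_def using sum.subset_diff[OF B(1) fB] by blast
  have ex: "\<exists>u. (\<forall>x. x \<notin> b \<longrightarrow> u x = 0) \<and> v - lincomb u b \<in> W" if v: "v \<in> V" for v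
  proof -
    have "v \<in> fs.span B" using v B(4) by blast
    then obtain a where a: "v = (\<Sum>x\<in>B. fscale (a x) x)"
      unfolding fs.span_finite[OF fB] by blast
    define u where "u = (\<lambda>x. if x \<in> b then a x else 0)"
    have "lincomb u b = (\<Sum>x\<in>b. fscale (a x) x)"
      unfolding lincomb_eq by (intro sum.cong) (auto simp: u_def)
    then have "v - lincomb u b = (\<Sum>x\<in>\<beta>. fscale (a x) x)"
      using a split[of "\<lambda>x. fscale (a x) x"] by (simp add: algebra_simps)
    also have "\<dots> \<in> W"
      by (intro fs.subspace_sum[OF W(1)] fs.subspace_scale[OF W(1)])
        (use \<beta>(3) fs.span_superset in blast)
    finally show ?thesis
      by (intro exI[of _ u]) (auto simp: u_def)
  qed
  have un: "u = u'" if u: "\<forall>x. x \<notin> b \<longrightarrow> u x = 0" "v - lincomb u b \<in> W"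
    and u': "\<forall>x. x \<notin> b \<longrightarrow> u' x = 0" "v - lincomb u' b \<in> W" for u u' v
  proof -
    have "(v - lincomb u' b) - (v - lincomb u b) \<in> W"
      by (rule fs.subspace_diff[OF W(1) u'(2) u(2)])
    then have "lincomb (\<lambda>x. u x - u' x) b \<in> fs.span \<beta>"
      by (simp add: lincomb_diff \<beta>(3))
    then obtain a where a: "lincomb (\<lambda>x. u x - u' x) b = (\<Sum>x\<in>\<beta>. fscale (a x) x)"
      unfolding fs.span_finite[OF \<beta>(1)] by blast
    define g where "g = (\<lambda>x. if x \<in> b then u x - u' x else - a x)"
    have "(\<Sum>x\<in>b. fscale (g x) x) = lincomb (\<lambda>x. u x - u' x) b"
      unfolding lincomb_eq by (intro sum.cong) (auto simp: g_def)
    moreover have "(\<Sum>x\<in>\<beta>. fscale (g x) x) = (\<Sum>x\<in>\<beta>. - fscale (a x) x)"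
      by (intro sum.cong) (auto simp: g_def b_def)
    ultimately have "(\<Sum>x\<in>B. fscale (g x) x) = 0"
      using split[of "\<lambda>x. fscale (g x) x"] a by (simp add: sum_negf)
    then have g: "g x = 0" if "x \<in> B" for x
      using fs.independentD[OF B(3) fB subset_refl _ that] by blast
    show "u = u'"
    proof
      fix x
      show "u x = u' x"
        using g[of x] u(1) u'(1) by (cases "x \<in> b") (auto simp: g_def b_def)
    qed
  qed
  have "rel_basis V W b"
    unfolding rel_basis_def
  proof (intro conjI ballI)
    show "finite b" "b \<subseteq> V"
      using fB B(2) by (auto simp: b_def)
    fix v assume "v \<in> V"
    then show "\<exists>!u. (\<forall>x. x \<notin> b \<longrightarrow> u x = 0) \<and> v - lincomb u b \<in> W"
      using ex un by (metis (mono_tags, lifting))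
  qed
  then show thesis by (rule that)
qed

lemma dim_mono_subspace:
  fixes V W :: "('b \<Rightarrow> 'k::field) set"
  assumes "fs.subspace V" "V \<subseteq> fs.span F" "finite F" "fs.subspace W" "W \<subseteq> V"
  shows "fs.dim W \<le> fs.dim V"
proof -
  obtain b where b: "rel_basis V W b"
    using rel_basis_exists[OF assms] .
  have "W \<subseteq> fs.span F"
    using assms(2,5) by simp
  then show ?thesis
    using rel_basis_dim[OF assms(1,4,5) _ assms(3) b] by simp
qed

text \<open>As in the second isomorphism theorem, representatives for \<open>V\<close> modulo
  \<open>V \<inter> W\<close> also serve for the sum modulo \<open>W\<close>.\<close>

lemma dim_sum_Int:
  fixes V W :: "('b \<Rightarrow> 'k::field) set"
  assumes V: "fs.subspace V" "V \<subseteq> fs.span F" and W: "fs.subspace W" "W \<subseteq> fs.span F"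
    and F: "finite F"
  shows "fs.dim {v + w | v w. v \<in> V \<and> w \<in> W} + fs.dim (V \<inter> W) = fs.dim V + fs.dim W"
proof -
  let ?S = "{v + w | v w. v \<in> V \<and> w \<in> W}"
  have I: "fs.subspace (V \<inter> W)"
    using V(1) W(1) by (rule fs.subspace_inter)
  have S: "fs.subspace ?S"
    using V(1) W(1) by (rule fs.subspace_sums)
  obtain b where b: "rel_basis V (V \<inter> W) b"
    using rel_basis_exists[OF V F I] by blast
  have bV: "b \<subseteq> V"
    using b by (simp add: rel_basis_def)
  have VS: "V \<subseteq> ?S"
  proof
    fix v assume "v \<in> V"
    moreover have "v = v + 0" by simp
    ultimately show "v \<in> ?S"
      using fs.subspace_0[OF W(1)] by blast
  qed
  have WS: "W \<subseteq> ?S"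
  proof
    fix v assume "v \<in> W"
    moreover have "v = 0 + v" by simp
    ultimately show "v \<in> ?S"
      using fs.subspace_0[OF V(1)] by blast
  qed
  have "rel_basis ?S W b"
    unfolding rel_basis_def
  proof (intro conjI ballI)
    show "finite b"
      using b by (simp add: rel_basis_def)
    show "b \<subseteq> ?S"
      using bV VS by blast
    fix s assume "s \<in> ?S"
    then obtain v w where s: "s = v + w" "v \<in> V" "w \<in> W" by blast
    have "(s - lincomb u b \<in> W) = (v - lincomb u b \<in> V \<inter> W)" for u
    proof
      assume "s - lincomb u b \<in> W"
      then have "(s - lincomb u b) - w \<in> W"
        using fs.subspace_diff[OF W(1) _ s(3)] by blast
      moreover have "v - lincomb u b \<in> V"
        by (intro fs.subspace_diff[OF V(1)] s lincomb_in_subspace[OF V(1) bV])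
      moreover have "(s - lincomb u b) - w = v - lincomb u b"
        by (simp add: s(1))
      ultimately show "v - lincomb u b \<in> V \<inter> W" by auto
    next
      assume "v - lincomb u b \<in> V \<inter> W"
      then have "(v - lincomb u b) + w \<in> W"
        using fs.subspace_add[OF W(1) _ s(3)] by blast
      moreover have "(v - lincomb u b) + w = s - lincomb u b"
        by (simp add: s(1))
      ultimately show "s - lincomb u b \<in> W" by argo
    qed
    then show "\<exists>!u. (\<forall>x. x \<notin> b \<longrightarrow> u x = 0) \<and> s - lincomb u b \<in> W"
      using b s(2) by (simp only: rel_basis_def)
  qed
  then have "fs.dim ?S = fs.dim W + card b"
    by (rule rel_basis_dim[OF S W(1) WS W(2) F])
  moreover have "fs.dim V = fs.dim (V \<inter> W) + card b"
    by (rule rel_basis_dim[OF V(1) I _ _ F b]) (use V(2) in auto)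
  ultimately show ?thesis by simp
qed

lemma dim_linear_image:
  fixes T :: "('b \<Rightarrow> 'k::field) \<Rightarrow> 'c \<Rightarrow> 'k"
  assumes "\<And>x y. T (x + y) = T x + T y" "\<And>a x. T (fscale a x) = fscale a (T x)"
    and V: "fs.subspace V" and inj: "inj_on T V"
  shows "fs.dim (T ` V) = fs.dim V"
proof -
  interpret pair: vector_space_pair "fscale :: 'k \<Rightarrow> ('b \<Rightarrow> 'k) \<Rightarrow> _" "fscale :: 'k \<Rightarrow> ('c \<Rightarrow> 'k) \<Rightarrow> _"
    by unfold_locales
  have T: "Vector_Spaces.linear fscale fscale T"
    unfolding Vector_Spaces.linear_iff by (intro conjI allI fs.vector_space_axioms assms)
  obtain B where B: "B \<subseteq> V" "fs.independent B" "V \<subseteq> fs.span B" "card B = fs.dim V"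
    using fs.basis_exists[of V] by blast
  have sB: "fs.span B = V"
    using B(1,3) fs.span_minimal[OF B(1) V] by blast
  have "fs.independent (T ` B)"
    by (rule pair.linear_independent_injective_image[OF T B(2)]) (simp add: sB inj)
  moreover have "T ` V \<subseteq> fs.span (T ` B)"
    using pair.linear_span_image[OF T, of B] sB by simp
  ultimately have "card (T ` B) = fs.dim (T ` V)"
    using B(1) by (intro fs.basis_card_eq_dim) auto
  moreover have "card (T ` B) = card B"
    using inj_on_subset[OF inj B(1)] by (rule card_image)
  ultimately show ?thesis
    using B(4) by simp
qed

section \<open>Cycles, boundaries and dimensions of homology\<close>

abbreviation ocycles :: "'a::order set \<Rightarrow> int \<Rightarrow> ('a set \<Rightarrow> 'k::field) set" where
  "ocycles A i \<equiv> cycles (order_complex A) i"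

abbreviation obounds :: "'a::order set \<Rightarrow> int \<Rightarrow> ('a set \<Rightarrow> 'k::field) set" where
  "obounds A i \<equiv> boundaries (order_complex A) i"

lemma ocycles_subspace: "finite A \<Longrightarrow> fs.subspace (ocycles A i :: ('a::order set \<Rightarrow> 'k::field) set)"
  by (rule fs.subspaceI)
    (auto simp: cycles_def ochains_add ochains_scale bdry_add[of A _ i] bdry_scale[of A _ i])

lemma obounds_iff: "z \<in> obounds A i \<longleftrightarrow> (\<exists>d\<in>ochains A (i + 1). bdry d = z)"
  by (auto simp: boundaries_def)

lemma obounds_subspace:
  assumes "finite A"
  shows "fs.subspace (obounds A i :: ('a::order set \<Rightarrow> 'k::field) set)"
proof (rule fs.subspaceI)
  show "0 \<in> (obounds A i :: ('a set \<Rightarrow> 'k) set)"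
    unfolding obounds_iff by (rule bexI[of _ 0]) (rule bdry_zero, rule ochains_zero)
next
  fix x y :: "'a set \<Rightarrow> 'k" assume "x \<in> obounds A i" "y \<in> obounds A i"
  then obtain c d where cd: "c \<in> ochains A (i + 1)" "d \<in> ochains A (i + 1)" "bdry c = x" "bdry d = y"
    unfolding obounds_iff by blast
  then have "bdry (c + d) = x + y"
    using bdry_add[OF assms cd(1,2)] by blast
  then show "x + y \<in> obounds A i"
    unfolding obounds_iff using ochains_add[OF cd(1,2)] by blast
next
  fix x :: "'a set \<Rightarrow> 'k" and a assume "x \<in> obounds A i"
  then obtain c where c: "c \<in> ochains A (i + 1)" "bdry c = x"
    unfolding obounds_iff by blast
  then have "bdry (fscale a c) = fscale a x"
    using bdry_scale[OF assms c(1)] by blast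
  then show "fscale a x \<in> obounds A i"
    unfolding obounds_iff using ochains_scale[OF c(1)] by blast
qed

lemma obounds_subset: "finite A \<Longrightarrow> obounds A i \<subseteq> ocycles A i"
  by (auto simp: boundaries_def cycles_def bdry_in_ochains' bdry_bdry)

lemma ocycles_mono: "A \<subseteq> B \<Longrightarrow> ocycles A i \<subseteq> ocycles B i"
  by (auto simp: cycles_def intro: ochains_mono)

lemma obounds_mono: "A \<subseteq> B \<Longrightarrow> obounds A i \<subseteq> obounds B i"
  by (auto simp: boundaries_def intro: ochains_mono)

text \<open>One finite spanning set, the indicator functions of the subsets of \<open>A\<close>,
  serves all vertex sets and all degrees, so that cycles and boundaries over different subsets can
  be compared in one finite-dimensional space.\<close>

lemma ochains_finite_dim:
  assumes "finite A"
  shows "\<exists>F :: ('a::order set \<Rightarrow> 'k::field) set. finite F \<and>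
    (\<forall>B i. B \<subseteq> A \<longrightarrow> ochains B i \<subseteq> fs.span F)"
proof (intro exI conjI allI impI)
  let ?d = "\<lambda>\<sigma> \<tau>. if \<tau> = \<sigma> then 1 else 0 :: 'k"
  show "finite (?d ` Pow A)"
    using assms by simp
  fix B i assume B: "B \<subseteq> A"
  show "ochains B i \<subseteq> fs.span (?d ` Pow A)"
  proof
    fix c :: "'a set \<Rightarrow> 'k" assume c: "c \<in> ochains B i"
    have "c = (\<Sum>\<sigma>\<in>Pow A. fscale (c \<sigma>) (?d \<sigma>))"
    proof
      fix \<tau>
      have "(\<Sum>\<sigma>\<in>Pow A. fscale (c \<sigma>) (?d \<sigma>)) \<tau> = (\<Sum>\<sigma>\<in>Pow A. if \<sigma> = \<tau> then c \<tau> else 0)"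
        unfolding sum_apply by (intro sum.cong) auto
      also have "\<dots> = c \<tau>"
        using assms ochainsD(2)[OF c, of \<tau>] B by auto
      finally show "c \<tau> = (\<Sum>\<sigma>\<in>Pow A. fscale (c \<sigma>) (?d \<sigma>)) \<tau>" ..
    qed
    also have "\<dots> \<in> fs.span (?d ` Pow A)"
      by (intro fs.span_sum fs.span_scale fs.span_base) auto
    finally show "c \<in> fs.span (?d ` Pow A)" .
  qed
qed

lemma ocycles_ochains: "ocycles A i \<subseteq> ochains A i"
  by (auto simp: cycles_def)

lemma hclass_eq_iff:
  assumes "finite A"
  shows "hclass (order_complex A) i z = hclass (order_complex A) i z' \<longleftrightarrow>
    z - (z' :: 'a::order set \<Rightarrow> 'k::field) \<in> obounds A i"
proof
  note B = obounds_subspace[OF assms, of i, where 'k='k]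
  assume "hclass (order_complex A) i z = hclass (order_complex A) i z'"
  moreover have "z \<in> hclass (order_complex A) i z"
    unfolding hclass_def by (rule image_eqI[of _ _ 0]) (use fs.subspace_0[OF B] in auto)
  ultimately obtain b where "b \<in> obounds A i" "z = z' + b"
    unfolding hclass_def by auto
  then show "z - z' \<in> obounds A i"
    by simp
next
  note B = obounds_subspace[OF assms, of i, where 'k='k]
  assume *: "z - z' \<in> obounds A i"
  show "hclass (order_complex A) i z = hclass (order_complex A) i z'"
    unfolding hclass_def
  proof (intro equalityI subsetI)
    fix x assume "x \<in> (+) z ` obounds A i"
    then obtain b where b: "b \<in> obounds A i" "x = z + b" by blast
    then have "x = z' + ((z - z') + b)" by simp
    then show "x \<in> (+) z' ` obounds A i"
      using fs.subspace_add[OF B * b(1)] by blast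
  next
    fix x assume "x \<in> (+) z' ` obounds A i"
    then obtain b where b: "b \<in> obounds A i" "x = z' + b" by blast
    then have "x = z + (b - (z - z'))" by simp
    then show "x \<in> (+) z ` obounds A i"
      using fs.subspace_diff[OF B b(1) *] by blast
  qed
qed

lemma homology_basis_iff:
  assumes "finite A"
  shows "homology_basis (order_complex A) i (b :: ('a::order set \<Rightarrow> 'k::field) set) \<longleftrightarrow>
    rel_basis (ocycles A i) (obounds A i) b"
  unfolding homology_basis_def rel_basis_def homology_def
  by (simp add: hclass_eq_iff[OF assms])

text \<open>The choice in \<open>hbasis\<close> succeeds because the cycles form a
  finite-dimensional space.\<close>

lemma hbasis_is_basis:
  assumes "finite A"
  shows "homology_basis (order_complex A) i (hbasis (order_complex A) i :: ('a::order set \<Rightarrow> 'k::field) set)"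
proof -
  obtain F :: "('a set \<Rightarrow> 'k) set" where F: "finite F" "\<And>B i. B \<subseteq> A \<Longrightarrow> ochains B i \<subseteq> fs.span F"
    using ochains_finite_dim[OF assms, where 'k='k] by blast
  obtain b :: "('a set \<Rightarrow> 'k) set" where "rel_basis (ocycles A i) (obounds A i) b"
    using rel_basis_exists[OF ocycles_subspace[OF assms] _ F(1) obounds_subspace[OF assms] obounds_subset[OF assms], of i]
      F(2)[of A i] ocycles_ochains[of A i] by blast
  then have "homology_basis (order_complex A) i b"
    by (simp add: homology_basis_iff[OF assms])
  then show ?thesis
    unfolding hbasis_def by (rule someI)
qed

lemma hdim_dim:
  assumes "finite A"
  shows "fs.dim (ocycles A i :: ('a::order set \<Rightarrow> 'k::field) set) =
    fs.dim (obounds A i :: ('a set \<Rightarrow> 'k) set) + hdim TYPE('k) (order_complex A) i"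
proof -
  obtain F :: "('a set \<Rightarrow> 'k) set" where F: "finite F" "\<And>B i. B \<subseteq> A \<Longrightarrow> ochains B i \<subseteq> fs.span F"
    using ochains_finite_dim[OF assms, where 'k='k] by blast
  have "obounds A i \<subseteq> fs.span F"
    using F(2)[of A i] ocycles_ochains[of A i] obounds_subset[OF assms, of i] by blast
  then show ?thesis
    unfolding hdim_def
    by (rule rel_basis_dim[OF ocycles_subspace[OF assms] obounds_subspace[OF assms] obounds_subset[OF assms]])
      (use F(1) hbasis_is_basis[OF assms] homology_basis_iff[OF assms] in auto)
qed

text \<open>Relative acyclicity says that cycles over \<open>A\<close> are cycles over
  \<open>X\<close> plus boundaries, and that a cycle over \<open>X\<close> bounding over
  \<open>A\<close> bounds over \<open>X\<close>. The dimension formula for sum and intersection then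
  compares the two quotients.\<close>

lemma hdim_rel_acyclic:
  assumes "finite A" "rel_acyclic TYPE('k::field) X A"
  shows "hdim TYPE('k) (order_complex X) i = hdim TYPE('k) (order_complex A) i"
proof -
  have XA: "X \<subseteq> A"
    using assms by (simp add: rel_acyclic_def)
  then have X: "finite X"
    using assms(1) finite_subset by blast
  obtain F :: "('a set \<Rightarrow> 'k) set" where F: "finite F" "\<And>B i. B \<subseteq> A \<Longrightarrow> ochains B i \<subseteq> fs.span F"
    using ochains_finite_dim[OF assms(1), where 'k='k] by blast
  let ?ZX = "ocycles X i :: ('a set \<Rightarrow> 'k) set" and ?BA = "obounds A i :: ('a set \<Rightarrow> 'k) set"
  have Z: "ocycles A i = {v + w | v w. v \<in> ?ZX \<and> w \<in> ?BA}"
  proof (intro equalityI subsetI)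
    fix z :: "'a set \<Rightarrow> 'k" assume "z \<in> ocycles A i"
    then have z: "z \<in> ochains A i" "bdry z = 0"
      by (auto simp: cycles_def)
    then obtain d where d: "d \<in> ochains A (i + 1)" "z - bdry d \<in> ochains X i"
      using rel_acyclicD[OF assms(2) z(1)] by (metis ochains_zero)
    have "bdry (z - bdry d) = 0"
      using bdry_diff[OF assms(1) z(1) bdry_in_ochains'[OF assms(1) d(1)]] bdry_bdry[OF assms(1) d(1)] z(2)
      by simp
    then have "z - bdry d \<in> ?ZX"
      using d(2) by (simp add: cycles_def)
    moreover have "bdry d \<in> ?BA"
      using d(1) by (simp add: boundaries_def)
    moreover have "z = (z - bdry d) + bdry d" by simp
    ultimately show "z \<in> {v + w | v w. v \<in> ?ZX \<and> w \<in> ?BA}" by blast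
  next
    fix z assume "z \<in> {v + w | v w. v \<in> ?ZX \<and> w \<in> ?BA}"
    then obtain v w where "z = v + w" "v \<in> ocycles A i" "w \<in> ocycles A i"
      using ocycles_mono[OF XA] obounds_subset[OF assms(1)] by blast
    then show "z \<in> ocycles A i"
      using fs.subspace_add[OF ocycles_subspace[OF assms(1)]] by blast
  qed
  have B: "obounds X i = ?ZX \<inter> ?BA"
  proof (intro equalityI subsetI)
    fix z :: "'a set \<Rightarrow> 'k" assume "z \<in> obounds X i"
    then show "z \<in> ?ZX \<inter> ?BA"
      using obounds_subset[OF X] obounds_mono[OF XA] by blast
  next
    fix z assume "z \<in> ?ZX \<inter> ?BA"
    then obtain d where "z \<in> ochains X i" "d \<in> ochains A (i + 1)" "bdry d = z"
      by (auto simp: cycles_def boundaries_def)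
    then obtain e where "e \<in> ochains X (i + 1)" "bdry e = z"
      using rel_acyclic_bounds[OF assms] by metis
    then show "z \<in> obounds X i"
      by (auto simp: boundaries_def)
  qed
  have "?ZX \<subseteq> fs.span F" "?BA \<subseteq> fs.span F"
    using F(2)[OF XA, of i] F(2)[OF subset_refl, of i] ocycles_ochains obounds_subset[OF assms(1)] by blast+
  then have "fs.dim {v + w | v w. v \<in> ?ZX \<and> w \<in> ?BA} + fs.dim (?ZX \<inter> ?BA) = fs.dim ?ZX + fs.dim ?BA"
    by (rule dim_sum_Int[OF ocycles_subspace[OF X] _ obounds_subspace[OF assms(1)] _ F(1)])
  then show ?thesis
    unfolding Z[symmetric] B[symmetric]
    using hdim_dim[OF X, of i, where 'k='k] hdim_dim[OF assms(1), of i, where 'k='k] by linarith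
qed

text \<open>Every class killed by passing from \<open>K\<close> to \<open>K'\<close> has a
  representative in \<open>S\<close>, and the members of \<open>S0\<close> bound already over
  \<open>K\<close>. So the kernel on homology has dimension at most that of \<open>S\<close> minus
  that of \<open>S0\<close>.\<close>

lemma hdim_le_if_bounds:
  assumes "finite K'" "K \<subseteq> K'" and S: "fs.subspace S"
    and S1: "S \<subseteq> ocycles K j" and S2: "S0 \<subseteq> S \<inter> obounds K j" "fs.subspace S0"
    and split: "\<And>z. z \<in> ocycles K j \<Longrightarrow> z \<in> obounds K' j \<Longrightarrow> \<exists>b\<in>obounds K j. \<exists>w\<in>S. z = b + w"
  shows "hdim TYPE('k::field) (order_complex K) j + fs.dim S0
    \<le> hdim TYPE('k) (order_complex K') j + fs.dim (S :: ('a::order set \<Rightarrow> 'k) set)"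
proof -
  have K: "finite K"
    using assms(1,2) finite_subset by blast
  obtain F :: "('a set \<Rightarrow> 'k) set" where F: "finite F" "\<And>B i. B \<subseteq> K' \<Longrightarrow> ochains B i \<subseteq> fs.span F"
    using ochains_finite_dim[OF assms(1), where 'k='k] by blast
  let ?Z = "ocycles K j :: ('a set \<Rightarrow> 'k) set" and ?Z' = "ocycles K' j :: ('a set \<Rightarrow> 'k) set"
  let ?B = "obounds K j :: ('a set \<Rightarrow> 'k) set" and ?B' = "obounds K' j :: ('a set \<Rightarrow> 'k) set"
  note sZ = ocycles_subspace[OF K, of j, where 'k='k] and sZ' = ocycles_subspace[OF assms(1), of j, where 'k='k]
  note sB = obounds_subspace[OF K, of j, where 'k='k] and sB' = obounds_subspace[OF assms(1), of j, where 'k='k]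
  have ZF: "?Z \<subseteq> fs.span F" "?Z' \<subseteq> fs.span F"
    using F(2)[OF assms(2), of j] F(2)[OF subset_refl, of j] ocycles_ochains by blast+
  have BZ: "?B \<subseteq> ?Z" "?B' \<subseteq> ?Z'"
    using obounds_subset[OF K] obounds_subset[OF assms(1)] by blast+
  have ZZ': "?Z \<subseteq> ?Z'"
    by (rule ocycles_mono[OF assms(2)])
  have "{v + w | v w. v \<in> ?Z \<and> w \<in> ?B'} \<subseteq> ?Z'"
    using ZZ' BZ(2) fs.subspace_add[OF sZ'] by blast
  then have "fs.dim {v + w | v w. v \<in> ?Z \<and> w \<in> ?B'} \<le> fs.dim ?Z'"
    by (intro dim_mono_subspace[OF sZ' ZF(2) F(1)] fs.subspace_sums sZ sB')
  then have 1: "fs.dim ?Z + fs.dim ?B' \<le> fs.dim ?Z' + fs.dim (?Z \<inter> ?B')"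
    using dim_sum_Int[OF sZ ZF(1) sB' subset_trans[OF BZ(2) ZF(2)] F(1)] by linarith
  have "?Z \<inter> ?B' \<subseteq> {v + w | v w. v \<in> ?B \<and> w \<in> S}"
    using split by blast
  moreover have "{v + w | v w. v \<in> ?B \<and> w \<in> S} \<subseteq> ?Z"
    using BZ(1) S1 fs.subspace_add[OF sZ] by blast
  ultimately have 2: "fs.dim (?Z \<inter> ?B') \<le> fs.dim {v + w | v w. v \<in> ?B \<and> w \<in> S}"
    using ZF(1) by (intro dim_mono_subspace[OF _ _ F(1)] fs.subspace_sums fs.subspace_inter sZ sB sB' S) auto
  have "fs.dim S0 \<le> fs.dim (?B \<inter> S)"
    using S2 ZF(1) BZ(1) by (intro dim_mono_subspace[OF _ _ F(1)] fs.subspace_inter sB S) auto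
  then have 3: "fs.dim {v + w | v w. v \<in> ?B \<and> w \<in> S} + fs.dim S0 \<le> fs.dim ?B + fs.dim S"
    using dim_sum_Int[OF sB subset_trans[OF BZ(1) ZF(1)] S subset_trans[OF S1 ZF(1)] F(1)] by linarith
  show ?thesis
    using 1 2 3 hdim_dim[OF K, of j, where 'k='k] hdim_dim[OF assms(1), of j, where 'k='k] by simp
qed

text \<open>If a chain \<open>d\<close> bounds \<open>z\<close>, which avoids \<open>x\<close>, then
  the link of \<open>d\<close> at \<open>x\<close> is a cycle and accounts for the difference
  between \<open>z\<close> and the boundary of the part of \<open>d\<close> avoiding
  \<open>x\<close>.\<close>

lemma bounding_cycle_split:
  fixes z :: "'a::order set \<Rightarrow> 'k::field"
  assumes "finite A" "x \<in> A" "z \<in> ocycles (A - {x}) j" "z \<in> obounds A j"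
  obtains b w where "b \<in> obounds (A - {x}) j" "w \<in> ocycles (comparables A x) j" "z = b + w"
proof -
  obtain d where d: "d \<in> ochains A (j + 1)" "bdry d = z"
    using assms(4) by (auto simp: boundaries_def)
  have w: "link x d \<in> ochains (comparables A x) j"
    using link_in_ochains[OF d(1), of x] by simp
  have "link x z = 0"
    using link_eq_0[of z "A - {x}" j x] assms(3) by (simp add: cycles_def)
  then have bw: "bdry (link x d) = 0"
    using link_bdry[OF assms(1) d(1), of x] d(2) by simp
  have "z = bdry (avoid x d) + link x d"
    using bdry_decompose[OF assms(1,2) d(1)] by (simp add: bw d(2) add.commute)
  moreover have "bdry (avoid x d) \<in> obounds (A - {x}) j"
    using avoid_in_ochains[OF d(1)] by (auto simp: boundaries_def)
  ultimately show thesis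
    using that w bw by (simp add: cycles_def)
qed

text \<open>A piece of the exact sequence for attaching a vertex: whatever dies when
  \<open>x\<close> is attached comes from the homology of its link.\<close>

lemma hdim_remove_le:
  assumes "finite A" "x \<in> A"
  shows "hdim TYPE('k::field) (order_complex (A - {x})) j
    \<le> hdim TYPE('k) (order_complex A) j + hdim TYPE('k) (order_complex (comparables A x)) j"
proof -
  let ?S = "ocycles (comparables A x) j :: ('a set \<Rightarrow> 'k) set"
  let ?B = "obounds (comparables A x) j :: ('a set \<Rightarrow> 'k) set"
  have C: "finite (comparables A x)"
    using assms(1) by (rule finite_comparables)
  have "hdim TYPE('k) (order_complex (A - {x})) j + fs.dim ?B
    \<le> hdim TYPE('k) (order_complex A) j + fs.dim ?S"
  proof (rule hdim_le_if_bounds)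
    show "?B \<subseteq> ?S \<inter> obounds (A - {x}) j"
      using obounds_subset[OF C] obounds_mono[OF comparables_subset] by blast
    fix z :: "'a set \<Rightarrow> 'k" assume z: "z \<in> ocycles (A - {x}) j" "z \<in> obounds A j"
    show "\<exists>b\<in>obounds (A - {x}) j. \<exists>w\<in>?S. z = b + w"
      by (rule bounding_cycle_split[OF assms z]) blast
  next
    show "?S \<subseteq> ocycles (A - {x}) j"
      by (rule ocycles_mono[OF comparables_subset])
  qed (use assms ocycles_subspace[OF C] obounds_subspace[OF C] in auto)
  then show ?thesis
    using hdim_dim[OF C, of j, where 'k='k] by simp
qed

text \<open>The same exact sequence when the homology of the link maps to zero over
  \<open>A - {x}\<close>: attaching \<open>x\<close> then kills nothing.\<close>

lemma hdim_remove_le_if_link_bounds: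
  assumes "finite A" "x \<in> A"
    and "\<And>w :: 'a::order set \<Rightarrow> 'k::field. w \<in> ocycles (comparables A x) j \<Longrightarrow> w \<in> obounds (A - {x}) j"
  shows "hdim TYPE('k) (order_complex (A - {x})) j \<le> hdim TYPE('k) (order_complex A) j"
proof -
  have sB: "fs.subspace (obounds (A - {x}) j :: ('a set \<Rightarrow> 'k) set)"
    by (rule obounds_subspace) (use assms(1) in auto)
  have "hdim TYPE('k) (order_complex (A - {x})) j + fs.dim {0 :: 'a set \<Rightarrow> 'k}
    \<le> hdim TYPE('k) (order_complex A) j + fs.dim {0 :: 'a set \<Rightarrow> 'k}"
  proof (rule hdim_le_if_bounds)
    fix z :: "'a set \<Rightarrow> 'k" assume z: "z \<in> ocycles (A - {x}) j" "z \<in> obounds A j"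
    obtain b w where "b \<in> obounds (A - {x}) j" "w \<in> ocycles (comparables A x) j" "z = b + w"
      by (rule bounding_cycle_split[OF assms(1,2) z])
    then have "z \<in> obounds (A - {x}) j"
      using assms(3) fs.subspace_add[OF sB] by blast
    moreover have "z = z + 0" by simp
    ultimately show "\<exists>b\<in>obounds (A - {x}) j. \<exists>w\<in>{0}. z = b + w" by blast
  next
    show "{0} \<subseteq> (ocycles (A - {x}) j :: ('a set \<Rightarrow> 'k) set)"
      using fs.subspace_0[OF sB] obounds_subset[of "A - {x}" j] assms(1) by blast
  qed (use assms(1) fs.subspace_single_0 fs.subspace_0[OF sB] in auto)
  then show ?thesis by simp
qed

lemma acyclic_over_iff: "acyclic_over TYPE('k::field) A \<longleftrightarrow>
    (\<forall>i. (ocycles A i :: ('a::order set \<Rightarrow> 'k) set) \<subseteq> obounds A i)"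
  unfolding acyclic_over_def cycles_def obounds_iff[symmetric] by blast

lemma hdim_eq_0_iff:
  assumes "finite A"
  shows "hdim TYPE('k::field) (order_complex A) i = 0 \<longleftrightarrow>
    (ocycles A i :: ('a::order set \<Rightarrow> 'k) set) \<subseteq> obounds A i"
proof
  assume "hdim TYPE('k) (order_complex A) i = 0"
  moreover have b: "rel_basis (ocycles A i) (obounds A i) (hbasis (order_complex A) i :: ('a set \<Rightarrow> 'k) set)"
    using hbasis_is_basis[OF assms] homology_basis_iff[OF assms] by blast
  ultimately have "hbasis (order_complex A) i = ({} :: ('a set \<Rightarrow> 'k) set)"
    by (simp add: hdim_def rel_basis_def)
  with b show "(ocycles A i :: ('a set \<Rightarrow> 'k) set) \<subseteq> obounds A i"
    by (auto simp: rel_basis_def lincomb_eq)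
next
  assume "(ocycles A i :: ('a set \<Rightarrow> 'k) set) \<subseteq> obounds A i"
  then have "(ocycles A i :: ('a set \<Rightarrow> 'k) set) = obounds A i"
    using obounds_subset[OF assms] by blast
  then show "hdim TYPE('k) (order_complex A) i = 0"
    using hdim_dim[OF assms, of i, where 'k='k] by simp
qed

lemma acyclic_over_iff_hdim:
  "finite A \<Longrightarrow> acyclic_over TYPE('k::field) A \<longleftrightarrow> (\<forall>i. hdim TYPE('k) (order_complex A) i = 0)"
  by (simp add: acyclic_over_iff hdim_eq_0_iff)

lemma hdim_iso:
  assumes "finite A" "poset_iso B A e"
  shows "hdim TYPE('k::field) (order_complex B) i = hdim TYPE('k) (order_complex A) i"
proof -
  have B: "finite B"
    using assms by (metis bij_betw_finite poset_iso_def)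
  note inv = poset_iso_inv[OF assms(2)]
  let ?T = "pull B e :: ('a set \<Rightarrow> 'k) \<Rightarrow> _" and ?T' = "pull A (inv_into B e) :: ('b set \<Rightarrow> 'k) \<Rightarrow> _"
  have lin: "?T (x + y) = ?T x + ?T y" "?T (fscale a x) = fscale a (?T x)" for x y a
    by (auto simp: fun_eq_iff pull_def)
  have T0: "?T 0 = 0" "?T' 0 = 0"
    by (auto simp: fun_eq_iff pull_def)
  have inj: "inj_on ?T (ochains A i)" for i
    by (rule inj_on_inverseI) (rule pull_inv[OF assms(2)])
  have Z: "?T ` ocycles A i = ocycles B i"
  proof (intro equalityI subsetI)
    fix z assume "z \<in> ?T ` ocycles A i"
    then obtain y where "z = ?T y" "y \<in> ochains A i" "bdry y = 0"
      by (auto simp: cycles_def)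
    then show "z \<in> ocycles B i"
      using bdry_pull[OF B assms(2)] pull_in_ochains[OF assms(2)] T0 by (auto simp: cycles_def)
  next
    fix z :: "'b set \<Rightarrow> 'k" assume "z \<in> ocycles B i"
    then have z: "z \<in> ochains B i" "bdry z = 0"
      by (auto simp: cycles_def)
    then have "?T' z \<in> ocycles A i"
      using bdry_pull[OF assms(1) inv z(1)] pull_in_ochains[OF inv z(1)] T0 by (auto simp: cycles_def)
    then show "z \<in> ?T ` ocycles A i"
      by (rule image_eqI[rotated]) (rule pull_inv'[OF assms(2) z(1), symmetric])
  qed
  have Bd: "?T ` obounds A i = obounds B i"
  proof (intro equalityI subsetI)
    fix z assume "z \<in> ?T ` obounds A i"
    then obtain y where "z = ?T (bdry y)" "y \<in> ochains A (i + 1)"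
      by (auto simp: boundaries_def)
    then have "pull B e y \<in> ochains B (i + 1)" "bdry (pull B e y) = z"
      using bdry_pull[OF B assms(2)] pull_in_ochains[OF assms(2)] by auto
    then show "z \<in> obounds B i"
      unfolding obounds_iff by blast
  next
    fix z :: "'b set \<Rightarrow> 'k" assume "z \<in> obounds B i"
    then obtain y where y: "z = bdry y" "y \<in> ochains B (i + 1)"
      by (auto simp: boundaries_def)
    have "?T (bdry (?T' y)) = z"
      using bdry_pull[OF B assms(2) pull_in_ochains[OF inv y(2)]] pull_inv'[OF assms(2) y(2)] y(1) by simp
    moreover have "bdry (?T' y) \<in> obounds A i"
      using pull_in_ochains[OF inv y(2)] by (auto simp: boundaries_def)
    ultimately show "z \<in> ?T ` obounds A i"
      by (intro image_eqI[OF sym])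
  qed
  have "fs.dim (?T ` ocycles A i) = fs.dim (ocycles A i :: ('a set \<Rightarrow> 'k) set)"
    by (intro dim_linear_image lin ocycles_subspace assms inj_on_subset[OF inj[of i]] ocycles_ochains)
  moreover have "fs.dim (?T ` obounds A i) = fs.dim (obounds A i :: ('a set \<Rightarrow> 'k) set)"
    by (intro dim_linear_image lin obounds_subspace assms inj_on_subset[OF inj[of i]])
      (use obounds_subset[OF assms(1)] ocycles_ochains in blast)
  ultimately show ?thesis
    using hdim_dim[OF assms(1), of i, where 'k='k] hdim_dim[OF B, of i, where 'k='k] by (simp add: Z Bd)
qed

section \<open>Betti posets\<close>

definition finite_pointed :: "'a::order set \<Rightarrow> bool" where
  "finite_pointed Q \<longleftrightarrow> finite Q \<and> (\<exists>m\<in>Q. \<forall>x\<in>Q. m \<le> x)"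

definition below :: "'a::order set \<Rightarrow> 'a \<Rightarrow> 'a set" where
  "below Q p = {x \<in> Q. pbot Q < x \<and> x < p}"

definition proper :: "'a::order set \<Rightarrow> 'a set" where
  "proper Q = {x \<in> Q. pbot Q < x}"

definition down_closed :: "'a::order set \<Rightarrow> 'a set \<Rightarrow> bool" where
  "down_closed Q A \<longleftrightarrow> A \<subseteq> Q \<and> (\<forall>x\<in>A. \<forall>y\<in>Q. y \<le> x \<longrightarrow> y \<in> A)"

lemma Delta_below: "Delta Q p = order_complex (below Q p)"
  by (simp add: Delta_def below_def)

lemma pbot_eqI: "m \<in> Q \<Longrightarrow> (\<And>x. x \<in> Q \<Longrightarrow> m \<le> x) \<Longrightarrow> pbot Q = m"
  unfolding pbot_def by (rule Least_equality)

lemma finite_pointedD: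
  assumes "finite_pointed Q"
  shows "finite Q" "pbot Q \<in> Q" "\<And>x. x \<in> Q \<Longrightarrow> pbot Q \<le> x"
  using assms pbot_eqI unfolding finite_pointed_def by blast+

lemma proper_eq: "finite_pointed Q \<Longrightarrow> proper Q = Q - {pbot Q}"
  using finite_pointedD[of Q] by (auto simp: proper_def order_le_less)

lemma finite_below: "finite_pointed Q \<Longrightarrow> finite (below Q p)"
  and finite_proper: "finite_pointed Q \<Longrightarrow> finite (proper Q)"
  using finite_pointedD(1)[of Q] by (auto simp: below_def proper_def)

lemma below_eq: "below Q p = {x \<in> proper Q. x < p}"
  by (auto simp: below_def proper_def)

lemma down_closed_finite: "finite_pointed Q \<Longrightarrow> down_closed (proper Q) A \<Longrightarrow> finite A"
  unfolding down_closed_def using finite_proper finite_subset by blast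

lemma order_complex_empty: "order_complex {} = {{}}"
  by (auto simp: order_complex_def chain_def)

lemma ochains_empty_iff:
  "c \<in> ochains {} i \<longleftrightarrow> (\<forall>\<sigma>. c \<sigma> \<noteq> 0 \<longrightarrow> \<sigma> = {} \<and> i = -1)"
  by (auto simp: chains_def order_complex_empty)

lemma ochains_below_minus_one:
  assumes "i < -1" "c \<in> ochains A i"
  shows "c = 0"
  using ochainsD(4)[OF assms(2)] assms(1) by (force simp: fun_eq_iff)

lemma hdim_below_minus_one:
  assumes "finite A" "i < -1"
  shows "hdim TYPE('k::field) (order_complex A) i = 0"
proof -
  have "(ocycles A i :: ('a set \<Rightarrow> 'k) set) \<subseteq> {0}"
    using ochains_below_minus_one[OF assms(2)] by (auto simp: cycles_def)
  then show ?thesis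
    unfolding hdim_eq_0_iff[OF assms(1)] using fs.subspace_0[OF obounds_subspace[OF assms(1)]] by blast
qed

lemma obounds_empty: "obounds {} (-1) = {0 :: 'a::order set \<Rightarrow> 'k::field}"
proof -
  have "ochains {} 0 = {0 :: 'a set \<Rightarrow> 'k}"
    by (auto simp: ochains_empty_iff fun_eq_iff)
  then show ?thesis
    by (simp add: boundaries_def)
qed

text \<open>The indicator of the empty face is a cycle of degree -1 that bounds nothing. This is
  what puts the minimum and the atoms into the Betti poset.\<close>

lemma hdim_empty_nonzero: "hdim TYPE('k::field) (order_complex ({} :: 'a::order set)) (-1) \<noteq> 0"
proof -
  define c :: "'a set \<Rightarrow> 'k" where "c = (\<lambda>\<sigma>. if \<sigma> = {} then 1 else 0)"
  have c: "c \<in> ochains {} (-1)"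
    by (auto simp: ochains_empty_iff c_def)
  have "bdry c = 0"
    using bdry_ochain[OF finite.emptyI c] by (auto simp: fun_eq_iff)
  then have "c \<in> ocycles {} (-1)"
    using c by (simp add: cycles_def)
  moreover have "c \<noteq> 0"
    by (auto simp: c_def fun_eq_iff)
  ultimately show ?thesis
    unfolding hdim_eq_0_iff[OF finite.emptyI] obounds_empty by blast
qed

section \<open>Comparison of a poset with its Betti poset\<close>

context
  fixes P Q :: "'a::order set" and k :: "'k::field itself"
  assumes P: "finite_pointed P" and Q: "Q = betti_poset TYPE('k) P"
begin

lemma betti_poset_pbot_mem: "pbot P \<in> Q"
proof -
  have "below P (pbot P) = {}"
    by (auto simp: below_def)
  then show ?thesis
    using hdim_empty_nonzero[where 'k='k and 'a='a] finite_pointedD(2)[OF P]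
    unfolding Q betti_poset_def Delta_below by auto
qed

lemma betti_poset_subset: "Q \<subseteq> P"
  by (auto simp: Q betti_poset_def)

lemma betti_poset_pointed: "finite_pointed Q"
  unfolding finite_pointed_def
  using betti_poset_pbot_mem betti_poset_subset finite_pointedD[OF P] finite_subset by blast

lemma betti_poset_pbot: "pbot Q = pbot P"
  using betti_poset_pbot_mem betti_poset_subset finite_pointedD[OF P] by (intro pbot_eqI) auto

lemma betti_poset_below: "below Q p = below P p \<inter> Q"
  using betti_poset_subset by (auto simp: below_def betti_poset_pbot)

lemma betti_poset_proper: "proper Q = proper P \<inter> Q"
  using betti_poset_subset by (auto simp: proper_def betti_poset_pbot)

text \<open>By induction, the elements below \<open>y\<close> that are not in \<open>Q\<close> have
  acyclic lower fibres. Hence \<open>below P y\<close> has the homology of its trace on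
  \<open>Q\<close>, and it is acyclic because \<open>y\<close> is not in the Betti poset.\<close>

lemma acyclic_below_not_betti:
  assumes "y \<in> proper P" "y \<notin> Q"
  shows "acyclic_over TYPE('k) (below Q y)"
  using assms
proof (induction "card (below P y)" arbitrary: y rule: less_induct)
  case less
  have fin: "finite (below P y)"
    by (rule finite_below[OF P])
  have "rel_acyclic TYPE('k) (below P y \<inter> Q) (below P y)"
  proof (rule rel_acyclic_if_lower_fibers_acyclic[OF fin])
    fix x assume x: "x \<in> below P y - Q"
    then have "{z \<in> below P y \<inter> Q. z < x} = below Q x"
      unfolding betti_poset_below by (auto simp: below_def)
    moreover have "card (below P x) < card (below P y)"
      using x by (intro psubset_card_mono[OF fin]) (auto simp: below_def)
    ultimately show "acyclic_over TYPE('k) {z \<in> below P y \<inter> Q. z < x}"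
      using less.hyps[of x] x by (simp add: below_def proper_def)
  qed
  moreover have "\<forall>i. hdim TYPE('k) (order_complex (below P y)) i = 0"
    using less.prems by (auto simp: Q betti_poset_def Delta_below proper_def)
  then have "acyclic_over TYPE('k) (below P y)"
    by (simp add: acyclic_over_iff_hdim[OF fin])
  ultimately show ?case
    unfolding betti_poset_below by (rule acyclic_over_down[OF fin])
qed

text \<open>In a down-set the lower fibre of an element \<open>y\<close> outside \<open>Q\<close> is
  all of \<open>below Q y\<close>.\<close>

lemma rel_acyclic_betti:
  assumes "down_closed (proper P) A"
  shows "rel_acyclic TYPE('k) (A \<inter> Q) A"
proof (rule rel_acyclic_if_lower_fibers_acyclic)
  show "finite A"
    using down_closed_finite[OF P assms] .
  fix y assume y: "y \<in> A - Q"
  then have "{x \<in> A \<inter> Q. x < y} = below Q y"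
    using assms by (auto simp: down_closed_def below_eq betti_poset_proper dest: less_imp_le)
  then show "acyclic_over TYPE('k) {x \<in> A \<inter> Q. x < y}"
    using acyclic_below_not_betti[of y] y assms by (auto simp: down_closed_def)
qed

lemma hdim_betti_poset: "hdim TYPE('k) (Delta Q p) i = hdim TYPE('k) (Delta P p) i"
proof -
  have "down_closed (proper P) (below P p)"
    by (auto simp: down_closed_def below_eq)
  then show ?thesis
    unfolding Delta_below betti_poset_below
    by (intro hdim_rel_acyclic[OF finite_below[OF P]] rel_acyclic_betti)
qed

text \<open>The proper elements of \<open>P\<close> up to \<open>x\<close> form a cone with apex
  \<open>x\<close>. As a down-set it may be cut down to \<open>Q\<close>, whether or not
  \<open>x\<close> belongs to \<open>Q\<close>.\<close>

lemma acyclic_betti_le: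
  assumes "x \<in> proper P"
  shows "acyclic_over TYPE('k) {y \<in> proper Q. y \<le> x}"
proof -
  let ?A = "{y \<in> proper P. y \<le> x}"
  have fin: "finite ?A"
    using finite_proper[OF P] by simp
  have "acyclic_over TYPE('k) ?A"
    by (rule acyclic_over_cone[of _ x]) (use fin assms in auto)
  moreover have "down_closed (proper P) ?A"
    by (auto simp: down_closed_def)
  ultimately have "acyclic_over TYPE('k) (?A \<inter> Q)"
    using acyclic_over_down[OF fin rel_acyclic_betti] by blast
  moreover have "?A \<inter> Q = {y \<in> proper Q. y \<le> x}"
    unfolding betti_poset_proper by auto
  ultimately show ?thesis by simp
qed

end

text \<open>The missing elements are attached along a linear extension. Then the link of each new
  \<open>x\<close> is exactly the set of elements of \<open>R\<close> below it, and the estimates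
  for single vertices add up.\<close>

lemma hdim_add_set_le:
  assumes R: "finite R" "down_closed R A" "down_closed R A'" "A \<subseteq> A'"
  shows "hdim TYPE('k::field) (order_complex A) j \<le> hdim TYPE('k) (order_complex A') j
    + (\<Sum>x\<in>A' - A. hdim TYPE('k) (order_complex {y \<in> R. y < x}) j)"
  using assms
proof (induction "card (A' - A)" arbitrary: A)
  case 0
  have "finite A'"
    using 0 finite_subset unfolding down_closed_def by metis
  then have "A' = A"
    using 0 by auto
  then show ?case by simp
next
  case (Suc n)
  have fin: "finite A'"
    using Suc.prems finite_subset unfolding down_closed_def by metis
  have "A' - A \<noteq> {}" "finite (A' - A)"
    using Suc.hyps(2) fin by (metis card.empty nat.distinct(1)) (use fin in simp)
  then obtain x where x: "x \<in> A' - A" "\<And>y. y \<in> A' - A \<Longrightarrow> \<not> y < x"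
    by (metis finite_minimal_exists)
  let ?A1 = "insert x A"
  have lower: "y \<in> A" if "y \<in> R" "y < x" for y
  proof -
    have "y \<in> A'"
      using that x(1) Suc.prems(3) less_imp_le unfolding down_closed_def by blast
    then show ?thesis
      using x(2) that(2) by blast
  qed
  have dA1: "down_closed R ?A1"
    using Suc.prems(2,3) x(1) lower by (auto simp: down_closed_def order_le_less)
  have "x \<notin> A" "finite ?A1"
    using x fin Suc.prems(4) finite_subset by auto
  moreover have "\<not> x < y" if "y \<in> A" for y
    using that x(1) Suc.prems(2,3) less_imp_le unfolding down_closed_def by blast
  then have "comparables ?A1 x = {y \<in> R. y < x}"
    using lower Suc.prems(2) by (auto simp: comparables_def down_closed_def)
  ultimately have 1: "hdim TYPE('k) (order_complex A) j
      \<le> hdim TYPE('k) (order_complex ?A1) j + hdim TYPE('k) (order_complex {y \<in> R. y < x}) j"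
    using hdim_remove_le[of ?A1 x j, where 'k='k] by simp
  have "A' - ?A1 = (A' - A) - {x}"
    by auto
  then have "card (A' - ?A1) = n" and
    sum: "(\<Sum>x\<in>A' - A. hdim TYPE('k) (order_complex {y \<in> R. y < x}) j) =
      hdim TYPE('k) (order_complex {y \<in> R. y < x}) j
      + (\<Sum>x\<in>A' - ?A1. hdim TYPE('k) (order_complex {y \<in> R. y < x}) j)"
    using Suc.hyps(2) x(1) fin by (auto simp: sum.remove[of "A' - A" x])
  then show ?case
    using Suc.hyps(1)[of ?A1] Suc.prems dA1 x(1) 1 by auto
qed

section \<open>Rigid Betti posets\<close>

lemma card_le_if_strict_mono_on_chain:
  fixes r :: "'a::order \<Rightarrow> nat"
  assumes "\<And>x y. x \<in> \<sigma> \<Longrightarrow> y \<in> \<sigma> \<Longrightarrow> x \<le> y \<or> y \<le> x"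
    and "\<And>x y. x \<in> \<sigma> \<Longrightarrow> y \<in> \<sigma> \<Longrightarrow> x < y \<Longrightarrow> r x < r y"
    and "\<And>x. x \<in> \<sigma> \<Longrightarrow> 1 \<le> r x \<and> r x \<le> n"
  shows "inj_on r \<sigma>" "card \<sigma> \<le> n" "card \<sigma> = n \<Longrightarrow> r ` \<sigma> = {1..n}"
proof -
  show inj: "inj_on r \<sigma>"
    using assms(1,2) by (intro inj_onI) (metis less_irrefl order_le_less)
  have sub: "r ` \<sigma> \<subseteq> {1..n}"
    using assms(3) by auto
  then have "card (r ` \<sigma>) \<le> n"
    using card_mono[of "{1..n}" "r ` \<sigma>"] by simp
  then show "card \<sigma> \<le> n"
    using card_image[OF inj] by simp
  show "r ` \<sigma> = {1..n}" if "card \<sigma> = n"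
    using card_subset_eq[OF _ sub] card_image[OF inj] that by simp
qed

text \<open>The rank \<open>r q\<close> is the only index at which \<open>q\<close> contributes to
  the complex; the shift by 2 is the one between that index and the homological degree. The second
  rigidity condition enters only as distinctness of ranks of comparable elements.\<close>

locale rigid_poset =
  fixes k :: "'k::field itself" and Q :: "'a::order set" and r :: "'a \<Rightarrow> nat"
  assumes pointed: "finite_pointed Q"
    and r_pos: "\<And>q. q \<in> proper Q \<Longrightarrow> 1 \<le> r q"
    and hdim_below: "\<And>q j. q \<in> proper Q \<Longrightarrow>
      hdim TYPE('k) (order_complex (below Q q)) j = (if j = int (r q) - 2 then 1 else 0)"
    and r_neq: "\<And>p q. p \<in> proper Q \<Longrightarrow> q \<in> proper Q \<Longrightarrow> p < q \<Longrightarrow> r p \<noteq> r q"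
begin

lemma fin_below [simp]: "finite (below Q q)"
  by (rule finite_below[OF pointed])

lemma fin_proper [simp]: "finite (proper Q)"
  by (rule finite_proper[OF pointed])

text \<open>A cycle generating the homology below \<open>p\<close> is a combination of chains with \<open>r p - 1\<close>
  elements, so there must be enough smaller ranks below \<open>p\<close>.\<close>

lemma r_mono:
  assumes "p \<in> proper Q" "q \<in> proper Q" "p < q"
  shows "r p < r q"
  using assms
proof (induction "card (below Q q)" arbitrary: p q rule: less_induct)
  case less
  show ?case
  proof (rule ccontr)
    assume nless: "\<not> r p < r q"
    \<comment> \<open>Below a minimal element \<open>p0\<close> of \<open>S\<close> all ranks are
      smaller than \<open>r q\<close>, and by induction they increase along chains there, so such a
      chain has at most \<open>r q - 1\<close> elements. Those in a nonzero cycle below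
      \<open>p0\<close>, however, have \<open>r p0 - 1\<close>, which is at least
      \<open>r q\<close>.\<close>
    define S where "S = {p \<in> proper Q. p < q \<and> r q < r p}"
    have "p \<in> S"
      using less.prems r_neq[of p q] nless by (auto simp: S_def)
    moreover have "finite S"
      by (simp add: S_def)
    ultimately obtain p0 where p0: "p0 \<in> S" "\<And>x. x \<in> S \<Longrightarrow> \<not> x < p0"
      by (metis finite_minimal_exists empty_iff)
    have p0': "p0 \<in> proper Q" "p0 < q" "r q < r p0"
      using p0(1) by (auto simp: S_def)
    have "hdim TYPE('k) (order_complex (below Q p0)) (int (r p0) - 2) \<noteq> 0"
      using hdim_below[OF p0'(1)] by simp
    then obtain c :: "'a set \<Rightarrow> 'k" where c: "c \<in> ochains (below Q p0) (int (r p0) - 2)"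
      and "c \<notin> obounds (below Q p0) (int (r p0) - 2)"
      unfolding hdim_eq_0_iff[OF fin_below] cycles_def by blast
    then have "c \<noteq> 0"
      using fs.subspace_0[OF obounds_subspace[OF fin_below]] by metis
    then obtain \<sigma> where "c \<sigma> \<noteq> 0"
      by (auto simp: fun_eq_iff)
    note * = ochainsD[OF c this]
    have mem: "x \<in> proper Q" "x < p0" if "x \<in> \<sigma>" for x
      using *(2) that by (auto simp: below_eq)
    have "card \<sigma> \<le> r q - 1"
    proof (rule card_le_if_strict_mono_on_chain(2)[OF *(3)])
      fix x y assume xy: "x \<in> \<sigma>" "y \<in> \<sigma>" "x < y"
      have "y < q"
        using mem(2)[OF xy(2)] p0'(2) by simp
      moreover have "card (below Q y) < card (below Q q)"
        using \<open>y < q\<close> mem(1)[OF xy(2)] by (intro psubset_card_mono) (auto simp: below_eq)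
      ultimately show "r x < r y"
        using less.hyps[of y x] mem(1) xy by blast
    next
      fix x assume x: "x \<in> \<sigma>"
      have "x < q"
        using mem(2)[OF x] p0'(2) by simp
      moreover have "\<not> r q < r x"
        using p0(2)[of x] mem[OF x] \<open>x < q\<close> by (auto simp: S_def)
      ultimately show "1 \<le> r x \<and> r x \<le> r q - 1"
        using r_pos[OF mem(1)[OF x]] r_neq[OF mem(1)[OF x] less.prems(2)] by auto
    qed
    then show False
      using *(4) p0'(3) r_pos[OF less.prems(2)] by linarith
  qed
qed

text \<open>Ranks are positive and strictly increasing, so a chain of maximal length takes every
  rank exactly once. This makes the elements of top rank visible in chains of top dimension.\<close>

lemma rank_chain:
  assumes "c \<in> ochains (proper Q) i" "c \<sigma> \<noteq> 0" "\<And>x. x \<in> \<sigma> \<Longrightarrow> r x \<le> n"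
  shows "inj_on r \<sigma>" "i + 1 \<le> int n" "i + 1 = int n \<Longrightarrow> r ` \<sigma> = {1..n}"
proof -
  note * = ochainsD[OF assms(1,2)]
  have mem: "x \<in> proper Q" if "x \<in> \<sigma>" for x
    using *(2) that by blast
  note card = card_le_if_strict_mono_on_chain[where \<sigma>=\<sigma> and r=r and n=n, OF *(3)]
  have mono: "r x < r y" if "x \<in> \<sigma>" "y \<in> \<sigma>" "x < y" for x y
    using r_mono mem that by blast
  have bd: "1 \<le> r x \<and> r x \<le> n" if "x \<in> \<sigma>" for x
    using assms(3) r_pos mem that by blast
  show "inj_on r \<sigma>"
    by (rule card(1)[OF _ _ mono bd])
  have "card \<sigma> \<le> n"
    by (rule card(2)[OF _ _ mono bd])
  then show "i + 1 \<le> int n"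
    using *(4) by linarith
  show "r ` \<sigma> = {1..n}" if "i + 1 = int n"
    by (rule card(3)[OF _ _ mono bd]) (use that *(4) in auto)
qed

lemma ochains_rank_eq_0:
  assumes "c \<in> ochains A i" "A \<subseteq> proper Q" "\<And>x. x \<in> A \<Longrightarrow> r x \<le> n" "int n < i + 1"
  shows "c = 0"
proof
  fix \<sigma>
  show "c \<sigma> = 0 \<sigma>"
  proof (rule ccontr)
    assume "c \<sigma> \<noteq> 0 \<sigma>"
    then have nz: "c \<sigma> \<noteq> 0" by simp
    have "i + 1 \<le> int n"
      by (rule rank_chain(2)[OF ochains_mono[OF assms(1,2)] nz]) (use assms(3) ochainsD(2)[OF assms(1) nz] in blast)
    then show False
      using assms(4) by simp
  qed
qed

lemma below_rank: "q \<in> proper Q \<Longrightarrow> x \<in> below Q q \<Longrightarrow> x \<in> proper Q \<and> x < q \<and> r x \<le> r q - 1"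
  using r_mono[of x q] by (auto simp: below_eq)

text \<open>Ranks below \<open>q\<close> are at most \<open>r q - 1\<close>, so no chain there has
  \<open>r q\<close> elements. In the relevant degree homology therefore consists of cycles, with
  nothing to divide out.\<close>

lemma obounds_top: 
  assumes "q \<in> proper Q"
  shows "obounds (below Q q) (int (r q) - 2) = {0 :: 'a set \<Rightarrow> 'k}"
proof -
  have "c = 0" if "c \<in> ochains (below Q q) (int (r q) - 2 + 1)" for c :: "'a set \<Rightarrow> 'k"
    by (rule ochains_rank_eq_0[OF that, of "r q - 1"])
      (use below_rank[OF assms] r_pos[OF assms] in auto)
  then have "ochains (below Q q) (int (r q) - 2 + 1) = {0 :: 'a set \<Rightarrow> 'k}"
    by (metis (no_types, lifting) ochains_zero is_singletonI' is_singleton_def singleton_iff empty_iff)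
  then show ?thesis
    by (simp add: boundaries_def)
qed

text \<open>The member of the very basis chosen by \<open>hbasis\<close>, so that
  \<open>hcoord\<close> and the generators of \<open>poset_complex\<close> refer to it
  directly.\<close>

definition gen :: "'a \<Rightarrow> 'a set \<Rightarrow> 'k" where
  "gen q = (THE z. hbasis (order_complex (below Q q)) (int (r q) - 2) = {z})"

lemma hbasis_gen:
  assumes "q \<in> proper Q"
  shows "(hbasis (order_complex (below Q q)) (int i - 2) :: ('a set \<Rightarrow> 'k) set) =
    (if r q = i then {gen q} else {})"
proof (cases "r q = i")
  case True
  have "card (hbasis (order_complex (below Q q)) (int (r q) - 2) :: ('a set \<Rightarrow> 'k) set) = 1"
    using hdim_below[OF assms, of "int (r q) - 2"] by (simp add: hdim_def)
  then obtain z where z: "(hbasis (order_complex (below Q q)) (int (r q) - 2) :: ('a set \<Rightarrow> 'k) set) = {z}"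
    by (metis card_1_singletonE)
  then have "gen q = z"
    unfolding gen_def by (intro the_equality) auto
  with z True show ?thesis by simp
next
  case False
  have "card (hbasis (order_complex (below Q q)) (int i - 2) :: ('a set \<Rightarrow> 'k) set) = 0"
    using hdim_below[OF assms, of "int i - 2"] False by (simp add: hdim_def)
  moreover have "finite (hbasis (order_complex (below Q q)) (int i - 2) :: ('a set \<Rightarrow> 'k) set)"
    using hbasis_is_basis[OF fin_below, of q "int i - 2", where 'k='k] by (simp only: homology_basis_def)
  ultimately show ?thesis
    using False by simp
qed

lemma rel_basis_gen:
  assumes "q \<in> proper Q"
  shows "rel_basis (ocycles (below Q q) (int (r q) - 2)) {0} {gen q}"
  using hbasis_is_basis[OF fin_below, of q "int (r q) - 2", where 'k='k] hbasis_gen[OF assms, of "r q"]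
  by (simp add: homology_basis_iff[OF fin_below] obounds_top[OF assms])

lemma gen_cycle:
  assumes "q \<in> proper Q"
  shows "gen q \<in> ochains (below Q q) (int (r q) - 2)" "bdry (gen q) = 0"
  using rel_basis_gen[OF assms] by (auto simp: rel_basis_def cycles_def)

lemma lincomb_singleton: "lincomb u {x} = fscale (u x) x"
  by (simp add: lincomb_eq)

lemma cycle_multiple_of_gen:
  assumes "q \<in> proper Q" "c \<in> ochains (below Q q) (int (r q) - 2)" "bdry c = 0"
  obtains a where "c = fscale a (gen q)"
proof -
  have "c \<in> ocycles (below Q q) (int (r q) - 2)"
    using assms by (simp add: cycles_def)
  then obtain u where "c - lincomb u {gen q} \<in> {0}"
    using rel_basis_gen[OF assms(1)] unfolding rel_basis_def by blast
  then have "c = fscale (u (gen q)) (gen q)"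
    by (simp add: lincomb_singleton)
  then show thesis by (rule that)
qed

lemma gen_nonzero:
  assumes "q \<in> proper Q"
  shows "gen q \<noteq> 0"
proof
  assume 0: "gen q = 0"
  define u where "u = (\<lambda>x::'a set \<Rightarrow> 'k. if x = gen q then 1 else 0 :: 'k)"
  have "lincomb u {gen q} \<in> {0}"
    by (simp add: lincomb_singleton 0)
  then have "u = (\<lambda>_. 0)"
    by (intro rel_basis_lincomb_eq_0[OF ocycles_subspace[OF fin_below] fs.subspace_single_0 rel_basis_gen[OF assms]])
      (auto simp: u_def)
  then have "u (gen q) = 0" by simp
  then show False
    by (simp add: u_def)
qed

lemma fscale_gen_eq_iff: "q \<in> proper Q \<Longrightarrow> fscale a (gen q) = fscale b (gen q) \<longleftrightarrow> a = b"
  using gen_nonzero by (simp add: fs.scale_cancel_right)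

lemma hcoord_gen:
  assumes "q \<in> proper Q" "j = int (r q) - 2"
  shows "hcoord (order_complex (below Q q)) j (hclass (order_complex (below Q q)) j (fscale a (gen q))) (gen q) = a"
proof -
  let ?P = "\<lambda>u. (\<forall>x. x \<notin> {gen q} \<longrightarrow> u x = 0) \<and>
    hclass (order_complex (below Q q)) j (fscale a (gen q)) =
    hclass (order_complex (below Q q)) j (lincomb u {gen q})"
  have "?P u \<longleftrightarrow> u = (\<lambda>x. if x = gen q then a else 0)" for u
  proof -
    have "?P u \<longleftrightarrow> (\<forall>x. x \<noteq> gen q \<longrightarrow> u x = 0) \<and> a = u (gen q)"
      unfolding hclass_eq_iff[OF fin_below] assms(2) obounds_top[OF assms(1)] lincomb_singleton
      by (simp add: gen_nonzero[OF assms(1)])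
    also have "\<dots> \<longleftrightarrow> u = (\<lambda>x. if x = gen q then a else 0)"
      by (auto simp: fun_eq_iff[of u])
    finally show ?thesis .
  qed
  then have "(THE u. ?P u) = (\<lambda>x. if x = gen q then a else 0)"
    by simp
  then show ?thesis
    unfolding hcoord_def using hbasis_gen[OF assms(1), of "r q"] assms(2) by simp
qed

text \<open>Each chain of the top dimension contains exactly one element of the top rank.\<close>

lemma top_rank_decompose:
  assumes "c \<in> ochains A i" "A \<subseteq> proper Q" "\<And>x. x \<in> A \<Longrightarrow> r x \<le> n" "i + 1 = int n" "1 \<le> n"
  shows "c = (\<Sum>q | q \<in> A \<and> r q = n. cone q (link q c))"
proof
  fix \<sigma>
  have A: "finite A"
    using assms(2) fin_proper finite_subset by blast
  have cl: "cone q (link q c) \<sigma> = (if q \<in> \<sigma> then c \<sigma> else 0)" for q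
    by (simp add: cone_def link_def insert_absorb)
  show "c \<sigma> = (\<Sum>q | q \<in> A \<and> r q = n. cone q (link q c)) \<sigma>"
  proof (cases "c \<sigma> = 0")
    case True
    then show ?thesis
      by (simp add: sum_apply cl sum.neutral)
  next
    case False
    note * = ochainsD[OF assms(1) False]
    have rk: "inj_on r \<sigma>" "r ` \<sigma> = {1..n}"
      using rank_chain[OF ochains_mono[OF assms(1,2)] False, of n] assms(3,4) *(2) by blast+
    then obtain q0 where q0: "q0 \<in> \<sigma>" "r q0 = n"
      using assms(5) by (metis atLeastAtMost_iff image_iff order_refl)
    have "(\<Sum>q | q \<in> A \<and> r q = n. cone q (link q c)) \<sigma> = (\<Sum>q | q \<in> A \<and> r q = n. if q = q0 then c \<sigma> else 0)"
      unfolding sum_apply cl using q0 rk(1) by (intro sum.cong) (auto dest: inj_onD)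
    also have "\<dots> = c \<sigma>"
      using A q0 subsetD[OF *(2) q0(1)] by simp
    finally show ?thesis ..
  qed
qed

end

section \<open>Incidence numbers and exactness\<close>

context rigid_poset
begin

lemma comparables_below:
  assumes "p \<in> proper Q" "q \<in> proper Q" "r q = Suc (r p)"
  shows "comparables (below Q q) p \<subseteq> below Q p"
proof
  fix x assume x: "x \<in> comparables (below Q q) p"
  then have "x \<in> proper Q" "x < q" "x < p \<or> p < x"
    by (auto simp: comparables_def below_eq)
  moreover have "\<not> p < x"
    using r_mono[of p x] r_mono[of x q] assms calculation by auto
  ultimately show "x \<in> below Q p"
    by (simp add: below_eq)
qed

text \<open>The link of \<open>gen q\<close> at an element \<open>p\<close> of the preceding rank is
  a cycle of the degree belonging to \<open>p\<close>, hence a multiple of \<open>gen p\<close>. The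
  factor is the incidence number, later the matrix entry of the differential.\<close>

definition co :: "'a \<Rightarrow> 'a \<Rightarrow> 'k" where
  "co q p = (THE a. link p (gen q) = fscale a (gen p))"

lemma link_gen:
  assumes "p \<in> proper Q" "q \<in> proper Q" "r q = Suc (r p)"
  shows "link p (gen q) = fscale (co q p) (gen p)"
proof -
  have "link p (gen q) \<in> ochains (below Q p) (int (r q) - 2 - 1)"
    by (rule ochains_mono[OF link_in_ochains[OF gen_cycle(1)[OF assms(2)]] comparables_below[OF assms]])
  moreover have "int (r q) - 2 - 1 = int (r p) - 2"
    using assms(3) by simp
  moreover have "bdry (link p (gen q)) = 0"
    using link_bdry[OF fin_below gen_cycle(1)[OF assms(2)], of p] gen_cycle(2)[OF assms(2)] by simp
  ultimately obtain a where a: "link p (gen q) = fscale a (gen p)"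
    using cycle_multiple_of_gen[OF assms(1)] by metis
  then have "co q p = a"
    unfolding co_def by (simp add: gen_nonzero[OF assms(1)])
  with a show ?thesis by simp
qed

lemma co_eq_0:
  assumes "p \<in> proper Q" "q \<in> proper Q" "r q = Suc (r p)" "\<not> p < q"
  shows "co q p = 0"
proof -
  have "link p (gen q) = 0"
    by (rule link_eq_0[OF gen_cycle(1)[OF assms(2)]]) (use assms(4) in \<open>simp add: below_eq\<close>)
  then show ?thesis
    using link_gen[OF assms(1-3)] gen_nonzero[OF assms(1)] by (simp add: fs.scale_eq_0_iff)
qed

text \<open>The cone over \<open>gen q\<close> is the cell contributed by \<open>q\<close>, of
  dimension \<open>r q - 1\<close> and with attaching cycle \<open>gen q\<close>.\<close>

lemma cone_gen_in_ochains:
  assumes "q \<in> proper Q"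
  shows "cone q (fscale a (gen q)) \<in> ochains (insert q (below Q q)) (int (r q) - 1)"
proof -
  have "comparables (insert q (below Q q)) q = below Q q"
    by (auto simp: comparables_def below_eq)
  then show ?thesis
    using cone_in_ochains[of q "insert q (below Q q)" "fscale a (gen q)" "int (r q) - 2"]
      ochains_scale[OF gen_cycle(1)[OF assms]] by simp
qed

lemma bdry_cone_gen:
  assumes "q \<in> proper Q"
  shows "bdry (cone q (fscale a (gen q))) = fscale a (gen q)"
proof -
  have "comparables (insert q (below Q q)) q = below Q q"
    by (auto simp: comparables_def below_eq)
  then have 1: "bdry (cone q (fscale a (gen q))) = fscale a (gen q) - cone q (bdry (fscale a (gen q)))"
    using bdry_cone[of "insert q (below Q q)" q "fscale a (gen q)" "int (r q) - 2"]
      ochains_scale[OF gen_cycle(1)[OF assms]] by simp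
  have 2: "bdry (fscale a (gen q)) = 0"
    using bdry_scale[OF fin_below gen_cycle(1)[OF assms]] gen_cycle(2)[OF assms] by simp
  show ?thesis
    using 1 unfolding 2 by (simp only: cone_zero diff_zero)
qed

lemma bdry_sum_cone_gen:
  assumes "\<And>q. q \<in> S \<Longrightarrow> q \<in> proper Q \<and> r q = i"
  shows "bdry (\<Sum>q\<in>S. cone q (fscale (x q) (gen q))) = (\<Sum>q\<in>S. fscale (x q) (gen q))"
proof -
  have "cone q (fscale (x q) (gen q)) \<in> ochains (proper Q) (int i - 1)" if "q \<in> S" for q
    using ochains_mono[OF cone_gen_in_ochains, of q "proper Q" "x q"] assms[OF that] by (auto simp: below_eq)
  then have "bdry (\<Sum>q\<in>S. cone q (fscale (x q) (gen q))) = (\<Sum>q\<in>S. bdry (cone q (fscale (x q) (gen q))))"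
    by (intro bdry_sum[OF fin_proper])
  also have "\<dots> = (\<Sum>q\<in>S. fscale (x q) (gen q))"
    by (intro sum.cong refl bdry_cone_gen) (use assms in blast)
  finally show ?thesis .
qed

text \<open>Chain-level form of the fact that consecutive differentials compose to zero:
  \<open>gen q'\<close> is the sum of the cones over its links at rank \<open>i\<close>, and its
  boundary, which vanishes, is the sum of these links.\<close>

lemma sum_co_gen:
  assumes "q' \<in> proper Q" "r q' = Suc i" "1 \<le> i"
  shows "(\<Sum>q | q \<in> proper Q \<and> r q = i. fscale (co q' q) (gen q)) = 0"
proof -
  let ?S = "{q \<in> below Q q'. r q = i}"
  have S: "q \<in> proper Q \<and> r q = i" if "q \<in> ?S" for q
    using that by (auto simp: below_eq)
  have "gen q' = (\<Sum>q\<in>?S. cone q (link q (gen q')))"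
  proof (rule top_rank_decompose[OF gen_cycle(1)[OF assms(1)]])
    show "below Q q' \<subseteq> proper Q"
      by (auto simp: below_eq)
    show "r x \<le> i" if "x \<in> below Q q'" for x
      using below_rank[OF assms(1) that] assms(2) by simp
  qed (use assms(2,3) in auto)
  also have "\<dots> = (\<Sum>q\<in>?S. cone q (fscale (co q' q) (gen q)))"
  proof (rule sum.cong[OF refl])
    fix q assume q: "q \<in> ?S"
    have "link q (gen q') = fscale (co q' q) (gen q)"
      by (rule link_gen) (use S[OF q] assms(1,2) in auto)
    then show "cone q (link q (gen q')) = cone q (fscale (co q' q) (gen q))"
      by (rule arg_cong)
  qed
  finally have "gen q' = (\<Sum>q\<in>?S. cone q (fscale (co q' q) (gen q)))" .
  then have "bdry (gen q') = (\<Sum>q\<in>?S. fscale (co q' q) (gen q))"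
    using bdry_sum_cone_gen[OF S, of ?S "co q'"] by simp
  then have "(\<Sum>q\<in>?S. fscale (co q' q) (gen q)) = 0"
    using gen_cycle(2)[OF assms(1)] by simp
  \<comment> \<open>Elements not below \<open>q'\<close> have incidence number 0, so the sum may run
    over the whole rank.\<close>
  moreover have "(\<Sum>q | q \<in> proper Q \<and> r q = i. fscale (co q' q) (gen q)) = (\<Sum>q\<in>?S. fscale (co q' q) (gen q))"
  proof (rule sum.mono_neutral_right)
    show "\<forall>q\<in>{q \<in> proper Q. r q = i} - ?S. fscale (co q' q) (gen q) = 0"
      using co_eq_0[OF _ assms(1)] assms(2) by (auto simp: below_eq)
  qed (auto simp: below_eq)
  ultimately show ?thesis by simp
qed

text \<open>An analogue of cellular approximation. Below an element of rank above \<open>n\<close>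
  there is homology only in degrees from \<open>n - 1\<close> on, whereas the link of
  \<open>e\<close> has degree \<open>i - 1 < n - 1\<close>. So this link bounds, and
  \<open>e\<close> can be moved off the element.\<close>

lemma push_to_rank:
  fixes e :: "'a set \<Rightarrow> 'k"
  assumes "down_closed (proper Q) U" "e \<in> ochains U i"
    "bdry e \<in> ochains {q \<in> U. r q \<le> n} (i - 1)" "i < int n"
  shows "\<exists>d\<in>ochains U (i + 1). e - bdry d \<in> ochains {q \<in> U. r q \<le> n} i"
  using assms(1-3)
proof (induction "card U" arbitrary: U e rule: less_induct)
  case less
  have U: "finite U"
    by (rule down_closed_finite[OF pointed less.prems(1)])
  show ?case
  proof (cases "\<forall>q\<in>U. r q \<le> n")
    case True
    then have "{q \<in> U. r q \<le> n} = U" by auto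
    then have "e - bdry 0 \<in> ochains {q \<in> U. r q \<le> n} i"
      using less.prems(2) by simp
    then show ?thesis
      using ochains_zero by blast
  next
    case False
    then have "{q \<in> U. n < r q} \<noteq> {}" "finite {q \<in> U. n < r q}"
      using U by (auto simp: not_le)
    then obtain q where q: "q \<in> U" "n < r q" "\<And>x. x \<in> U \<Longrightarrow> n < r x \<Longrightarrow> \<not> q < x"
      using finite_maximal_exists[of "{q \<in> U. n < r q}"] by (metis (mono_tags, lifting) mem_Collect_eq)
    have qQ: "q \<in> proper Q"
      using q(1) less.prems(1) by (auto simp: down_closed_def)
    \<comment> \<open>An element above \<open>q\<close> would again have rank above
      \<open>n\<close>. Hence \<open>q\<close> is maximal in all of \<open>U\<close>, and its link
      in \<open>U\<close> is \<open>below Q q\<close>.\<close>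
    have max: "\<not> q < x" if "x \<in> U" for x
      using q r_mono[OF qQ, of x] that less.prems(1) by (metis down_closed_def less_trans subsetD)
    have C: "comparables U q = below Q q"
      using max less.prems(1) q(1) by (auto simp: comparables_def below_eq down_closed_def dest: less_imp_le)
    have l: "link q e \<in> ochains (below Q q) (i - 1)"
      using link_in_ochains[OF less.prems(2), of q] by (simp add: C)
    have "link q (bdry e) = 0"
      by (rule link_eq_0[OF less.prems(3)]) (use q(2) in simp)
    then have "bdry (link q e) = 0"
      using link_bdry[OF U less.prems(2), of q] by simp
    then have "link q e \<in> ocycles (below Q q) (i - 1)"
      using l by (simp add: cycles_def)
    moreover have "hdim TYPE('k) (order_complex (below Q q)) (i - 1) = 0"
      using hdim_below[OF qQ, of "i - 1"] q(2) assms(4) by simp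
    ultimately have "link q e \<in> obounds (below Q q) (i - 1)"
      using hdim_eq_0_iff[OF fin_below] by blast
    then obtain v where v: "v \<in> ochains (comparables U q) i" "bdry v = link q e"
      by (auto simp: boundaries_def C)
    note * = bdry_add_cone[OF U q(1) less.prems(2) v(1)]
    have cv: "cone q v \<in> ochains U (i + 1)"
      by (rule cone_in_ochains[OF q(1) v(1)])
    define e' where "e' = avoid q e + v"
    have e': "e' = e + bdry (cone q v)"
      using *(2) v(2) by (simp add: e'_def)
    have e'U: "e' \<in> ochains (U - {q}) i"
      using *(3) by (simp add: e'_def)
    have sub: "{x \<in> U - {q}. r x \<le> n} = {x \<in> U. r x \<le> n}"
      using q(2) by auto
    have be': "bdry e' = bdry e"
      unfolding e' using bdry_add[OF U less.prems(2) *(1)] bdry_bdry[OF U cv] by simp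
    have "\<exists>d\<in>ochains (U - {q}) (i + 1). e' - bdry d \<in> ochains {x \<in> U - {q}. r x \<le> n} i"
    proof (rule less.hyps)
      show "card (U - {q}) < card U"
        using U q(1) by (rule card_Diff1_less)
      show "down_closed (proper Q) (U - {q})"
        using less.prems(1) max by (auto simp: down_closed_def order_le_less)
      show "e' \<in> ochains (U - {q}) i" by (rule e'U)
      show "bdry e' \<in> ochains {x \<in> U - {q}. r x \<le> n} (i - 1)"
        unfolding be' sub by (rule less.prems(3))
    qed
    then obtain d where d: "d \<in> ochains (U - {q}) (i + 1)" "e' - bdry d \<in> ochains {x \<in> U. r x \<le> n} i"
      unfolding sub by blast
    have dU: "d \<in> ochains U (i + 1)"
      by (rule ochains_mono[OF d(1)]) auto
    have "e - bdry (d - cone q v) = e' - bdry d"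
      unfolding bdry_diff[OF U dU cv] e' by (rule diff_diff_eq2)
    then show ?thesis
      using d(2) ochains_diff[OF dU cv] by metis
  qed
qed

text \<open>The comparison of cellular with simplicial homology. The cells with coefficients
  \<open>x\<close> add up to a simplicial cycle \<open>c\<close>, which bounds over the acyclic set
  \<open>U\<close>. The bounding chain can be chosen within ranks up to \<open>i + 1\<close>, where
  it is a sum of cells with coefficients \<open>y\<close>; the links of \<open>c\<close> then
  express \<open>x\<close> through \<open>y\<close>.\<close>

lemma strand_exact:
  assumes U: "down_closed (proper Q) U" "acyclic_over TYPE('k) U" and i: "1 \<le> i"
    and x: "(\<Sum>q | q \<in> U \<and> r q = i. fscale (x q) (gen q)) = 0"
  shows "\<exists>y. \<forall>q\<in>U. r q = i \<longrightarrow> x q = (\<Sum>q' | q' \<in> U \<and> r q' = Suc i. y q' * co q' q)"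
proof -
  have fU: "finite U"
    by (rule down_closed_finite[OF pointed U(1)])
  have UQ: "q \<in> proper Q" if "q \<in> U" for q
    using U(1) that by (auto simp: down_closed_def)
  let ?S = "{q \<in> U. r q = i}" and ?A = "{q \<in> U. r q \<le> i}"
  define c where "c = (\<Sum>q\<in>?S. cone q (fscale (x q) (gen q)))"
  have cA: "c \<in> ochains ?A (int i - 1)"
    unfolding c_def
  proof (rule ochains_sum)
    fix q assume q: "q \<in> ?S"
    have "insert q (below Q q) \<subseteq> ?A"
      using q U(1) below_rank[OF UQ, of q] by (fastforce simp: down_closed_def)
    then show "cone q (fscale (x q) (gen q)) \<in> ochains ?A (int i - 1)"
      using ochains_mono[OF cone_gen_in_ochains[OF UQ, of q "x q"]] q by simp
  qed
  have cU: "c \<in> ochains U (int i - 1)"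
    by (rule ochains_mono[OF cA]) auto
  have "bdry c = (\<Sum>q\<in>?S. fscale (x q) (gen q))"
    unfolding c_def by (rule bdry_sum_cone_gen[of _ i]) (use UQ in auto)
  then have "bdry c = 0"
    using x by simp
  then obtain e where e: "e \<in> ochains U (int i - 1 + 1)" "bdry e = c"
    using acyclic_overD[OF U(2) cU] by metis
  then have eU: "e \<in> ochains U (int i)" by simp
  have "bdry e \<in> ochains {q \<in> U. r q \<le> Suc i} (int i - 1)"
    unfolding e(2) by (rule ochains_mono[OF cA]) auto
  \<comment> \<open>The bounding chain has degree \<open>i\<close>, just below the bound
    \<open>Suc i\<close> required for pushing; afterwards its links at rank \<open>Suc i\<close>
    have top dimension.\<close>
  then obtain d where d: "d \<in> ochains U (int i + 1)" "e - bdry d \<in> ochains {q \<in> U. r q \<le> Suc i} (int i)"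
    using push_to_rank[OF U(1) eU, of "Suc i"] by auto
  define e1 where "e1 = e - bdry d"
  have e1: "e1 \<in> ochains {q \<in> U. r q \<le> Suc i} (int i)"
    using d(2) by (simp add: e1_def)
  have be1: "bdry e1 = c"
    unfolding e1_def
    using bdry_diff[OF fU eU bdry_in_ochains'[OF fU d(1)]] bdry_bdry[OF fU d(1)] e(2) by simp
  let ?S1 = "{q' \<in> U. r q' = Suc i}"
  have "\<exists>a. link q' e1 = fscale a (gen q')" if q': "q' \<in> ?S1" for q'
  proof -
    have "link q' e1 \<in> ochains (comparables {q \<in> U. r q \<le> Suc i} q') (int i - 1)"
      by (rule link_in_ochains[OF e1])
    moreover have "comparables {q \<in> U. r q \<le> Suc i} q' \<subseteq> below Q q'"
      using q' UQ r_mono[of q'] by (auto simp: comparables_def below_eq) (metis leD)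
    ultimately have "link q' e1 \<in> ochains (below Q q') (int i - 1)"
      by (rule ochains_mono)
    moreover have "int i - 1 = int (r q') - 2"
      using q' by simp
    moreover have "link q' c = 0"
      by (rule link_eq_0[OF cA]) (use q' in simp)
    then have "bdry (link q' e1) = 0"
      using link_bdry[OF _ e1, of q'] fU be1 by simp
    ultimately show ?thesis
      using cycle_multiple_of_gen[OF UQ, of q' "link q' e1"] q' by (metis (mono_tags, lifting) mem_Collect_eq)
  qed
  then obtain y where y: "\<And>q'. q' \<in> ?S1 \<Longrightarrow> link q' e1 = fscale (y q') (gen q')"
    by metis
  have "e1 = (\<Sum>q' | q' \<in> {q \<in> U. r q \<le> Suc i} \<and> r q' = Suc i. cone q' (link q' e1))"
    by (rule top_rank_decompose[OF e1]) (use UQ in auto)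
  also have "{q'. q' \<in> {q \<in> U. r q \<le> Suc i} \<and> r q' = Suc i} = ?S1"
    by auto
  also have "(\<Sum>q'\<in>?S1. cone q' (link q' e1)) = (\<Sum>q'\<in>?S1. cone q' (fscale (y q') (gen q')))"
    by (rule sum.cong[OF refl], rule arg_cong[of _ _ "cone _"], rule y)
  finally have "bdry e1 = bdry (\<Sum>q'\<in>?S1. cone q' (fscale (y q') (gen q')))"
    by (rule arg_cong)
  also have "\<dots> = (\<Sum>q'\<in>?S1. fscale (y q') (gen q'))"
    by (rule bdry_sum_cone_gen[of _ "Suc i"]) (use UQ in auto)
  finally have c_eq: "c = (\<Sum>q'\<in>?S1. fscale (y q') (gen q'))"
    using be1 by simp
  have "x q = (\<Sum>q'\<in>?S1. y q' * co q' q)" if q: "q \<in> U" "r q = i" for q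
  proof -
    \<comment> \<open>Elements of equal rank are incomparable, so the link at \<open>q\<close> sees
      only the cell of \<open>q\<close> and reads off its coefficient.\<close>
    have "link q c = (\<Sum>q2\<in>?S. link q (cone q2 (fscale (x q2) (gen q2))))"
      unfolding c_def by (rule link_sum)
    also have "\<dots> = (\<Sum>q2\<in>?S. if q2 = q then fscale (x q) (gen q) else 0)"
    proof (rule sum.cong[OF refl])
      fix q2 assume q2: "q2 \<in> ?S"
      have "link q (cone q2 (fscale (x q2) (gen q2))) = 0" if "q2 \<noteq> q"
        by (rule link_eq_0[OF cone_gen_in_ochains[OF UQ]])
          (use q2 q that r_neq[OF UQ UQ, of q q2] in \<open>auto simp: below_eq\<close>)
      moreover have "link q (cone q (fscale (x q) (gen q))) = fscale (x q) (gen q)"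
        by (rule link_cone) (use ochainsD(2)[OF gen_cycle(1)[OF UQ[OF q(1)]]] in \<open>auto simp: below_eq\<close>)
      ultimately show "link q (cone q2 (fscale (x q2) (gen q2))) = (if q2 = q then fscale (x q) (gen q) else 0)"
        by (cases "q2 = q") simp_all
    qed
    also have "\<dots> = fscale (x q) (gen q)"
      using q fU by simp
    finally have "fscale (x q) (gen q) = link q (\<Sum>q'\<in>?S1. fscale (y q') (gen q'))"
      unfolding c_eq by (rule sym)
    also have "\<dots> = (\<Sum>q'\<in>?S1. fscale (y q' * co q' q) (gen q))"
      unfolding link_sum link_scale
    proof (rule sum.cong[OF refl])
      fix q' assume "q' \<in> ?S1"
      then have "link q (gen q') = fscale (co q' q) (gen q)"
        using q UQ by (intro link_gen) auto
      then show "fscale (y q') (link q (gen q')) = fscale (y q' * co q' q) (gen q)"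
        by simp
    qed
    also have "\<dots> = fscale (\<Sum>q'\<in>?S1. y q' * co q' q) (gen q)"
      by (rule fs.scale_sum_left[symmetric])
    finally show ?thesis
      by (simp only: fscale_gen_eq_iff[OF UQ[OF q(1)]])
  qed
  then show ?thesis by blast
qed

text \<open>The chains in the sum have top dimension, so it is recovered from its links at rank
  \<open>i\<close>, and each of these is a given coordinate times \<open>gen p\<close>.\<close>

lemma sum_gen_eq_0_if_coords_0:
  assumes U: "down_closed (proper Q) U" and i: "1 \<le> i"
    and x: "\<And>p. p \<in> U \<Longrightarrow> r p = i \<Longrightarrow> (\<Sum>q | q \<in> U \<and> r q = Suc i. x q * co q p) = 0"
  shows "(\<Sum>q | q \<in> U \<and> r q = Suc i. fscale (x q) (gen q)) = 0"
proof -
  have UQ: "q \<in> proper Q" if "q \<in> U" for q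
    using U that by (auto simp: down_closed_def)
  let ?S = "{q \<in> U. r q = Suc i}" and ?A = "{q \<in> U. r q \<le> i}"
  define c where "c = (\<Sum>q\<in>?S. fscale (x q) (gen q))"
  have c: "c \<in> ochains ?A (int i - 1)"
    unfolding c_def
  proof (rule ochains_sum)
    fix q assume q: "q \<in> ?S"
    have "below Q q \<subseteq> ?A"
      using q U below_rank[OF UQ, of q] by (fastforce simp: down_closed_def)
    then show "fscale (x q) (gen q) \<in> ochains ?A (int i - 1)"
      using ochains_mono[OF ochains_scale[OF gen_cycle(1)[OF UQ, of q], of "x q"]] q by simp
  qed
  have "c = (\<Sum>p | p \<in> ?A \<and> r p = i. cone p (link p c))"
    by (rule top_rank_decompose[OF c]) (use UQ i in auto)
  also have "\<dots> = (\<Sum>p | p \<in> ?A \<and> r p = i. 0)"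
  proof (rule sum.cong[OF refl])
    fix p assume p: "p \<in> {p. p \<in> ?A \<and> r p = i}"
    have "link p c = (\<Sum>q\<in>?S. fscale (x q * co q p) (gen p))"
      unfolding c_def link_sum link_scale
    proof (rule sum.cong[OF refl])
      fix q assume "q \<in> ?S"
      then have "link p (gen q) = fscale (co q p) (gen p)"
        using p UQ by (intro link_gen) auto
      then show "fscale (x q) (link p (gen q)) = fscale (x q * co q p) (gen p)"
        by simp
    qed
    also have "\<dots> = fscale (\<Sum>q\<in>?S. x q * co q p) (gen p)"
      by (rule fs.scale_sum_left[symmetric])
    also have "\<dots> = 0"
      using x[of p] p by simp
    finally show "cone p (link p c) = 0" by simp
  qed
  finally have "c = 0"
    by (simp only: sum.neutral_const)
  then show ?thesis
    by (simp only: c_def)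
qed

end

section \<open>Multigraded strands\<close>

lemma lookup_sum_apply: "Poly_Mapping.lookup (\<Sum>x\<in>S. f x) u = (\<Sum>x\<in>S. Poly_Mapping.lookup (f x) u)"
  by (induction S rule: infinite_finite_induct) (simp_all add: lookup_add)

lemma lookup_mult_single:
  fixes f :: "('v, 'k::field) mpoly"
  shows "Poly_Mapping.lookup (f * Poly_Mapping.single s c) u =
    (if s \<le> u then Poly_Mapping.lookup f (u - s) * c else 0)"
proof -
  have "(\<Sum>q. (Poly_Mapping.lookup (Poly_Mapping.single s c) q when u = l + q)) = (c when u = l + s)" for l
  proof -
    have "(Poly_Mapping.lookup (Poly_Mapping.single s c) q when u = l + q) = ((c when u = l + s) when q = s)" for q
      by (auto simp: lookup_single when_def)
    then show ?thesis
      by simp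
  qed
  then have *: "Poly_Mapping.lookup (f * Poly_Mapping.single s c) u =
      (\<Sum>l. Poly_Mapping.lookup f l * (c when u = l + s))"
    by (simp add: lookup_mult)
  show ?thesis
  proof (cases "s \<le> u")
    case True
    have "u = l + s \<longleftrightarrow> l = u - s" for l
      using True by (auto simp: fun_eq_iff le_fun_def)
    then have "(Poly_Mapping.lookup f l * (c when u = l + s)) = ((Poly_Mapping.lookup f (u - s) * c) when l = u - s)" for l
      by (auto simp: when_def)
    then show ?thesis
      using True unfolding * by simp
  next
    case False
    then have "u \<noteq> l + s" for l
      by (auto simp: le_fun_def)
    then show ?thesis
      using False unfolding * by simp
  qed
qed

text \<open>The conditions on the strand of each multidegree \<open>t\<close> that make a based complex a minimal free
  resolution of the quotient by the ideal spanned by the monomials in \<open>M\<close>.\<close>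

definition strandwise_minimal :: "('e, 'v, 'k::field) based_complex \<Rightarrow> 'v monom set \<Rightarrow> bool" where
  "strandwise_minimal F M \<longleftrightarrow>
     (\<forall>i. finite (gens F i)) \<and>
     (\<forall>i. \<forall>e\<in>gens F (Suc i). \<forall>e'\<in>gens F i. coef F (Suc i) e e' \<noteq> 0 \<longrightarrow>
        mdeg F i e' \<le> mdeg F (Suc i) e \<and> mdeg F i e' \<noteq> mdeg F (Suc i) e) \<and>
     (\<exists>e0. gens F 0 = {e0} \<and> mdeg F 0 e0 = 0 \<and>
        (\<forall>e\<in>gens F 1. \<forall>t. mdeg F 1 e \<le> t \<longrightarrow> t \<in> M) \<and>
        (\<forall>t\<in>M. \<exists>e\<in>gens F 1. mdeg F 1 e \<le> t \<and> coef F 1 e e0 \<noteq> 0)) \<and>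
     (\<forall>i. \<forall>e\<in>gens F (Suc (Suc i)). \<forall>e'\<in>gens F i.
        (\<Sum>e1\<in>gens F (Suc i). coef F (Suc (Suc i)) e e1 * coef F (Suc i) e1 e') = 0) \<and>
     (\<forall>i t x.
        (\<forall>e'\<in>gens F i. mdeg F i e' \<le> t \<longrightarrow>
           (\<Sum>e | e \<in> gens F (Suc i) \<and> mdeg F (Suc i) e \<le> t. x e * coef F (Suc i) e e') = 0) \<longrightarrow>
        (\<exists>y. \<forall>e\<in>gens F (Suc i). mdeg F (Suc i) e \<le> t \<longrightarrow>
           x e = (\<Sum>e' | e' \<in> gens F (Suc (Suc i)) \<and> mdeg F (Suc (Suc i)) e' \<le> t.
             y e' * coef F (Suc (Suc i)) e' e)))"

text \<open>The part of \<open>f\<close> of multidegree \<open>t\<close> as a vector of scalars: in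
  the summand of \<open>e\<close> it sits at the monomial \<open>t\<close> divided by the degree of
  \<open>e\<close>. The test guards the truncated subtraction.\<close>

definition strand :: "('e, 'v, 'k::field) based_complex \<Rightarrow> nat \<Rightarrow> ('e \<Rightarrow> ('v, 'k) mpoly) \<Rightarrow>
    'v monom \<Rightarrow> 'e \<Rightarrow> 'k" where
  "strand F i f t e = (if mdeg F i e \<le> t then Poly_Mapping.lookup (f e) (t - mdeg F i e) else 0)"

lemma lookup_eq_strand: "Poly_Mapping.lookup (f e) u = strand F i f (u + mdeg F i e) e"
proof -
  have "mdeg F i e \<le> u + mdeg F i e" "u + mdeg F i e - mdeg F i e = u"
    by (auto simp: le_fun_def fun_eq_iff)
  then show ?thesis
    by (simp add: strand_def)
qed

text \<open>The differential is homogeneous and so acts on each strand by the scalar matrix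
  \<open>coef\<close>. Divisibility of the degrees makes the truncated differences add up.\<close>

lemma strand_diffl:
  assumes deg: "\<And>e. e \<in> gens F (Suc i) \<Longrightarrow> coef F (Suc i) e e' \<noteq> 0 \<Longrightarrow> mdeg F i e' \<le> mdeg F (Suc i) e"
    and e': "e' \<in> gens F i"
  shows "strand F i (diffl F (Suc i) f) t e' =
    (\<Sum>e\<in>gens F (Suc i). coef F (Suc i) e e' * strand F (Suc i) f t e)"
proof (cases "mdeg F i e' \<le> t")
  case True
  have "strand F i (diffl F (Suc i) f) t e' = (\<Sum>e\<in>gens F (Suc i).
      Poly_Mapping.lookup (f e * Poly_Mapping.single (mdeg F (Suc i) e - mdeg F i e') (coef F (Suc i) e e'))
        (t - mdeg F i e'))"
    using True e' by (simp add: strand_def diffl_def lookup_sum_apply)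
  also have "\<dots> = (\<Sum>e\<in>gens F (Suc i). coef F (Suc i) e e' * strand F (Suc i) f t e)"
  proof (rule sum.cong[OF refl])
    fix e assume e: "e \<in> gens F (Suc i)"
    let ?a = "mdeg F (Suc i) e" and ?b = "mdeg F i e'"
    show "Poly_Mapping.lookup (f e * Poly_Mapping.single (?a - ?b) (coef F (Suc i) e e')) (t - ?b) =
      coef F (Suc i) e e' * strand F (Suc i) f t e"
    proof (cases "coef F (Suc i) e e' = 0")
      case False
      then have ba: "?b \<le> ?a"
        using deg e by blast
      have "?a x - ?b x \<le> t x - ?b x \<longleftrightarrow> ?a x \<le> t x" for x
        using True ba by (auto simp: le_fun_def) (metis diff_le_mono eq_diff_iff le_diff_iff)
      then have "?a - ?b \<le> t - ?b \<longleftrightarrow> ?a \<le> t"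
        by (auto simp: le_fun_def)
      moreover have "t - ?b - (?a - ?b) = t - ?a"
        using ba by (auto simp: fun_eq_iff le_fun_def)
      ultimately show ?thesis
        by (simp add: lookup_mult_single strand_def)
    qed (simp add: lookup_mult_single)
  qed
  finally show ?thesis .
next
  case False
  \<comment> \<open>Where the entry is nonzero, the degree of \<open>e\<close> is a multiple of that
    of \<open>e'\<close> and hence does not divide \<open>t\<close> either.\<close>
  have "coef F (Suc i) e e' * strand F (Suc i) f t e = 0" if "e \<in> gens F (Suc i)" for e
    using deg[OF that] False by (auto simp: strand_def dest: order_trans)
  then have "(\<Sum>e\<in>gens F (Suc i). coef F (Suc i) e e' * strand F (Suc i) f t e) = 0"
    by (rule sum.neutral[rule_format])
  then show ?thesis
    using False by (simp only: strand_def if_False)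
qed

text \<open>Scalars may be prescribed on the strands as long as only finitely many degrees are
  involved, since the components must be polynomials.\<close>

lemma element_with_strands:
  fixes F :: "('e, 'v, 'k::field) based_complex"
  assumes "finite T"
  shows "\<exists>g\<in>free_mod F i. \<forall>t. \<forall>e\<in>gens F i.
    strand F i g t e = (if t \<in> T \<and> mdeg F i e \<le> t then y t e else 0)"
proof (intro bexI allI ballI)
  define g where "g = (\<lambda>e. if e \<in> gens F i then
    \<Sum>t\<in>{t \<in> T. mdeg F i e \<le> t}. Poly_Mapping.single (t - mdeg F i e) (y t e) else 0)"
  show "g \<in> free_mod F i"
    by (simp add: free_mod_def g_def)
  fix t e assume e: "e \<in> gens F i"
  show "strand F i g t e = (if t \<in> T \<and> mdeg F i e \<le> t then y t e else 0)"
  proof (cases "mdeg F i e \<le> t")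
    case True
    have inj: "s - mdeg F i e = t - mdeg F i e \<longleftrightarrow> s = t" if "mdeg F i e \<le> s" for s
      using that True by (auto simp: fun_eq_iff le_fun_def) (metis eq_diff_iff)
    have "strand F i g t e = (\<Sum>s\<in>{t \<in> T. mdeg F i e \<le> t}. if s = t then y t e else 0)"
      using True e inj by (auto simp: strand_def g_def lookup_sum_apply lookup_single when_def intro!: sum.cong)
    also have "\<dots> = (if t \<in> T then y t e else 0)"
      using assms True by simp
    finally show ?thesis
      using True by simp
  qed (simp add: strand_def)
qed

lemma finite_strand_support:
  assumes "finite (gens F i)"
  shows "finite {t. \<exists>e\<in>gens F i. strand F i f t e \<noteq> 0}"
proof (rule finite_subset)
  show "{t. \<exists>e\<in>gens F i. strand F i f t e \<noteq> 0} \<subseteq>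
    (\<Union>e\<in>gens F i. (\<lambda>s. s + mdeg F i e) ` Poly_Mapping.keys (f e))"
  proof
    fix t assume "t \<in> {t. \<exists>e\<in>gens F i. strand F i f t e \<noteq> 0}"
    then obtain e where e: "e \<in> gens F i" "strand F i f t e \<noteq> 0" by blast
    then have "mdeg F i e \<le> t" "t - mdeg F i e \<in> Poly_Mapping.keys (f e)"
      by (auto simp: strand_def in_keys_iff split: if_splits)
    moreover have "t = t - mdeg F i e + mdeg F i e"
      using calculation by (auto simp: fun_eq_iff le_fun_def)
    ultimately show "t \<in> (\<Union>e\<in>gens F i. (\<lambda>s. s + mdeg F i e) ` Poly_Mapping.keys (f e))"
      using e(1) by blast
  qed
qed (use assms in simp)

lemma free_mod_eqI:
  assumes "f \<in> free_mod F i" "g \<in> free_mod F i"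
    "\<And>t e. e \<in> gens F i \<Longrightarrow> strand F i f t e = strand F i g t e"
  shows "f = g"
proof
  fix e
  show "f e = g e"
  proof (cases "e \<in> gens F i")
    case True
    show ?thesis
      by (rule poly_mapping_eqI) (simp add: lookup_eq_strand[of _ e _ F i] assms(3)[OF True])
  qed (use assms in \<open>simp add: free_mod_def\<close>)
qed

lemma diffl_in_free_mod: "diffl F (Suc i) f \<in> free_mod F i"
  by (simp add: diffl_def free_mod_def)

text \<open>All maps are homogeneous, so image, kernel and augmentation can be computed one
  multidegree at a time, where they are linear algebra over the field.\<close>

lemma strandwise_minimal_imp_resolution:
  fixes F :: "('e, 'v, 'k::field) based_complex"
  assumes "strandwise_minimal F M" and N: "N = {f. \<forall>t\<in>Poly_Mapping.keys f. t \<in> M}"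
  shows "minimal_free_resolution F N"
proof -
  have fin: "\<And>i. finite (gens F i)"
    and deg: "\<And>i e e'. e \<in> gens F (Suc i) \<Longrightarrow> e' \<in> gens F i \<Longrightarrow> coef F (Suc i) e e' \<noteq> 0 \<Longrightarrow>
        mdeg F i e' \<le> mdeg F (Suc i) e \<and> mdeg F i e' \<noteq> mdeg F (Suc i) e"
    and dd: "\<And>i e e'. e \<in> gens F (Suc (Suc i)) \<Longrightarrow> e' \<in> gens F i \<Longrightarrow>
        (\<Sum>e1\<in>gens F (Suc i). coef F (Suc (Suc i)) e e1 * coef F (Suc i) e1 e') = 0"
    and exact: "\<And>i t x. (\<And>e'. e' \<in> gens F i \<Longrightarrow> mdeg F i e' \<le> t \<Longrightarrow>
           (\<Sum>e | e \<in> gens F (Suc i) \<and> mdeg F (Suc i) e \<le> t. x e * coef F (Suc i) e e') = 0) \<Longrightarrow>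
        (\<exists>y. \<forall>e\<in>gens F (Suc i). mdeg F (Suc i) e \<le> t \<longrightarrow>
           x e = (\<Sum>e' | e' \<in> gens F (Suc (Suc i)) \<and> mdeg F (Suc (Suc i)) e' \<le> t. y e' * coef F (Suc (Suc i)) e' e))"
    using assms(1) unfolding strandwise_minimal_def by blast+
  obtain e0 where e0: "gens F 0 = {e0}" "mdeg F 0 e0 = 0"
    and up: "\<forall>e\<in>gens F 1. \<forall>t. mdeg F 1 e \<le> t \<longrightarrow> t \<in> M"
    and hit: "\<forall>t\<in>M. \<exists>e\<in>gens F 1. mdeg F 1 e \<le> t \<and> coef F 1 e e0 \<noteq> 0"
    using assms(1) unfolding strandwise_minimal_def by (elim conjE exE) blast
  have sd: "strand F i (diffl F (Suc i) f) t e' =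
      (\<Sum>e\<in>gens F (Suc i). coef F (Suc i) e e' * strand F (Suc i) f t e)" if "e' \<in> gens F i" for i f t e'
    using strand_diffl[of F i e' f t] deg[OF _ that] that by blast
  have lookup0: "Poly_Mapping.lookup (diffl F 1 f e0) u = (\<Sum>e\<in>gens F 1. coef F 1 e e0 * strand F 1 f u e)" for f u
    using sd[of e0 0 f u] e0 lookup_eq_strand[of "diffl F 1 f" e0 u F 0] by simp
  have aug: "(\<lambda>f. f e0) ` diffl F 1 ` free_mod F 1 = N"
  proof (intro equalityI subsetI)
    fix h assume "h \<in> (\<lambda>f. f e0) ` diffl F 1 ` free_mod F 1"
    then obtain f where h: "h = diffl F 1 f e0" by blast
    show "h \<in> N"
      unfolding N
    proof (intro CollectI ballI)
      fix t assume "t \<in> Poly_Mapping.keys h"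
      then have "(\<Sum>e\<in>gens F 1. coef F 1 e e0 * strand F 1 f t e) \<noteq> 0"
        unfolding in_keys_iff h lookup0 .
      then obtain e where "e \<in> gens F 1" "strand F 1 f t e \<noteq> 0"
        by (metis (no_types, lifting) mult_zero_right sum.neutral)
      then show "t \<in> M"
        using up by (auto simp: strand_def split: if_splits)
    qed
  next
    fix h assume h: "h \<in> N"
    \<comment> \<open>One generator of \<open>F\<close> in degree 1 per monomial of
      \<open>h\<close>, with nonzero entry to \<open>e0\<close> and degree dividing that monomial,
      is enough to build a preimage.\<close>
    have "\<forall>t. \<exists>e. t \<in> Poly_Mapping.keys h \<longrightarrow> e \<in> gens F 1 \<and> mdeg F 1 e \<le> t \<and> coef F 1 e e0 \<noteq> 0"
      using h hit unfolding N by blast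
    then obtain E where E: "\<And>t. t \<in> Poly_Mapping.keys h \<Longrightarrow>
        E t \<in> gens F 1 \<and> mdeg F 1 (E t) \<le> t \<and> coef F 1 (E t) e0 \<noteq> 0"
      by metis
    obtain g where g: "g \<in> free_mod F 1" "\<forall>t. \<forall>e\<in>gens F 1. strand F 1 g t e =
        (if t \<in> Poly_Mapping.keys h \<and> mdeg F 1 e \<le> t
         then if e = E t then Poly_Mapping.lookup h t / coef F 1 (E t) e0 else 0 else 0)"
      using element_with_strands[of "Poly_Mapping.keys h" F 1
          "\<lambda>t e. if e = E t then Poly_Mapping.lookup h t / coef F 1 (E t) e0 else 0"]
        finite_keys[of h] by blast
    have "diffl F 1 g e0 = h"
    proof (rule poly_mapping_eqI)
      fix u
      have "Poly_Mapping.lookup (diffl F 1 g e0) u =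
          (\<Sum>e\<in>gens F 1. if e = E u then (if u \<in> Poly_Mapping.keys h then Poly_Mapping.lookup h u else 0) else 0)"
        unfolding lookup0 using g(2) E[of u] by (intro sum.cong) auto
      also have "\<dots> = Poly_Mapping.lookup h u"
        using fin[of 1] E[of u] by (auto simp: in_keys_iff)
      finally show "Poly_Mapping.lookup (diffl F 1 g e0) u = Poly_Mapping.lookup h u" .
    qed
    then show "h \<in> (\<lambda>f. f e0) ` diffl F 1 ` free_mod F 1"
      using g(1) by blast
  qed
  have ex: "diffl F (Suc (Suc i)) ` free_mod F (Suc (Suc i)) = {f \<in> free_mod F (Suc i). diffl F (Suc i) f = 0}" for i
  proof (intro equalityI subsetI)
    fix f assume "f \<in> diffl F (Suc (Suc i)) ` free_mod F (Suc (Suc i))"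
    then obtain g where f: "f = diffl F (Suc (Suc i)) g" by blast
    have "diffl F (Suc i) f = 0"
    proof (rule free_mod_eqI[of _ F i])
      fix t e' assume e': "e' \<in> gens F i"
      have "strand F i (diffl F (Suc i) f) t e' = (\<Sum>e\<in>gens F (Suc i). \<Sum>e''\<in>gens F (Suc (Suc i)).
          coef F (Suc i) e e' * (coef F (Suc (Suc i)) e'' e * strand F (Suc (Suc i)) g t e''))"
        using sd[OF e', of f t] sd[of _ "Suc i" g t] by (simp add: f sum_distrib_left)
      also have "\<dots> = (\<Sum>e''\<in>gens F (Suc (Suc i)). \<Sum>e\<in>gens F (Suc i).
          coef F (Suc i) e e' * (coef F (Suc (Suc i)) e'' e * strand F (Suc (Suc i)) g t e''))"
        by (rule sum.swap)
      also have "\<dots> = (\<Sum>e''\<in>gens F (Suc (Suc i)).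
          (\<Sum>e\<in>gens F (Suc i). coef F (Suc (Suc i)) e'' e * coef F (Suc i) e e') * strand F (Suc (Suc i)) g t e'')"
        by (simp add: sum_distrib_left mult_ac)
      also have "\<dots> = 0"
        using dd e' by simp
      finally show "strand F i (diffl F (Suc i) f) t e' = strand F i 0 t e'"
        by (simp add: strand_def)
    qed (auto simp: diffl_def free_mod_def)
    then show "f \<in> {f \<in> free_mod F (Suc i). diffl F (Suc i) f = 0}"
      by (simp add: f diffl_in_free_mod)
  next
    fix f assume "f \<in> {f \<in> free_mod F (Suc i). diffl F (Suc i) f = 0}"
    then have f: "f \<in> free_mod F (Suc i)" "diffl F (Suc i) f = 0" by auto
    \<comment> \<open>Preimages are found in each degree separately; using them only in the finitely
      many degrees where \<open>f\<close> is nonzero combines them into one element.\<close>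
    define T where "T = {t. \<exists>e\<in>gens F (Suc i). strand F (Suc i) f t e \<noteq> 0}"
    have T: "finite T"
      unfolding T_def by (rule finite_strand_support[OF fin])
    have "\<exists>y. \<forall>e\<in>gens F (Suc i). mdeg F (Suc i) e \<le> t \<longrightarrow> strand F (Suc i) f t e =
       (\<Sum>e' | e' \<in> gens F (Suc (Suc i)) \<and> mdeg F (Suc (Suc i)) e' \<le> t. y e' * coef F (Suc (Suc i)) e' e)" for t
    proof (rule exact)
      fix e' assume e': "e' \<in> gens F i" "mdeg F i e' \<le> t"
      have "(\<Sum>e | e \<in> gens F (Suc i) \<and> mdeg F (Suc i) e \<le> t. strand F (Suc i) f t e * coef F (Suc i) e e')
          = (\<Sum>e\<in>gens F (Suc i). coef F (Suc i) e e' * strand F (Suc i) f t e)"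
        by (rule sum.mono_neutral_cong_left) (use fin in \<open>auto simp: strand_def\<close>)
      also have "\<dots> = strand F i (diffl F (Suc i) f) t e'"
        by (rule sd[OF e'(1), symmetric])
      also have "\<dots> = 0"
        by (simp add: f(2) strand_def)
      finally show "(\<Sum>e | e \<in> gens F (Suc i) \<and> mdeg F (Suc i) e \<le> t. strand F (Suc i) f t e * coef F (Suc i) e e') = 0" .
    qed
    then obtain y where y: "\<forall>t. \<forall>e\<in>gens F (Suc i). mdeg F (Suc i) e \<le> t \<longrightarrow> strand F (Suc i) f t e =
       (\<Sum>e' | e' \<in> gens F (Suc (Suc i)) \<and> mdeg F (Suc (Suc i)) e' \<le> t. y t e' * coef F (Suc (Suc i)) e' e)"
      by (rule exE[OF choice[OF allI]])
    obtain g where g: "g \<in> free_mod F (Suc (Suc i))" "\<forall>t. \<forall>e\<in>gens F (Suc (Suc i)).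
        strand F (Suc (Suc i)) g t e = (if t \<in> T \<and> mdeg F (Suc (Suc i)) e \<le> t then y t e else 0)"
      using element_with_strands[OF T, of F "Suc (Suc i)" y] by blast
    have "diffl F (Suc (Suc i)) g = f"
    proof (rule free_mod_eqI[OF diffl_in_free_mod f(1)])
      fix t e assume e: "e \<in> gens F (Suc i)"
      have "strand F (Suc i) (diffl F (Suc (Suc i)) g) t e = (\<Sum>e'\<in>gens F (Suc (Suc i)).
          coef F (Suc (Suc i)) e' e * (if t \<in> T \<and> mdeg F (Suc (Suc i)) e' \<le> t then y t e' else 0))"
        unfolding sd[OF e] by (intro sum.cong refl) (simp add: g(2))
      also have "\<dots> = strand F (Suc i) f t e"
      proof (cases "t \<in> T \<and> mdeg F (Suc i) e \<le> t")
        case True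
        then have "(\<Sum>e'\<in>gens F (Suc (Suc i)).
            coef F (Suc (Suc i)) e' e * (if t \<in> T \<and> mdeg F (Suc (Suc i)) e' \<le> t then y t e' else 0)) =
          (\<Sum>e' | e' \<in> gens F (Suc (Suc i)) \<and> mdeg F (Suc (Suc i)) e' \<le> t. y t e' * coef F (Suc (Suc i)) e' e)"
          by (intro sum.mono_neutral_cong_right) (use fin in auto)
        then show ?thesis
          using y e True by simp
      next
        case False
        then have "coef F (Suc (Suc i)) e' e * (if t \<in> T \<and> mdeg F (Suc (Suc i)) e' \<le> t then y t e' else 0) = 0"
          if "e' \<in> gens F (Suc (Suc i))" for e'
          using deg[OF that e] by (auto dest: order_trans)
        then have "(\<Sum>e'\<in>gens F (Suc (Suc i)). coef F (Suc (Suc i)) e' e *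
            (if t \<in> T \<and> mdeg F (Suc (Suc i)) e' \<le> t then y t e' else 0)) = 0"
          by (rule sum.neutral[rule_format])
        moreover have "strand F (Suc i) f t e = 0"
          using False e by (auto simp: T_def strand_def)
        ultimately show ?thesis by argo
      qed
      finally show "strand F (Suc i) (diffl F (Suc (Suc i)) g) t e = strand F (Suc i) f t e" .
    qed
    then show "f \<in> diffl F (Suc (Suc i)) ` free_mod F (Suc (Suc i))"
      using g(1) by blast
  qed
  have min: "Poly_Mapping.lookup (diffl F (Suc i) f e) 0 = 0" for i f e
  proof (cases "e \<in> gens F i")
    case True
    \<comment> \<open>The constant term at \<open>e\<close> is the strand in the degree of
      \<open>e\<close> itself. A contribution from \<open>e1\<close> would need degrees dividing
      each other, hence equal, which a nonzero entry excludes.\<close>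
    have "coef F (Suc i) e1 e * strand F (Suc i) f (mdeg F i e) e1 = 0" if "e1 \<in> gens F (Suc i)" for e1
      using deg[OF that True] order_antisym[of "mdeg F i e" "mdeg F (Suc i) e1"]
      by (cases "coef F (Suc i) e1 e = 0") (auto simp: strand_def)
    then have "strand F i (diffl F (Suc i) f) (mdeg F i e) e = 0"
      unfolding sd[OF True] by (intro sum.neutral) blast
    then show ?thesis
      using lookup_eq_strand[of "diffl F (Suc i) f" e 0 F i] by simp
  qed (simp add: diffl_def)
  show ?thesis
    unfolding minimal_free_resolution_def
  proof (intro conjI allI impI ballI)
    fix i :: nat assume i: "1 \<le> i"
    then obtain j where j: "i = Suc j" by (cases i) auto
    show "mdeg F (i - 1) e' \<le> mdeg F i e" if "e \<in> gens F i" "e' \<in> gens F (i - 1)" "coef F i e e' \<noteq> 0" for e e'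
      using deg[of e j e'] that j by simp
    show "diffl F (i + 1) ` free_mod F (i + 1) = {f \<in> free_mod F i. diffl F i f = 0}"
      using ex[of j] j by simp
    show "Poly_Mapping.lookup (diffl F i f e) 0 = 0" for f e
      using min[of j] j by simp
  next
    show "\<exists>e0. gens F 0 = {e0} \<and> mdeg F 0 e0 = 0 \<and> (\<lambda>f. f e0) ` diffl F 1 ` free_mod F 1 = N"
      using e0 aug by blast
  qed (rule fin)
qed

text \<open>Renames the basis elements, since \<open>rigid_deformation\<close> asks for natural
  numbers. The inverse is taken on the union over all degrees, so one renaming serves every module
  of the complex.\<close>

definition reindex :: "('e \<Rightarrow> 'f) \<Rightarrow> ('e, 'v, 'k) based_complex \<Rightarrow> ('f, 'v, 'k) based_complex" where
  "reindex h F = \<lparr>gens = (\<lambda>i. h ` gens F i),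
     mdeg = (\<lambda>i e. mdeg F i (inv_into (\<Union>i. gens F i) h e)),
     coef = (\<lambda>i e e'. coef F i (inv_into (\<Union>i. gens F i) h e) (inv_into (\<Union>i. gens F i) h e'))\<rparr>"

lemma strandwise_minimal_reindex:
  assumes "strandwise_minimal F M" and inj: "inj_on h (\<Union>i. gens F i)"
  shows "strandwise_minimal (reindex h F) M"
proof -
  let ?F = "reindex h F"
  have inv: "inv_into (\<Union>i. gens F i) h (h e) = e" if "e \<in> gens F i" for e i
    using inv_into_f_f[OF inj] that by blast
  have g: "gens ?F i = h ` gens F i" for i
    by (simp add: reindex_def)
  have m: "mdeg ?F i (h e) = mdeg F i e" if "e \<in> gens F i" for i e
    using inv[OF that] by (simp add: reindex_def)
  have c: "coef ?F i (h e) (h e') = coef F i e e'" if "e \<in> gens F a" "e' \<in> gens F b" for i e e' a b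
    using inv[OF that(1)] inv[OF that(2)] by (simp add: reindex_def)
  have injg: "inj_on h (gens F i)" for i
    by (rule inj_on_subset[OF inj]) blast
  have sum1: "(\<Sum>e\<in>gens ?F i. u e) = (\<Sum>e\<in>gens F i. u (h e))" for i and u :: "_ \<Rightarrow> 'c"
    unfolding g by (simp add: sum.reindex[OF injg])
  have sum2: "(\<Sum>e | e \<in> gens ?F i \<and> mdeg ?F i e \<le> t. u e) =
      (\<Sum>e | e \<in> gens F i \<and> mdeg F i e \<le> t. u (h e))" for i t and u :: "_ \<Rightarrow> 'c"
  proof -
    have "{e. e \<in> gens ?F i \<and> mdeg ?F i e \<le> t} = h ` {e. e \<in> gens F i \<and> mdeg F i e \<le> t}"
      unfolding g using m by auto
    moreover have "inj_on h {e. e \<in> gens F i \<and> mdeg F i e \<le> t}"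
      by (rule inj_on_subset[OF injg]) auto
    ultimately show ?thesis
      by (simp add: sum.reindex)
  qed
  show ?thesis
    unfolding strandwise_minimal_def
  proof (intro conjI allI impI ballI)
    show "finite (gens ?F i)" for i
      using assms(1) unfolding g strandwise_minimal_def by blast
  next
    fix i e e' assume *: "e \<in> gens ?F (Suc i)" "e' \<in> gens ?F i" "coef ?F (Suc i) e e' \<noteq> 0"
    then obtain d d' where d: "e = h d" "d \<in> gens F (Suc i)" "e' = h d'" "d' \<in> gens F i"
      unfolding g by blast
    then have "coef F (Suc i) d d' \<noteq> 0"
      using *(3) c by metis
    then have "mdeg F i d' \<le> mdeg F (Suc i) d \<and> mdeg F i d' \<noteq> mdeg F (Suc i) d"
      using assms(1) d unfolding strandwise_minimal_def by blast
    then show "mdeg ?F i e' \<le> mdeg ?F (Suc i) e" "mdeg ?F i e' \<noteq> mdeg ?F (Suc i) e"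
      using d m by auto
  next
    obtain e0 where e0: "gens F 0 = {e0}" "mdeg F 0 e0 = 0"
      "\<forall>e\<in>gens F 1. \<forall>t. mdeg F 1 e \<le> t \<longrightarrow> t \<in> M"
      "\<forall>t\<in>M. \<exists>e\<in>gens F 1. mdeg F 1 e \<le> t \<and> coef F 1 e e0 \<noteq> 0"
      using assms(1) unfolding strandwise_minimal_def by (elim conjE exE) blast
    have "gens ?F 0 = {h e0} \<and> mdeg ?F 0 (h e0) = 0 \<and>
        (\<forall>e\<in>gens ?F 1. \<forall>t. mdeg ?F 1 e \<le> t \<longrightarrow> t \<in> M) \<and>
        (\<forall>t\<in>M. \<exists>e\<in>gens ?F 1. mdeg ?F 1 e \<le> t \<and> coef ?F 1 e (h e0) \<noteq> 0)"
    proof (intro conjI ballI allI impI)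
      show "gens ?F 0 = {h e0}" "mdeg ?F 0 (h e0) = 0"
        using e0(1,2) m[of e0 0] by (auto simp: g)
      show "t \<in> M" if "e \<in> gens ?F 1" "mdeg ?F 1 e \<le> t" for e t
        using that e0(3) m unfolding g by auto
      fix t assume "t \<in> M"
      then obtain e where e: "e \<in> gens F 1" "mdeg F 1 e \<le> t" "coef F 1 e e0 \<noteq> 0"
        using e0(4) by blast
      then have "h e \<in> gens ?F 1" "mdeg ?F 1 (h e) \<le> t" "coef ?F 1 (h e) (h e0) \<noteq> 0"
        using m c[OF e(1), of e0 0] e0(1) by (auto simp: g)
      then show "\<exists>e\<in>gens ?F 1. mdeg ?F 1 e \<le> t \<and> coef ?F 1 e (h e0) \<noteq> 0"
        by blast
    qed
    then show "\<exists>e0. gens ?F 0 = {e0} \<and> mdeg ?F 0 e0 = 0 \<and>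
        (\<forall>e\<in>gens ?F 1. \<forall>t. mdeg ?F 1 e \<le> t \<longrightarrow> t \<in> M) \<and>
        (\<forall>t\<in>M. \<exists>e\<in>gens ?F 1. mdeg ?F 1 e \<le> t \<and> coef ?F 1 e e0 \<noteq> 0)"
      by blast
  next
    fix i e e' assume *: "e \<in> gens ?F (Suc (Suc i))" "e' \<in> gens ?F i"
    then obtain d d' where d: "e = h d" "d \<in> gens F (Suc (Suc i))" "e' = h d'" "d' \<in> gens F i"
      unfolding g by blast
    have "(\<Sum>e1\<in>gens ?F (Suc i). coef ?F (Suc (Suc i)) e e1 * coef ?F (Suc i) e1 e') =
        (\<Sum>e1\<in>gens F (Suc i). coef F (Suc (Suc i)) d e1 * coef F (Suc i) e1 d')"
      unfolding sum1 d(1,3) by (intro sum.cong refl arg_cong2[of _ _ _ _ "(*)"] c) (use d in auto)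
    also have "\<dots> = 0"
      using assms(1) d(2,4) unfolding strandwise_minimal_def by blast
    finally show "(\<Sum>e1\<in>gens ?F (Suc i). coef ?F (Suc (Suc i)) e e1 * coef ?F (Suc i) e1 e') = 0" .
  next
    fix i t x assume x: "\<forall>e'\<in>gens ?F i. mdeg ?F i e' \<le> t \<longrightarrow>
           (\<Sum>e | e \<in> gens ?F (Suc i) \<and> mdeg ?F (Suc i) e \<le> t. x e * coef ?F (Suc i) e e') = 0"
    have "\<forall>e'\<in>gens F i. mdeg F i e' \<le> t \<longrightarrow>
           (\<Sum>e | e \<in> gens F (Suc i) \<and> mdeg F (Suc i) e \<le> t. x (h e) * coef F (Suc i) e e') = 0"
    proof (intro ballI impI)
      fix e' assume e': "e' \<in> gens F i" "mdeg F i e' \<le> t"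
      have "(\<Sum>e | e \<in> gens F (Suc i) \<and> mdeg F (Suc i) e \<le> t. x (h e) * coef F (Suc i) e e') =
          (\<Sum>e | e \<in> gens F (Suc i) \<and> mdeg F (Suc i) e \<le> t. x (h e) * coef ?F (Suc i) (h e) (h e'))"
        by (intro sum.cong refl arg_cong2[of _ _ _ _ "(*)"] c[symmetric]) (use e' in auto)
      also have "\<dots> = 0"
      proof -
        have "h e' \<in> gens ?F i" "mdeg ?F i (h e') \<le> t"
          using e' m by (auto simp: g)
        then have "(\<Sum>e | e \<in> gens ?F (Suc i) \<and> mdeg ?F (Suc i) e \<le> t. x e * coef ?F (Suc i) e (h e')) = 0"
          using x by blast
        then show ?thesis
          by (simp only: sum2)
      qed
      finally show "(\<Sum>e | e \<in> gens F (Suc i) \<and> mdeg F (Suc i) e \<le> t. x (h e) * coef F (Suc i) e e') = 0" .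
    qed
    then obtain y where y: "\<forall>e\<in>gens F (Suc i). mdeg F (Suc i) e \<le> t \<longrightarrow>
        x (h e) = (\<Sum>e' | e' \<in> gens F (Suc (Suc i)) \<and> mdeg F (Suc (Suc i)) e' \<le> t. y e' * coef F (Suc (Suc i)) e' e)"
      using assms(1) unfolding strandwise_minimal_def by meson
    define y' where "y' = (\<lambda>e. y (inv_into (\<Union>i. gens F i) h e))"
    have "x (h e) = (\<Sum>e' | e' \<in> gens F (Suc (Suc i)) \<and> mdeg F (Suc (Suc i)) e' \<le> t. y' (h e') * coef ?F (Suc (Suc i)) (h e') (h e))"
      if e: "e \<in> gens F (Suc i)" "mdeg F (Suc i) e \<le> t" for e
    proof -
      have "x (h e) = (\<Sum>e' | e' \<in> gens F (Suc (Suc i)) \<and> mdeg F (Suc (Suc i)) e' \<le> t. y e' * coef F (Suc (Suc i)) e' e)"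
        using y e by blast
      also have "\<dots> = (\<Sum>e' | e' \<in> gens F (Suc (Suc i)) \<and> mdeg F (Suc (Suc i)) e' \<le> t. y' (h e') * coef ?F (Suc (Suc i)) (h e') (h e))"
      proof (rule sum.cong[OF refl])
        fix e' assume "e' \<in> {e'. e' \<in> gens F (Suc (Suc i)) \<and> mdeg F (Suc (Suc i)) e' \<le> t}"
        then show "y e' * coef F (Suc (Suc i)) e' e = y' (h e') * coef ?F (Suc (Suc i)) (h e') (h e)"
          using c[of e' "Suc (Suc i)" e "Suc i" "Suc (Suc i)"] inv[of e' "Suc (Suc i)"] e(1) by (simp add: y'_def)
      qed
      finally show ?thesis .
    qed
    then have "\<forall>e\<in>gens ?F (Suc i). mdeg ?F (Suc i) e \<le> t \<longrightarrow>
        x e = (\<Sum>e' | e' \<in> gens ?F (Suc (Suc i)) \<and> mdeg ?F (Suc (Suc i)) e' \<le> t. y' e' * coef ?F (Suc (Suc i)) e' e)"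
      unfolding sum2 using m unfolding g by auto
    then show "\<exists>y. \<forall>e\<in>gens ?F (Suc i). mdeg ?F (Suc i) e \<le> t \<longrightarrow>
        x e = (\<Sum>e' | e' \<in> gens ?F (Suc (Suc i)) \<and> mdeg ?F (Suc (Suc i)) e' \<le> t. y e' * coef ?F (Suc (Suc i)) e' e)"
      by blast
  qed
qed

section \<open>The complex of a rigid Betti poset\<close>

context rigid_poset
begin

lemma coversI:
  assumes "p \<in> proper Q" "q \<in> proper Q" "p < q" "r q = Suc (r p)"
  shows "covers Q q p"
proof -
  have "\<not> (p < x \<and> x < q)" if "x \<in> Q" for x
  proof
    assume x: "p < x \<and> x < q"
    then have "x \<in> proper Q"
      using that assms(1) by (auto simp: proper_def)
    then show False
      using r_mono[of p x] r_mono[of x q] assms x by auto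
  qed
  then show ?thesis
    using assms by (auto simp: covers_def proper_def)
qed

lemma hclass_top:
  assumes "q \<in> proper Q"
  shows "hclass (order_complex (below Q q)) (int (r q) - 2) z = {z :: 'a set \<Rightarrow> 'k}"
  by (simp add: hclass_def obounds_top[OF assms])

lemma Delta_closed_le: "Delta_closed Q p = order_complex {x \<in> proper Q. x \<le> p}"
  unfolding Delta_closed_def proper_def by (rule arg_cong[of _ _ order_complex]) auto

text \<open>Ranks decide the connecting map: chains with \<open>r p\<close> elements in the closed
  interval up to \<open>p\<close> all contain \<open>p\<close>, and those under the other elements
  covered by \<open>q\<close> never do. So the splitting is unique, with \<open>z'\<close> the cone
  over the link, and the intersection has no chains of that dimension to divide out.\<close>

lemma phi_gen:
  assumes p: "p \<in> proper Q" and q: "q \<in> proper Q" and cov: "p < q" "r q = Suc (r p)"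
  shows "phi Q (r q) q p (hclass (Delta Q q) (int (r q) - 2) (gen q)) =
    hclass (Delta Q p) (int (r p) - 2) (link p (gen q))"
proof -
  let ?z = "gen q" and ?K1 = "Delta_closed Q p"
  let ?K2 = "\<Union>b\<in>{b. covers Q q b \<and> b \<noteq> p}. Delta_closed Q b"
  let ?j = "int (r q) - 2"
  have z: "?z \<in> ochains (below Q q) ?j" "bdry ?z = 0"
    by (rule gen_cycle[OF q])+
  have l: "link p ?z = fscale (co q p) (gen p)"
    by (rule link_gen[OF p q cov(2)])
  \<comment> \<open>A chain of \<open>r p\<close> elements with ranks at most \<open>r p\<close>
    meets rank \<open>r p\<close>, which among the elements up to \<open>p\<close> is attained only
    by \<open>p\<close>.\<close>
  have K1: "p \<in> \<sigma>" if s: "\<sigma> \<in> ?K1" "int (card \<sigma>) = ?j + 1" for \<sigma>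
  proof -
    define c where "c = (\<lambda>\<tau>. if \<tau> = \<sigma> then 1 else 0 :: 'k)"
    have c: "c \<in> ochains {x \<in> proper Q. x \<le> p} ?j"
      using s by (auto simp: c_def chains_def Delta_closed_le)
    have sub: "\<sigma> \<subseteq> {x \<in> proper Q. x \<le> p}"
      using s(1) by (auto simp: Delta_closed_le order_complex_def)
    have less: "r x < r p" if "x \<in> \<sigma>" "x \<noteq> p" for x
    proof -
      have "x \<in> proper Q" "x < p"
        using sub that by (auto simp: less_le)
      then show ?thesis
        by (intro r_mono p)
    qed
    then have "r x \<le> r p" if "x \<in> \<sigma>" for x
      using that by (cases "x = p") (auto intro: less_imp_le)
    then have "r ` \<sigma> = {1..r p}"
      by (intro rank_chain(3)[OF ochains_mono[OF c]]) (use cov(2) in \<open>auto simp: c_def\<close>)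
    then obtain x where x: "x \<in> \<sigma>" "r x = r p"
      using r_pos[OF p] by (metis atLeastAtMost_iff image_iff order_refl)
    then have "x = p"
      using less by force
    with x show ?thesis by simp
  qed
  have K2: "p \<notin> \<sigma>" if s: "\<sigma> \<in> ?K2" for \<sigma>
  proof
    assume "p \<in> \<sigma>"
    with s obtain b where b: "covers Q q b" "b \<noteq> p" "p \<le> b"
      by (auto simp: Delta_closed_le order_complex_def)
    then show False
      using coversI[OF p q cov] by (auto simp: covers_def order_le_less)
  qed
  have parts: "z' = cone p (link p ?z)" if "?z = z' + z''" "z' \<in> chains ?K1 ?j" "z'' \<in> chains ?K2 ?j" for z' z''
  proof
    fix \<sigma>
    have "?z \<sigma> = z' \<sigma> + z'' \<sigma>"
      using that(1) by (metis plus_fun_apply)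
    moreover have "z' \<sigma> = 0" if "p \<notin> \<sigma>"
      using K1[of \<sigma>] that \<open>z' \<in> chains ?K1 ?j\<close> by (auto simp: chains_def)
    moreover have "z'' \<sigma> = 0" if "p \<in> \<sigma>"
      using K2[of \<sigma>] that \<open>z'' \<in> chains ?K2 ?j\<close> by (auto simp: chains_def)
    ultimately show "z' \<sigma> = cone p (link p ?z) \<sigma>"
      by (auto simp: cone_def link_def insert_absorb)
  qed
  have in1: "cone p (link p ?z) \<in> chains ?K1 ?j"
  proof -
    have "insert p (below Q p) \<subseteq> {x \<in> proper Q. x \<le> p}"
      using p by (auto simp: below_eq)
    then show ?thesis
      unfolding l Delta_closed_le using ochains_mono[OF cone_gen_in_ochains[OF p, of "co q p"]] cov(2) by simp
  qed
  \<comment> \<open>A chain of \<open>gen q\<close> that avoids \<open>p\<close> still meets rank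
    \<open>r p\<close>, in an element \<open>b\<close> that \<open>q\<close> covers and that is the
    top of the chain.\<close>
  have in2: "avoid p ?z \<in> chains ?K2 ?j"
    unfolding chains_def
  proof (intro CollectI allI impI)
    fix \<sigma> assume "avoid p ?z \<sigma> \<noteq> 0"
    then have ps: "p \<notin> \<sigma>" and zs: "?z \<sigma> \<noteq> 0"
      by (auto simp: avoid_def split: if_splits)
    note * = ochainsD[OF z(1) zs]
    have mem: "x \<in> proper Q" "x < q" "r x \<le> r p" if "x \<in> \<sigma>" for x
      using *(2) that below_rank[OF q, of x] cov(2) by auto
    have "r ` \<sigma> = {1..r p}"
      by (intro rank_chain(3)[OF ochains_mono[OF z(1)] zs]) (use cov(2) mem in \<open>auto simp: below_eq\<close>)
    then obtain b where b: "b \<in> \<sigma>" "r b = r p"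
      using r_pos[OF p] by (metis atLeastAtMost_iff image_iff order_refl)
    have "covers Q q b"
      using coversI[OF mem(1)[OF b(1)] q mem(2)[OF b(1)]] b(2) cov(2) by simp
    moreover have "b \<noteq> p"
      using ps b(1) by blast
    moreover have "x \<le> b" if "x \<in> \<sigma>" for x
      using *(3)[OF that b(1)] r_mono[OF mem(1)[OF b(1)] mem(1)[OF that]] mem(3)[OF that] b(2)
      by (auto simp: order_le_less)
    then have "\<sigma> \<in> Delta_closed Q b"
      unfolding Delta_closed_le order_complex_def chain_def using * mem by auto
    ultimately show "\<sigma> \<in> ?K2 \<and> int (card \<sigma>) = ?j + 1"
      using *(4) by blast
  qed
  have bz': "bdry (cone p (link p ?z)) = link p ?z"
    unfolding l by (rule bdry_cone_gen[OF p])
  have "chains (?K1 \<inter> ?K2) ?j = {0 :: 'a set \<Rightarrow> 'k}"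
  proof -
    have "c = 0" if "c \<in> chains (?K1 \<inter> ?K2) ?j" for c :: "'a set \<Rightarrow> 'k"
    proof
      fix \<sigma> show "c \<sigma> = 0 \<sigma>"
        using that K1[of \<sigma>] K2[of \<sigma>] by (auto simp: chains_def)
    qed
    then show ?thesis
      using fs.subspace_0[OF chains_subspace] by blast
  qed
  then have hc: "hclass (?K1 \<inter> ?K2) (?j - 1) (link p ?z) = {link p ?z}"
    by (simp add: hclass_def boundaries_def)
  have "mv_connect ?K1 ?K2 ?j {?z} = {link p ?z}"
    unfolding mv_connect_def
  proof (rule the_equality)
    show "\<exists>z z' z''. z \<in> {?z} \<and> z = z' + z'' \<and> z' \<in> chains ?K1 ?j \<and> z'' \<in> chains ?K2 ?j \<and>
        {link p ?z} = hclass (?K1 \<inter> ?K2) (?j - 1) (bdry z')"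
      by (intro exI[of _ ?z] exI[of _ "cone p (link p ?z)"] exI[of _ "avoid p ?z"] conjI in1 in2)
        (simp_all only: singletonI bz' hc cone_link_avoid[symmetric])
  next
    fix \<zeta> assume "\<exists>z z' z''. z \<in> {?z} \<and> z = z' + z'' \<and> z' \<in> chains ?K1 ?j \<and> z'' \<in> chains ?K2 ?j \<and>
        \<zeta> = hclass (?K1 \<inter> ?K2) (?j - 1) (bdry z')"
    then obtain z' z'' where "?z = z' + z''" "z' \<in> chains ?K1 ?j" "z'' \<in> chains ?K2 ?j"
      and \<zeta>: "\<zeta> = hclass (?K1 \<inter> ?K2) (?j - 1) (bdry z')"
      by blast
    then have "z' = cone p (link p ?z)"
      by (intro parts)
    then show "\<zeta> = {link p ?z}"
      unfolding \<zeta> by (simp only: bz' hc)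
  qed
  moreover have "hclass (Delta Q q) ?j ?z = {?z}"
    unfolding Delta_below by (rule hclass_top[OF q])
  moreover have "int (r q) - 3 = int (r p) - 2"
    using cov(2) by simp
  ultimately show ?thesis
    by (simp add: phi_def h_incl_def)
qed

lemma rank_one: "q \<in> proper Q \<Longrightarrow> r q = 1 \<Longrightarrow> below Q q = {}"
  using below_rank r_pos by fastforce

lemma rank_one_if_minimal:
  assumes "q \<in> proper Q" "below Q q = {}"
  shows "r q = 1"
  using hdim_empty_nonzero[where 'a='a and 'k='k] hdim_below[OF assms(1), of "-1"] assms(2) by (auto split: if_splits)

section \<open>The based complex of a labelled poset\<close>

context
  fixes \<eta> :: "'a \<Rightarrow> 'v monom" and F :: "('a \<times> ('a set \<Rightarrow> 'k), 'v, 'k) based_complex"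
  assumes F: "F = poset_complex Q \<eta>"
begin

lemma gens_Suc: "gens F (Suc i) = (\<lambda>q. (q, gen q)) ` {q \<in> proper Q. r q = Suc i}"
proof -
  have "gens F (Suc i) = (SIGMA q : proper Q. hbasis (order_complex (below Q q)) (int (Suc i) - 2))"
    by (simp add: F poset_complex_def proper_eq[OF pointed] Delta_below)
  also have "\<dots> = (SIGMA q : proper Q. if r q = Suc i then {gen q} else {})"
    by (rule Sigma_cong[OF refl]) (rule hbasis_gen)
  finally show ?thesis
    by (auto split: if_splits)
qed

text \<open>The complex below an element of rank 1 is \<open>{{}}\<close>, the same as in degree 0,
  so the basis element chosen there is again \<open>gen a\<close>.\<close>

lemma gens_0:
  assumes "a \<in> proper Q" "r a = 1"
  shows "gens F 0 = {(pbot Q, gen a)}"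
  using hbasis_gen[OF assms(1), of 1] rank_one[OF assms] assms(2)
  by (simp add: F poset_complex_def order_complex_empty)

lemma mdeg_eq: "mdeg F i (q, z) = \<eta> q"
  by (simp add: F poset_complex_def)

text \<open>All elements of rank 1 share one generating cycle, and the identity map has entry 1 with
  respect to it.\<close>

lemma coef_1:
  assumes "a \<in> proper Q" "r a = 1" "q \<in> proper Q" "r q = 1"
  shows "coef F (Suc 0) (q, gen q) (pbot Q, gen a) = 1"
proof -
  have b: "below Q q = {}" "below Q a = {}"
    using rank_one assms by auto
  have "gen a = gen q"
    using hbasis_gen[OF assms(1), of 1] hbasis_gen[OF assms(3), of 1] b assms by simp
  moreover have "covers Q q (pbot Q)"
    using assms(3) b(1) finite_pointedD(2)[OF pointed] by (auto simp: covers_def proper_def below_def)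
  moreover have "hcoord {{}} (-1) (hclass {{}} (-1) (gen q)) (gen q) = 1"
    using hcoord_gen[OF assms(3), of "-1" 1] assms(4) by (simp add: b order_complex_empty)
  ultimately show ?thesis
    by (simp add: F poset_complex_def)
qed

lemma coef_Suc:
  assumes "p \<in> proper Q" "q \<in> proper Q" "r p = Suc i" "r q = Suc (Suc i)"
  shows "coef F (Suc (Suc i)) (q, gen q) (p, gen p) = co q p"
proof (cases "p < q")
  case True
  have rq: "r q = Suc (r p)"
    using assms by simp
  have "coef F (Suc (Suc i)) (q, gen q) (p, gen p) = hcoord (Delta Q p) (int (r q) - 3)
      (phi Q (r q) q p (hclass (Delta Q q) (int (r q) - 2) (gen q))) (gen p)"
    using coversI[OF assms(1,2) True rq] assms(4) by (simp add: F poset_complex_def)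
  also have "\<dots> = hcoord (order_complex (below Q p)) (int (r p) - 2)
      (hclass (order_complex (below Q p)) (int (r p) - 2) (fscale (co q p) (gen p))) (gen p)"
    unfolding phi_gen[OF assms(1,2) True rq] unfolding Delta_below link_gen[OF assms(1,2) rq] using rq by simp
  also have "\<dots> = co q p"
    by (rule hcoord_gen[OF assms(1) refl])
  finally show ?thesis .
next
  case False
  then have "\<not> covers Q q p"
    by (simp add: covers_def)
  moreover have "co q p = 0"
    by (rule co_eq_0[OF assms(1,2) _ False]) (use assms in simp)
  ultimately show ?thesis
    by (simp add: F poset_complex_def)
qed

lemma sum_gens_Suc: "(\<Sum>e\<in>gens F (Suc i). u e) = (\<Sum>q | q \<in> proper Q \<and> r q = Suc i. u (q, gen q))"
  for u :: "_ \<Rightarrow> 'k"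
  unfolding gens_Suc by (subst sum.reindex) (auto intro: inj_onI)

lemma sum_gens_Suc_le:
  "(\<Sum>e | e \<in> gens F (Suc i) \<and> mdeg F (Suc i) e \<le> t. u e) =
    (\<Sum>q | q \<in> {q \<in> proper Q. \<eta> q \<le> t} \<and> r q = Suc i. u (q, gen q))"
  for u :: "_ \<Rightarrow> 'k"
proof -
  have "{e. e \<in> gens F (Suc i) \<and> mdeg F (Suc i) e \<le> t} =
      (\<lambda>q. (q, gen q)) ` {q. q \<in> {q \<in> proper Q. \<eta> q \<le> t} \<and> r q = Suc i}"
    unfolding gens_Suc by (auto simp: mdeg_eq)
  then show ?thesis
    by (simp add: sum.reindex inj_on_def)
qed

text \<open>The strand of degree \<open>t\<close> is the complex of the down-set of elements whose
  label divides \<open>t\<close>. It vanishes in positive degrees for monomials outside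
  \<open>M\<close> and is exact there by acyclicity for the others.\<close>

lemma poset_complex_strandwise_minimal:
  assumes mono: "mono_on Q \<eta>" "\<eta> (pbot Q) = 0" and ne: "proper Q \<noteq> {}"
    and acyc: "\<And>t. t \<in> M \<Longrightarrow> acyclic_over TYPE('k) {q \<in> proper Q. \<eta> q \<le> t}"
    and out: "\<And>t q. q \<in> proper Q \<Longrightarrow> \<eta> q \<le> t \<Longrightarrow> t \<in> M" "0 \<notin> M"
    and min: "\<And>p q. p \<in> proper Q \<Longrightarrow> q \<in> proper Q \<Longrightarrow> p < q \<Longrightarrow> r q = Suc (r p) \<Longrightarrow>
      co q p \<noteq> 0 \<Longrightarrow> \<eta> p \<noteq> \<eta> q"
  shows "strandwise_minimal F M"
proof -
  have QQ: "q \<in> Q" if "q \<in> proper Q" for q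
    using that by (simp add: proper_def)
  \<comment> \<open>A minimal element has the empty interval below it, hence homology in degree -1
    and rank 1.\<close>
  have minimal_1: "\<exists>q\<in>U. r q = 1" if U: "U \<noteq> {}" "down_closed (proper Q) U" for U
  proof -
    obtain q where q: "q \<in> U" "\<And>x. x \<in> U \<Longrightarrow> \<not> x < q"
      using finite_minimal_exists[OF down_closed_finite[OF pointed U(2)] U(1)] by metis
    then have "q \<in> proper Q" "below Q q = {}"
      using U(2) less_imp_le unfolding down_closed_def below_eq by blast+
    then show ?thesis
      using rank_one_if_minimal q(1) by blast
  qed
  obtain a where a: "a \<in> proper Q" "r a = 1"
    using minimal_1[OF ne] by (auto simp: down_closed_def)
  have U: "down_closed (proper Q) {q \<in> proper Q. \<eta> q \<le> t}" for t
    unfolding down_closed_def using mono_onD[OF mono(1)] QQ by (blast intro: order_trans)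
  show ?thesis
    unfolding strandwise_minimal_def
  proof (intro conjI allI ballI impI)
    fix i show "finite (gens F i)"
      by (cases i) (simp_all add: gens_Suc gens_0[OF a])
  next
    fix i e e' assume e: "e \<in> gens F (Suc i)" "e' \<in> gens F i" "coef F (Suc i) e e' \<noteq> 0"
    obtain q where q: "e = (q, gen q)" "q \<in> proper Q" "r q = Suc i"
      using e(1) unfolding gens_Suc by auto
    have "mdeg F i e' \<le> mdeg F (Suc i) e \<and> mdeg F i e' \<noteq> mdeg F (Suc i) e"
    proof (cases i)
      case 0
      have "mdeg F i e' = 0"
        using e(2) unfolding 0 gens_0[OF a] by (simp add: mdeg_eq mono(2))
      moreover have "\<eta> q \<noteq> 0"
        using out(1)[OF q(2), of 0] out(2) by auto
      ultimately show ?thesis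
        by (auto simp: q(1) mdeg_eq le_fun_def)
    next
      case (Suc j)
      obtain p where p: "e' = (p, gen p)" "p \<in> proper Q" "r p = Suc j"
        using e(2) unfolding Suc gens_Suc by auto
      have co: "co q p \<noteq> 0"
        using e(3) coef_Suc[OF p(2) q(2) p(3)] q(3) by (simp add: q(1) p(1) Suc)
      have rq: "r q = Suc (r p)"
        using p q Suc by simp
      have "p < q"
        using co_eq_0[OF p(2) q(2) rq] co by blast
      then show ?thesis
        using min[OF p(2) q(2) _ rq co] mono_onD[OF mono(1) QQ[OF p(2)] QQ[OF q(2)]]
        by (simp add: q(1) p(1) mdeg_eq)
    qed
    then show "mdeg F i e' \<le> mdeg F (Suc i) e" "mdeg F i e' \<noteq> mdeg F (Suc i) e"
      by auto
  next
    have "gens F 0 = {(pbot Q, gen a)} \<and> mdeg F 0 (pbot Q, gen a) = 0 \<and>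
        (\<forall>e\<in>gens F 1. \<forall>t. mdeg F 1 e \<le> t \<longrightarrow> t \<in> M) \<and>
        (\<forall>t\<in>M. \<exists>e\<in>gens F 1. mdeg F 1 e \<le> t \<and> coef F 1 e (pbot Q, gen a) \<noteq> 0)"
    proof (intro conjI ballI allI impI)
      show "gens F 0 = {(pbot Q, gen a)}" "mdeg F 0 (pbot Q, gen a) = 0"
        by (simp_all add: gens_0[OF a] mdeg_eq mono(2))
      show "t \<in> M" if "e \<in> gens F 1" "mdeg F 1 e \<le> t" for e t
        using that out(1) by (auto simp: gens_Suc mdeg_eq)
      fix t assume t: "t \<in> M"
      \<comment> \<open>Acyclic sets are nonempty; this yields a generator whose degree divides
        \<open>t\<close>.\<close>
      have "{q \<in> proper Q. \<eta> q \<le> t} \<noteq> {}"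
        using acyc[OF t] hdim_empty_nonzero[where 'a='a and 'k='k]
        by (metis acyclic_over_iff_hdim finite.emptyI)
      then obtain q where q: "q \<in> proper Q" "\<eta> q \<le> t" "r q = 1"
        using minimal_1[OF _ U] by blast
      then have "(q, gen q) \<in> gens F 1" "mdeg F 1 (q, gen q) \<le> t" "coef F 1 (q, gen q) (pbot Q, gen a) \<noteq> 0"
        using coef_1[OF a q(1,3)] by (auto simp: gens_Suc mdeg_eq)
      then show "\<exists>e\<in>gens F 1. mdeg F 1 e \<le> t \<and> coef F 1 e (pbot Q, gen a) \<noteq> 0"
        by blast
    qed
    then show "\<exists>e0. gens F 0 = {e0} \<and> mdeg F 0 e0 = 0 \<and>
        (\<forall>e\<in>gens F 1. \<forall>t. mdeg F 1 e \<le> t \<longrightarrow> t \<in> M) \<and>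
        (\<forall>t\<in>M. \<exists>e\<in>gens F 1. mdeg F 1 e \<le> t \<and> coef F 1 e e0 \<noteq> 0)"
      by blast
  next
    fix i e e' assume e: "e \<in> gens F (Suc (Suc i))" "e' \<in> gens F i"
    obtain q' where q': "e = (q', gen q')" "q' \<in> proper Q" "r q' = Suc (Suc i)"
      using e(1) unfolding gens_Suc by auto
    have zero: "(\<Sum>q | q \<in> proper Q \<and> r q = Suc i. fscale (co q' q) (gen q)) = 0"
      by (rule sum_co_gen[OF q'(2,3)]) simp
    have "(\<Sum>e1\<in>gens F (Suc i). coef F (Suc (Suc i)) e e1 * coef F (Suc i) e1 e') =
        (\<Sum>q | q \<in> proper Q \<and> r q = Suc i. co q' q * coef F (Suc i) (q, gen q) e')"
      unfolding sum_gens_Suc q'(1) by (intro sum.cong refl) (simp add: coef_Suc q')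
    also have "\<dots> = 0"
    proof (cases i)
      case 0
      have e': "e' = (pbot Q, gen a)"
        using e(2) unfolding 0 gens_0[OF a] by simp
      have same: "gen q = gen a" if "q \<in> proper Q" "r q = Suc 0" for q
        using hbasis_gen[OF that(1), of 1] hbasis_gen[OF a(1), of 1] rank_one[of q] rank_one[of a] a that by simp
      have "fscale (\<Sum>q | q \<in> proper Q \<and> r q = Suc 0. co q' q) (gen a) =
          (\<Sum>q | q \<in> proper Q \<and> r q = Suc 0. fscale (co q' q) (gen a))"
        by (rule fs.scale_sum_left)
      also have "\<dots> = (\<Sum>q | q \<in> proper Q \<and> r q = Suc 0. fscale (co q' q) (gen q))"
        by (rule sum.cong[OF refl]) (simp add: same)
      also have "\<dots> = 0"
        using zero unfolding 0 .
      finally have "(\<Sum>q | q \<in> proper Q \<and> r q = Suc 0. co q' q) = 0"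
        using gen_nonzero[OF a(1)] unfolding fs.scale_eq_0_iff by blast
      then show ?thesis
        unfolding 0 e' by (simp add: coef_1[OF a])
    next
      case (Suc j)
      obtain p where p: "e' = (p, gen p)" "p \<in> proper Q" "r p = Suc j"
        using e(2) unfolding Suc gens_Suc by auto
      have "fscale (\<Sum>q | q \<in> proper Q \<and> r q = Suc i. co q' q * co q p) (gen p) =
          (\<Sum>q | q \<in> proper Q \<and> r q = Suc i. fscale (co q' q * co q p) (gen p))"
        by (rule fs.scale_sum_left)
      also have "\<dots> = (\<Sum>q | q \<in> proper Q \<and> r q = Suc i. fscale (co q' q) (link p (gen q)))"
        by (rule sum.cong[OF refl]) (use p Suc in \<open>simp add: link_gen\<close>)
      also have "\<dots> = link p (\<Sum>q | q \<in> proper Q \<and> r q = Suc i. fscale (co q' q) (gen q))"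
        by (simp only: link_sum link_scale)
      also have "\<dots> = 0"
        unfolding zero by (rule link_zero)
      finally have "(\<Sum>q | q \<in> proper Q \<and> r q = Suc i. co q' q * co q p) = 0"
        using gen_nonzero[OF p(2)] unfolding fs.scale_eq_0_iff by blast
      moreover have "(\<Sum>q | q \<in> proper Q \<and> r q = Suc i. co q' q * coef F (Suc i) (q, gen q) e') =
          (\<Sum>q | q \<in> proper Q \<and> r q = Suc i. co q' q * co q p)"
        unfolding p(1) Suc by (intro sum.cong refl) (simp add: coef_Suc p)
      ultimately show ?thesis by simp
    qed
    finally show "(\<Sum>e1\<in>gens F (Suc i). coef F (Suc (Suc i)) e e1 * coef F (Suc i) e1 e') = 0" .
  next
    fix i t and x :: "'a \<times> ('a set \<Rightarrow> 'k) \<Rightarrow> 'k"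
    let ?U = "{q \<in> proper Q. \<eta> q \<le> t}"
    define x' where "x' = (\<lambda>q. x (q, gen q))"
    assume x: "\<forall>e'\<in>gens F i. mdeg F i e' \<le> t \<longrightarrow>
        (\<Sum>e | e \<in> gens F (Suc i) \<and> mdeg F (Suc i) e \<le> t. x e * coef F (Suc i) e e') = 0"
    show "\<exists>y. \<forall>e\<in>gens F (Suc i). mdeg F (Suc i) e \<le> t \<longrightarrow>
        x e = (\<Sum>e' | e' \<in> gens F (Suc (Suc i)) \<and> mdeg F (Suc (Suc i)) e' \<le> t. y e' * coef F (Suc (Suc i)) e' e)"
    proof (cases "t \<in> M")
      case False
      then have "\<not> mdeg F (Suc i) e \<le> t" if "e \<in> gens F (Suc i)" for e
        using that out(1) by (auto simp: gens_Suc mdeg_eq)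
      then show ?thesis by blast
    next
      \<comment> \<open>The hypothesis concerns coordinates of the differential, while exactness is
        known for chains. In the lowest degree all generating cycles coincide, and in higher degrees
        the links determine the chain.\<close>
      case True
      have "(\<Sum>q | q \<in> ?U \<and> r q = Suc i. fscale (x' q) (gen q)) = 0"
      proof (cases i)
        case 0
        have same: "gen q = gen a" if "q \<in> proper Q" "r q = Suc 0" for q
          using hbasis_gen[OF that(1), of 1] hbasis_gen[OF a(1), of 1] rank_one[of q] rank_one[of a] a that by simp
        have "mdeg F 0 (pbot Q, gen a) \<le> t"
          by (simp add: mdeg_eq mono(2) le_fun_def)
        then have "(\<Sum>e | e \<in> gens F (Suc 0) \<and> mdeg F (Suc 0) e \<le> t. x e * coef F (Suc 0) e (pbot Q, gen a)) = 0"
          using x unfolding 0 gens_0[OF a] by blast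
        then have "(\<Sum>q | q \<in> ?U \<and> r q = Suc 0. x' q) = 0"
          unfolding sum_gens_Suc_le by (simp add: coef_1[OF a] x'_def)
        moreover have "(\<Sum>q | q \<in> ?U \<and> r q = Suc 0. fscale (x' q) (gen q)) =
            fscale (\<Sum>q | q \<in> ?U \<and> r q = Suc 0. x' q) (gen a)"
          unfolding fs.scale_sum_left by (rule sum.cong[OF refl]) (simp add: same)
        ultimately show ?thesis
          unfolding 0 by (simp only: fs.scale_zero_left)
      next
        case (Suc j)
        show ?thesis
          unfolding Suc
        proof (rule sum_gen_eq_0_if_coords_0[OF U])
          fix p assume p: "p \<in> ?U" "r p = Suc j"
          then have "(p, gen p) \<in> gens F i" "mdeg F i (p, gen p) \<le> t"
            by (auto simp: Suc gens_Suc mdeg_eq)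
          then have "(\<Sum>e | e \<in> gens F (Suc i) \<and> mdeg F (Suc i) e \<le> t. x e * coef F (Suc i) e (p, gen p)) = 0"
            using x by blast
          then have "(\<Sum>q | q \<in> ?U \<and> r q = Suc i. x (q, gen q) * coef F (Suc i) (q, gen q) (p, gen p)) = 0"
            by (simp only: sum_gens_Suc_le)
          moreover have "(\<Sum>q | q \<in> ?U \<and> r q = Suc i. x (q, gen q) * coef F (Suc i) (q, gen q) (p, gen p)) =
              (\<Sum>q | q \<in> ?U \<and> r q = Suc (Suc j). x' q * co q p)"
            unfolding Suc x'_def using p by (intro sum.cong refl) (simp add: coef_Suc)
          ultimately show "(\<Sum>q | q \<in> ?U \<and> r q = Suc (Suc j). x' q * co q p) = 0"
            by simp
        qed simp
      qed
      then obtain y where y: "\<forall>q\<in>?U. r q = Suc i \<longrightarrow> x' q = (\<Sum>q' | q' \<in> ?U \<and> r q' = Suc (Suc i). y q' * co q' q)"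
        using strand_exact[OF U acyc[OF True], of "Suc i"] by auto
      have "x e = (\<Sum>e' | e' \<in> gens F (Suc (Suc i)) \<and> mdeg F (Suc (Suc i)) e' \<le> t. y (fst e') * coef F (Suc (Suc i)) e' e)"
        if e: "e \<in> gens F (Suc i)" "mdeg F (Suc i) e \<le> t" for e
      proof -
        obtain q where q: "e = (q, gen q)" "q \<in> proper Q" "r q = Suc i"
          using e(1) unfolding gens_Suc by auto
        have "\<eta> q \<le> t"
          using e(2) by (simp add: q(1) mdeg_eq)
        then have "x e = (\<Sum>q' | q' \<in> ?U \<and> r q' = Suc (Suc i). y q' * co q' q)"
          using y q by (simp add: x'_def)
        also have "\<dots> = (\<Sum>q' | q' \<in> ?U \<and> r q' = Suc (Suc i).
            y (fst (q', gen q')) * coef F (Suc (Suc i)) (q', gen q') e)"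
          unfolding q(1) using q by (intro sum.cong refl) (simp add: coef_Suc)
        finally show ?thesis
          by (simp only: sum_gens_Suc_le)
      qed
      then show ?thesis
        by (intro exI[of _ "\<lambda>e. y (fst e)"]) blast
    qed
  qed
qed

end

end

section \<open>Retractions between posets\<close>

lemma finite_pointed_iso:
  assumes "finite_pointed A" "poset_iso A B e"
  shows "finite_pointed B" "pbot B = e (pbot A)"
proof -
  note iso = poset_isoD[OF assms(2)] and A = finite_pointedD[OF assms(1)]
  have min: "e (pbot A) \<in> B" "\<And>y. y \<in> B \<Longrightarrow> e (pbot A) \<le> y"
    using iso(2,3) A(2,3) by auto
  then show "finite_pointed B"
    unfolding finite_pointed_def using iso(2) A(1) by blast
  show "pbot B = e (pbot A)"
    using min by (rule pbot_eqI)
qed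

lemma proper_iso:
  assumes "finite_pointed A" "poset_iso A B e"
  shows "e ` proper A = proper B" "p \<in> A \<Longrightarrow> e ` below A p = below B (e p)"
  using poset_isoD[OF assms(2)] finite_pointedD(2)[OF assms(1)]
  by (auto simp: proper_def below_def finite_pointed_iso(2)[OF assms])

lemma hdim_Delta_iso:
  assumes "finite_pointed A" "poset_iso A B e" "p \<in> A"
  shows "hdim TYPE('k::field) (Delta B (e p)) i = hdim TYPE('k) (Delta A p) i"
proof -
  have "poset_iso (below A p) (below B (e p)) e"
    using poset_iso_subset[OF assms(2), of "below A p"] proper_iso(2)[OF assms] by (auto simp: below_def)
  moreover have "finite (below B (e p))"
    using finite_below[OF finite_pointed_iso(1)[OF assms(1,2)]] .
  ultimately show ?thesis
    unfolding Delta_below using hdim_iso by metis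
qed

lemma betti_poset_iso:
  assumes "finite_pointed A" "poset_iso A B e"
  shows "poset_iso (betti_poset TYPE('k::field) A) (betti_poset TYPE('k) B) e"
proof -
  have "e ` betti_poset TYPE('k) A = betti_poset TYPE('k) B"
  proof (intro equalityI subsetI)
    fix x assume "x \<in> e ` betti_poset TYPE('k) A"
    then show "x \<in> betti_poset TYPE('k) B"
      using poset_isoD(2)[OF assms(2)] hdim_Delta_iso[OF assms, where 'k='k] by (auto simp: betti_poset_def)
  next
    fix x assume x: "x \<in> betti_poset TYPE('k) B"
    then obtain p where p: "p \<in> A" "x = e p"
      using poset_isoD(2)[OF assms(2)] by (auto simp: betti_poset_def)
    then have "p \<in> betti_poset TYPE('k) A"
      using x hdim_Delta_iso[OF assms p(1), where 'k='k] by (simp add: betti_poset_def)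
    then show "x \<in> e ` betti_poset TYPE('k) A"
      using p(2) by blast
  qed
  then show ?thesis
    using poset_iso_subset[OF assms(2), of "betti_poset TYPE('k) A"] by (simp add: betti_poset_def)
qed

lemma sum_proper_iso:
  assumes "finite_pointed A" "poset_iso A B e"
  shows "(\<Sum>p\<in>proper B. hdim TYPE('k::field) (Delta B p) i) = (\<Sum>p\<in>proper A. hdim TYPE('k) (Delta A p) i)"
proof -
  have "inj_on e (proper A)"
    by (rule inj_on_subset[OF poset_isoD(1)[OF assms(2)]]) (auto simp: proper_def)
  then have "(\<Sum>p\<in>proper B. hdim TYPE('k) (Delta B p) i) = (\<Sum>p\<in>proper A. hdim TYPE('k) (Delta B (e p)) i)"
    unfolding proper_iso(1)[OF assms, symmetric] by (rule sum.reindex_cong) auto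
  also have "\<dots> = (\<Sum>p\<in>proper A. hdim TYPE('k) (Delta A p) i)"
    by (rule sum.cong[OF refl]) (simp add: hdim_Delta_iso[OF assms] proper_def)
  finally show ?thesis .
qed

lemma rigid_iso:
  assumes "finite_pointed A" "poset_iso A B e" "rigid TYPE('k::field) A"
  shows "rigid TYPE('k) B"
proof -
  note iso = poset_isoD[OF assms(2)] and hd = hdim_Delta_iso[OF assms(1,2), where 'k='k]
  have B: "B = e ` A" "B - {pbot B} = e ` (A - {pbot A})"
    using iso(1,2) finite_pointedD(2)[OF assms(1)] finite_pointed_iso(2)[OF assms(1,2)]
    by (auto dest: inj_onD)
  have R1: "hdim TYPE('k) (Delta A p) i = 1 \<and> (\<forall>j. hdim TYPE('k) (Delta A p) j \<noteq> 0 \<longrightarrow> j = i)"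
    if "p \<in> A" "hdim TYPE('k) (Delta A p) i \<noteq> 0" for p i
    using assms(3) that unfolding rigid_def by blast
  have R2: "\<not> p \<le> q" if "p \<in> A - {pbot A}" "q \<in> A - {pbot A}" "p \<noteq> q"
    "hdim TYPE('k) (Delta A p) i = 1" "hdim TYPE('k) (Delta A q) i = 1" for p q i
    using assms(3) that unfolding rigid_def by blast
  show ?thesis
    unfolding rigid_def
  proof (intro conjI ballI allI impI)
    fix x i assume x: "x \<in> B" "hdim TYPE('k) (Delta B x) i \<noteq> 0"
    then obtain p where p: "x = e p" "p \<in> A"
      unfolding B(1) by blast
    note * = R1[of p i, folded hd[OF p(2)] p(1), OF p(2) x(2)]
    show "hdim TYPE('k) (Delta B x) i = 1"
      using * by blast
    show "j = i" if "hdim TYPE('k) (Delta B x) j \<noteq> 0" for j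
      using * that by blast
  next
    fix x y i assume x: "x \<in> B - {pbot B}" and y: "y \<in> B - {pbot B}"
      and *: "x \<noteq> y \<and> hdim TYPE('k) (Delta B x) i = 1 \<and> hdim TYPE('k) (Delta B y) i = 1"
    obtain p q where pq: "x = e p" "p \<in> A - {pbot A}" "y = e q" "q \<in> A - {pbot A}"
      using x y unfolding B(2) by blast
    have h: "hdim TYPE('k) (Delta A p) i = 1" "hdim TYPE('k) (Delta A q) i = 1" "p \<noteq> q"
      using * pq hd[of p i] hd[of q i] by auto
    show "\<not> x \<le> y"
      using R2[OF pq(2,4) h(3,1,2)] iso(3)[of p q] pq by auto
    show "\<not> y \<le> x"
      using R2[OF pq(4,2) h(3)[symmetric] h(2,1)] iso(3)[of q p] pq by auto
  qed
qed

text \<open>The rank is the homological degree plus 2; degrees start at -1, so ranks start at 1.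
  Comparable elements of equal rank would violate the second rigidity condition.\<close>

lemma rigid_imp_rigid_poset:
  assumes P: "finite_pointed P" and "rigid TYPE('k::field) P"
  shows "\<exists>r. rigid_poset TYPE('k) (betti_poset TYPE('k) P) r"
proof -
  define Q where "Q = betti_poset TYPE('k) P"
  define j where "j q = (SOME j. hdim TYPE('k) (Delta P q) j \<noteq> 0)" for q
  define r where "r q = nat (j q + 2)" for q
  have j: "hdim TYPE('k) (Delta P q) (j q) \<noteq> 0" if "q \<in> Q" for q
    unfolding j_def using that by (auto simp: Q_def betti_poset_def intro: someI)
  have jr: "j q = int (r q) - 2" "1 \<le> r q" if "q \<in> Q" for q
    using j[OF that] hdim_below_minus_one[OF finite_below[OF P], of "j q" q, where 'k='k]
    unfolding Delta_below r_def by (cases "j q < -1"; auto)+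
  have sub: "Q \<subseteq> P" "pbot Q = pbot P"
    using betti_poset_subset[OF P Q_def] betti_poset_pbot[OF P Q_def] by auto
  have one: "hdim TYPE('k) (Delta P q) i = (if i = int (r q) - 2 then 1 else 0)" if q: "q \<in> Q" for q i
    using assms(2) j[OF q] sub q unfolding rigid_def jr(1)[OF q, symmetric] by auto
  have "rigid_poset TYPE('k) Q r"
  proof
    show "finite_pointed Q"
      by (rule betti_poset_pointed[OF P Q_def])
    show "1 \<le> r q" if "q \<in> proper Q" for q
      using jr that by (simp add: proper_def)
    show "hdim TYPE('k) (order_complex (below Q q)) i = (if i = int (r q) - 2 then 1 else 0)"
      if "q \<in> proper Q" for q i
      using one hdim_betti_poset[OF P Q_def, of q i] that by (simp add: proper_def Delta_below)
    show "r p \<noteq> r q" if "p \<in> proper Q" "q \<in> proper Q" "p < q" for p q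
    proof
      assume eq: "r p = r q"
      have mem: "p \<in> P - {pbot P}" "q \<in> P - {pbot P}" "p \<in> Q" "q \<in> Q" "p \<noteq> q"
        using that sub by (auto simp: proper_def)
      have "hdim TYPE('k) (Delta P p) (int (r p) - 2) = 1 \<and> hdim TYPE('k) (Delta P q) (int (r p) - 2) = 1"
        using one[OF mem(3)] one[OF mem(4)] eq by simp
      then have "\<not> p \<le> q"
        using assms(2) mem unfolding rigid_def by blast
      then show False
        using that(3) by simp
    qed
  qed
  then show ?thesis
    unfolding Q_def by blast
qed

text \<open>A join-preserving map between finite lattices that is a bijection on atoms is a retraction
  with an upper adjoint: \<open>g y\<close> is the largest element mapped below \<open>y\<close>.\<close>

locale retraction =
  fixes P :: "'b::order set" and L :: "'a::order set" and f :: "'b \<Rightarrow> 'a" and g :: "'a \<Rightarrow> 'b"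
  assumes P: "finite_pointed P" and L: "finite_pointed L"
    and f_mem: "\<And>x. x \<in> P \<Longrightarrow> f x \<in> L" and g_mem: "\<And>y. y \<in> L \<Longrightarrow> g y \<in> P"
    and adj: "\<And>x y. x \<in> P \<Longrightarrow> y \<in> L \<Longrightarrow> x \<le> g y \<longleftrightarrow> f x \<le> y"
    and f_g: "\<And>y. y \<in> L \<Longrightarrow> f (g y) = y"
    and f_pbot_only: "\<And>x. x \<in> P \<Longrightarrow> f x = pbot L \<Longrightarrow> x = pbot P"
begin

lemma le_g_f: "x \<in> P \<Longrightarrow> x \<le> g (f x)"
  using adj f_mem by blast

lemma f_mono: "x \<in> P \<Longrightarrow> x' \<in> P \<Longrightarrow> x \<le> x' \<Longrightarrow> f x \<le> f x'"
  using adj[of x "f x'"] f_mem le_g_f by (meson order_trans)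

lemma g_le_iff: "y \<in> L \<Longrightarrow> y' \<in> L \<Longrightarrow> g y \<le> g y' \<longleftrightarrow> y \<le> y'"
  using adj[of "g y" y'] g_mem f_g by simp

lemma f_pbot: "f (pbot P) = pbot L"
  using adj[of "pbot P" "pbot L"] finite_pointedD[OF P] finite_pointedD[OF L] g_mem f_mem
  by (meson order_antisym)

lemma f_proper: "x \<in> P \<Longrightarrow> f x \<in> proper L \<longleftrightarrow> x \<in> proper P"
  using f_pbot f_pbot_only f_mem by (auto simp: proper_eq[OF P] proper_eq[OF L])

lemma g_proper: "y \<in> proper L \<Longrightarrow> g y \<in> proper P"
  using f_proper[of "g y"] g_mem f_g by (auto simp: proper_def)

lemma g_iso: "S \<subseteq> L \<Longrightarrow> poset_iso S (g ` S) g"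
  unfolding poset_iso_def bij_betw_def
  using g_le_iff f_g by (auto simp: inj_on_def) (metis subsetD)+

lemma proper_mem: "x \<in> proper P \<Longrightarrow> x \<in> P" "y \<in> proper L \<Longrightarrow> y \<in> L"
  by (auto simp: proper_def)

text \<open>By adjunction, an element in the image of \<open>S\<close> lies above \<open>y\<close>
  exactly if it lies above \<open>g (f y)\<close>. So the upper fibre has a smallest element; it
  differs from \<open>y\<close>, which is not in the image.\<close>

lemma upper_fiber_acyclic:
  assumes "finite M" "S \<subseteq> L" "y \<in> P" "f y \<in> S" "y \<notin> g ` S" "g ` S \<subseteq> M"
  shows "acyclic_over TYPE('k::field) {x \<in> M \<inter> g ` S. y < x}"
proof (rule acyclic_over_cone[of _ "g (f y)"])
  show "g (f y) \<in> {x \<in> M \<inter> g ` S. y < x}"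
    using assms le_g_f[OF assms(3)] by (auto simp: less_le)
  show "x \<le> g (f y) \<or> g (f y) \<le> x" if x: "x \<in> {x \<in> M \<inter> g ` S. y < x}" for x
  proof -
    obtain s where s: "x = g s" "s \<in> S" "s \<in> L"
      using x assms(2) by auto
    then have "f y \<le> s"
      using x adj[OF assms(3), of s] by auto
    then show ?thesis
      using g_le_iff[of "f y" s] s assms(2,4) by auto
  qed
qed (use assms(1) in auto)

text \<open>\<open>g\<close> embeds the interval below \<open>y\<close> into the preimage, and every
  upper fibre of this embedding has a smallest element.\<close>

lemma hdim_Delta_eq_preimage:
  assumes "y \<in> L"
  shows "hdim TYPE('k::field) (Delta L y) j = hdim TYPE('k) (order_complex {x \<in> proper P. f x < y}) j"
proof -
  let ?A = "{x \<in> proper P. f x < y}" and ?X = "g ` below L y"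
  have A: "finite ?A"
    using finite_proper[OF P] by simp
  have BL: "below L y \<subseteq> L"
    by (auto simp: below_def)
  have XA: "?X \<subseteq> ?A"
    using g_proper f_g by (auto simp: below_eq proper_def)
  have "rel_acyclic TYPE('k) (?A \<inter> ?X) ?A"
  proof (rule rel_acyclic_if_upper_fibers_acyclic[OF A])
    fix x assume x: "x \<in> ?A - ?X"
    then have "f x \<in> below L y"
      using f_proper[OF proper_mem(1)] by (auto simp: below_eq)
    then show "acyclic_over TYPE('k) {z \<in> ?A \<inter> ?X. x < z}"
      by (intro upper_fiber_acyclic A BL) (use x XA proper_mem in auto)
  qed
  moreover have "?A \<inter> ?X = ?X"
    using XA by auto
  ultimately have "hdim TYPE('k) (order_complex ?X) j = hdim TYPE('k) (order_complex ?A) j"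
    using hdim_rel_acyclic[OF A] by metis
  moreover have "hdim TYPE('k) (order_complex (below L y)) j = hdim TYPE('k) (order_complex ?X) j"
    by (rule hdim_iso[OF _ g_iso[OF BL]]) (use finite_below[OF L] in auto)
  ultimately show ?thesis
    by (simp add: Delta_below)
qed

end

section \<open>Consequences of equal Betti numbers\<close>

locale betti_retraction = retraction P L f g + rigid_poset k Q r
  for P :: "'b::order set" and L :: "'a::order set" and f g
    and k :: "'k::field itself" and Q :: "'b set" and r +
  assumes Q: "Q = betti_poset TYPE('k) P"
    and betti_eq: "\<And>i. betti TYPE('k) P i = betti TYPE('k) L i"
begin

lemma Q_proper: "proper Q \<subseteq> proper P"
  using betti_poset_proper[OF P Q] by blast

lemma f_mono_Q: "x \<in> proper Q \<Longrightarrow> x' \<in> proper Q \<Longrightarrow> x \<le> x' \<Longrightarrow> f x \<le> f x'"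
  using f_mono Q_proper proper_mem(1) by blast

lemma down_closed_preimage:
  "down_closed (proper Q) {x \<in> proper Q. f x < y}" "down_closed (proper Q) {x \<in> proper Q. f x \<le> y}"
  unfolding down_closed_def by (blast intro: f_mono_Q order_le_less_trans order_trans)+

text \<open>By adjunction this preimage consists of the elements of \<open>Q\<close> up to
  \<open>g y\<close>.\<close>

lemma acyclic_preimage_le:
  assumes "y \<in> proper L"
  shows "acyclic_over TYPE('k) {x \<in> proper Q. f x \<le> y}"
proof -
  have "{x \<in> proper Q. f x \<le> y} = {x \<in> proper Q. x \<le> g y}"
    using adj[OF proper_mem(1), of _ y] Q_proper proper_mem(2)[OF assms] by auto
  then show ?thesis
    using acyclic_betti_le[OF P Q g_proper[OF assms]] by simp
qed

lemma hdim_Delta_eq_betti_preimage: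
  assumes "y \<in> L"
  shows "hdim TYPE('k) (Delta L y) j = hdim TYPE('k) (order_complex {x \<in> proper Q. f x < y}) j"
proof -
  let ?A = "{x \<in> proper P. f x < y}"
  have "down_closed (proper P) ?A"
    unfolding down_closed_def by (blast intro: f_mono proper_mem(1) order_le_less_trans)
  then have "rel_acyclic TYPE('k) (?A \<inter> Q) ?A"
    by (rule rel_acyclic_betti[OF P Q])
  moreover have "?A \<inter> Q = {x \<in> proper Q. f x < y}"
    using betti_poset_proper[OF P Q] by auto
  ultimately show ?thesis
    using hdim_Delta_eq_preimage[OF assms, where 'k='k] hdim_rel_acyclic[of ?A, where 'k='k] finite_proper[OF P]
    by simp
qed

lemma below_Q: "{x \<in> proper Q. x < q} = below Q q"
  by (simp add: below_eq)

text \<open>Attaching the fibre over \<open>y\<close> to the preimage of the open interval produces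
  an acyclic set, so the attached elements must kill all the homology present before.\<close>

lemma hdim_fiber_le:
  assumes "y \<in> proper L"
  shows "hdim TYPE('k) (Delta L y) j \<le> (\<Sum>x | x \<in> proper Q \<and> f x = y. hdim TYPE('k) (Delta Q x) j)"
proof -
  let ?A = "{x \<in> proper Q. f x < y}" and ?A' = "{x \<in> proper Q. f x \<le> y}"
  have "finite ?A'" by simp
  then have 0: "hdim TYPE('k) (order_complex ?A') j = 0"
    using acyclic_preimage_le[OF assms] acyclic_over_iff_hdim by blast
  have "hdim TYPE('k) (order_complex ?A) j \<le> hdim TYPE('k) (order_complex ?A') j
    + (\<Sum>x\<in>?A' - ?A. hdim TYPE('k) (order_complex {y \<in> proper Q. y < x}) j)"
    by (rule hdim_add_set_le[OF _ down_closed_preimage]) auto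
  moreover have "?A' - ?A = {x. x \<in> proper Q \<and> f x = y}"
    by auto
  ultimately show ?thesis
    using 0 hdim_Delta_eq_betti_preimage[OF proper_mem(2)[OF assms], of j] by (simp add: below_Q Delta_below)
qed

text \<open>Summed over \<open>y\<close>, the two sides of \<open>hdim_fiber_le\<close> become Betti
  numbers of \<open>L\<close> and of \<open>P\<close>. As these agree, no single inequality is
  strict.\<close>

lemma hdim_fiber:
  assumes "y \<in> proper L" "1 \<le> i"
  shows "hdim TYPE('k) (Delta L y) (int i - 2) =
    (\<Sum>x | x \<in> proper Q \<and> f x = y. hdim TYPE('k) (Delta Q x) (int i - 2))"
proof (rule sum_mono_inv[OF _ hdim_fiber_le assms(1)])
  let ?h = "\<lambda>x. hdim TYPE('k) (Delta Q x) (int i - 2)"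
  have "(\<Sum>y\<in>proper L. hdim TYPE('k) (Delta L y) (int i - 2)) = betti TYPE('k) L i"
    using assms(2) by (simp add: betti_def proper_eq[OF L])
  also have "\<dots> = (\<Sum>x\<in>proper P. hdim TYPE('k) (Delta P x) (int i - 2))"
    unfolding betti_eq[symmetric] using assms(2) by (simp add: betti_def proper_eq[OF P])
  also have "\<dots> = (\<Sum>x\<in>proper Q. hdim TYPE('k) (Delta P x) (int i - 2))"
  proof (rule sum.mono_neutral_right[OF finite_proper[OF P] Q_proper])
    show "\<forall>x\<in>proper P - proper Q. hdim TYPE('k) (Delta P x) (int i - 2) = 0"
      unfolding betti_poset_proper[OF P Q] by (auto simp: Q betti_poset_def proper_def)
  qed
  also have "\<dots> = sum ?h (proper Q)"
    using hdim_betti_poset[OF P Q] by simp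
  also have "\<dots> = (\<Sum>y\<in>proper L. sum ?h {x \<in> proper Q. f x = y})"
    by (rule sum.group[symmetric]) (use finite_proper[OF L] f_proper proper_mem Q_proper in auto)
  finally show "(\<Sum>y\<in>proper L. hdim TYPE('k) (Delta L y) (int i - 2)) =
      (\<Sum>y\<in>proper L. \<Sum>x | x \<in> proper Q \<and> f x = y. ?h x)"
    by simp
qed (use finite_proper[OF L] in auto)

text \<open>The summand of \<open>q\<close> makes the fibre sum over \<open>f q\<close> nonzero in
  degree \<open>r q - 2\<close>.\<close>

lemma f_betti:
  assumes "q \<in> proper Q"
  shows "f q \<in> betti_poset TYPE('k) L"
proof -
  have q: "f q \<in> proper L"
    using assms Q_proper f_proper proper_mem by blast
  have "hdim TYPE('k) (Delta Q q) (int (r q) - 2) \<le>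
      (\<Sum>x | x \<in> proper Q \<and> f x = f q. hdim TYPE('k) (Delta Q x) (int (r q) - 2))"
    by (rule member_le_sum) (use assms in auto)
  moreover have "hdim TYPE('k) (Delta Q q) (int (r q) - 2) = 1"
    using hdim_below[OF assms] by (simp add: Delta_below)
  ultimately have "hdim TYPE('k) (Delta L (f q)) (int (r q) - 2) \<noteq> 0"
    using hdim_fiber[OF q r_pos[OF assms]] by linarith
  then show ?thesis
    using q by (auto simp: betti_poset_def proper_def)
qed

text \<open>If \<open>co q p\<close> were nonzero, the cycle below \<open>p\<close> would bound even before \<open>p\<close> is attached: up to
  a factor, it is the boundary of the part of \<open>gen q\<close> avoiding \<open>p\<close>. So \<open>p\<close> would not contribute to
  the homology below \<open>f p\<close>.\<close>

lemma co_eq_0_if_same_image: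
  assumes p: "p \<in> proper Q" and q: "q \<in> proper Q" and pq: "p < q" "r q = Suc (r p)" and f: "f p = f q"
  shows "co q p = 0"
proof (rule ccontr)
  assume co: "co q p \<noteq> 0"
  define y where "y = f q"
  define j where "j = int (r p) - 2"
  have y: "y \<in> proper L"
    unfolding y_def using q Q_proper f_proper proper_mem by blast
  let ?h = "\<lambda>x. hdim TYPE('k) (Delta Q x) j"
  let ?A = "{x \<in> proper Q. f x < y}" and ?A' = "{x \<in> proper Q. f x \<le> y}"
  \<comment> \<open>The preimage of the open interval and the part of the fibre of rank up to
    \<open>r p\<close>: large enough to contain everything below \<open>q\<close>, small enough for
    \<open>p\<close> to be maximal.\<close>
  define K' where "K' = {x \<in> proper Q. f x < y \<or> (f x = y \<and> r x \<le> r p)}"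
  define K where "K = K' - {p}"
  note fQ = f_mono_Q
  have rQ: "r x \<le> r x'" if "x \<in> proper Q" "x' \<in> proper Q" "x \<le> x'" for x x'
    using r_mono that by (metis less_le order_refl order_le_less)
  have pK': "p \<in> K'"
    using p f by (simp add: K'_def y_def)
  have max: "\<not> p < x" if "x \<in> K'" for x
  proof
    assume px: "p < x"
    then have "f p \<le> f x" "r p < r x"
      using fQ r_mono p that by (auto simp: K'_def)
    then show False
      using that f by (auto simp: K'_def y_def)
  qed
  have dK': "down_closed (proper Q) K'"
    unfolding down_closed_def
  proof (intro conjI ballI impI)
    fix x x' assume x: "x \<in> K'" "x' \<in> proper Q" "x' \<le> x"
    then have "f x' \<le> f x" "r x' \<le> r x"
      using fQ rQ by (auto simp: K'_def)
    then show "x' \<in> K'"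
      using x by (auto simp: K'_def)
  qed (auto simp: K'_def)
  have dK: "down_closed (proper Q) K"
    using dK' max unfolding down_closed_def K_def by (auto simp: order_le_less)
  have C: "comparables K' p = below Q p"
    using dK' max pK' by (auto simp: comparables_def below_eq down_closed_def dest: less_imp_le)
  have fK': "finite K'"
    by (simp add: K'_def)
  have "hdim TYPE('k) (order_complex K) j \<le> hdim TYPE('k) (order_complex K') j"
    unfolding K_def
  proof (rule hdim_remove_le_if_link_bounds[OF fK' pK'])
    fix w :: "'b set \<Rightarrow> 'k" assume "w \<in> ocycles (comparables K' p) j"
    then have "w \<in> ochains (below Q p) (int (r p) - 2)" "bdry w = 0"
      unfolding C by (auto simp: cycles_def j_def)
    then obtain a where a: "w = fscale a (gen p)"
      using cycle_multiple_of_gen[OF p] by metis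
    have zK': "gen q \<in> ochains K' (int (r q) - 2)"
    proof (rule ochains_mono[OF gen_cycle(1)[OF q]])
      show "below Q q \<subseteq> K'"
      proof
        fix x assume x: "x \<in> below Q q"
        then have "f x \<le> y" "r x \<le> r p" "x \<in> proper Q"
          using below_rank[OF q x] fQ[OF _ q] pq(2) by (auto simp: y_def)
        then show "x \<in> K'"
          by (auto simp: K'_def order_le_less)
      qed
    qed
    have jq: "int (r q) - 2 = j + 1"
      using pq(2) by (simp add: j_def)
    have lz: "link p (gen q) = fscale (co q p) (gen p)"
      by (rule link_gen[OF p q pq(2)])
    have bl: "bdry (link p (gen q)) = 0"
      using link_bdry[OF fin_below gen_cycle(1)[OF q], of p] gen_cycle(2)[OF q] by simp
    have av: "avoid p (gen q) \<in> ochains (K' - {p}) (j + 1)"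
      using avoid_in_ochains[OF zK', of p] unfolding jq .
    have "0 = link p (gen q) - cone p (bdry (link p (gen q))) + bdry (avoid p (gen q))"
      using bdry_decompose[OF fK' pK' zK'] gen_cycle(2)[OF q] by simp
    then have "bdry (avoid p (gen q)) = - link p (gen q)"
      unfolding bl by (simp add: eq_neg_iff_add_eq_0 add.commute)
    then have "bdry (avoid p (gen q)) = fscale (- co q p) (gen p)"
      unfolding lz by simp
    then have "fscale (- co q p) (gen p) \<in> obounds (K' - {p}) j"
      unfolding obounds_iff using av by blast
    \<comment> \<open>Since the incidence number is invertible, every multiple of
      \<open>gen p\<close> becomes a boundary not involving \<open>p\<close>.\<close>
    then have "fscale (- a / co q p) (fscale (- co q p) (gen p)) \<in> obounds (K' - {p}) j"
      by (rule fs.subspace_scale[OF obounds_subspace, rotated]) (use fK' in simp)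
    then show "w \<in> obounds (K' - {p}) j"
      using co by (simp add: a)
  qed
  moreover have "hdim TYPE('k) (order_complex ?A) j \<le> hdim TYPE('k) (order_complex K) j
      + (\<Sum>x\<in>K - ?A. hdim TYPE('k) (order_complex {y \<in> proper Q. y < x}) j)"
    by (rule hdim_add_set_le[OF _ down_closed_preimage(1) dK]) (use f in \<open>auto simp: K_def K'_def y_def\<close>)
  moreover have "hdim TYPE('k) (order_complex K') j \<le> hdim TYPE('k) (order_complex ?A') j
      + (\<Sum>x\<in>?A' - K'. hdim TYPE('k) (order_complex {y \<in> proper Q. y < x}) j)"
    by (rule hdim_add_set_le[OF _ dK' down_closed_preimage(2)]) (auto simp: K'_def)
  moreover have "hdim TYPE('k) (order_complex ?A') j = 0"
    using acyclic_preimage_le[OF y] acyclic_over_iff_hdim[of ?A', where 'k='k] by simp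
  \<comment> \<open>The fibre is attached in three stages, with \<open>p\<close> alone in the
    middle. That stage kills nothing, so the bound lacks the summand 1 of \<open>p\<close>, contrary
    to \<open>hdim_fiber\<close>.\<close>
  ultimately have "hdim TYPE('k) (Delta L y) j \<le> (\<Sum>x\<in>K - ?A. ?h x) + (\<Sum>x\<in>?A' - K'. ?h x)"
    using hdim_Delta_eq_betti_preimage[OF proper_mem(2)[OF y], of j]
    unfolding below_Q Delta_below[symmetric] by linarith
  also have "\<dots> = (\<Sum>x\<in>(K - ?A) \<union> (?A' - K'). ?h x)"
    by (rule sum.union_disjoint[symmetric]) (auto simp: K_def K'_def)
  also have "(K - ?A) \<union> (?A' - K') = {x. x \<in> proper Q \<and> f x = y} - {p}"
    using pK' by (auto simp: K_def K'_def)
  also have "(\<Sum>x\<in>{x. x \<in> proper Q \<and> f x = y} - {p}. ?h x) < (\<Sum>x | x \<in> proper Q \<and> f x = y. ?h x)"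
  proof -
    have "(\<Sum>x | x \<in> proper Q \<and> f x = y. ?h x) = ?h p + (\<Sum>x\<in>{x. x \<in> proper Q \<and> f x = y} - {p}. ?h x)"
      by (rule sum.remove) (use p f in \<open>auto simp: y_def\<close>)
    moreover have "?h p = 1"
      using hdim_below[OF p, of j] by (simp add: Delta_below j_def)
    ultimately show ?thesis by simp
  qed
  also have "\<dots> = hdim TYPE('k) (Delta L y) j"
    unfolding j_def by (rule hdim_fiber[OF y r_pos[OF p], symmetric])
  finally show False by simp
qed

text \<open>Both the preimage and the copy of \<open>V\<close> under \<open>g\<close> have the
  homology of their union. Over the copy, upper fibres have a smallest element. Over the preimage,
  the lower fibre of an element \<open>g v\<close> is all of \<open>below Q (g v)\<close>, because
  \<open>f\<close> maps \<open>Q\<close> into the Betti poset of \<open>L\<close> and hence these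
  elements into \<open>V\<close>; it is acyclic when \<open>g v\<close> is not in
  \<open>Q\<close>.\<close>

lemma acyclic_preimage_betti:
  assumes V: "down_closed (proper (betti_poset TYPE('k) L)) V" "acyclic_over TYPE('k) V"
  shows "acyclic_over TYPE('k) {x \<in> proper Q. f x \<in> V}"
proof -
  let ?U = "{x \<in> proper Q. f x \<in> V}" and ?G = "g ` V"
  let ?M = "?U \<union> ?G"
  have pB: "proper (betti_poset TYPE('k) L) = proper L \<inter> betti_poset TYPE('k) L"
    by (rule betti_poset_proper[OF L refl])
  have VL: "V \<subseteq> proper L"
    using V(1) unfolding down_closed_def pB by blast
  then have VL': "V \<subseteq> L"
    using proper_mem(2) by blast
  have fV: "finite V"
    using VL finite_proper[OF L] finite_subset by blast
  have M: "finite ?M"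
    using fV by simp
  have rU: "rel_acyclic TYPE('k) (?M \<inter> ?U) ?M"
  proof (rule rel_acyclic_if_lower_fibers_acyclic[OF M])
    fix z assume z: "z \<in> ?M - ?U"
    then obtain v where v: "z = g v" "v \<in> V"
      by blast
    have gv: "g v \<in> proper P" "f (g v) = v"
      using v(2) VL VL' g_proper f_g by auto
    \<comment> \<open>As \<open>f (g v) = v\<close>, an element \<open>g v\<close> of
      \<open>Q\<close> would already lie in the preimage.\<close>
    have nQ: "g v \<notin> Q"
      using z v gv betti_poset_proper[OF P Q] by auto
    have "{x \<in> ?M \<inter> ?U. x < z} = below Q (g v)"
    proof (intro equalityI subsetI)
      fix x assume x: "x \<in> below Q (g v)"
      then have xQ: "x \<in> proper Q" "x \<le> g v" "x < g v"
        by (auto simp: below_eq)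
      have xP: "x \<in> proper P"
        using xQ(1) Q_proper by blast
      then have "f x \<le> v"
        using adj[of x v] xQ(2) proper_mem(1) v(2) VL' by blast
      moreover have "f x \<in> proper (betti_poset TYPE('k) L)"
        unfolding pB using f_betti[OF xQ(1)] f_proper xP proper_mem(1) by blast
      ultimately have "f x \<in> V"
        using V(1) v(2) unfolding down_closed_def by blast
      then show "x \<in> {x \<in> ?M \<inter> ?U. x < z}"
        using xQ v(1) by simp
    qed (auto simp: below_eq v(1))
    then show "acyclic_over TYPE('k) {x \<in> ?M \<inter> ?U. x < z}"
      using acyclic_below_not_betti[OF P Q gv(1) nQ] by simp
  qed
  have rG: "rel_acyclic TYPE('k) (?M \<inter> ?G) ?M"
  proof (rule rel_acyclic_if_upper_fibers_acyclic[OF M])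
    fix z assume "z \<in> ?M - ?G"
    then show "acyclic_over TYPE('k) {x \<in> ?M \<inter> ?G. z < x}"
      by (intro upper_fiber_acyclic M VL') (use Q_proper proper_mem(1) in auto)
  qed
  have I: "?M \<inter> ?U = ?U" "?M \<inter> ?G = ?G"
    by auto
  have "acyclic_over TYPE('k) ?G"
    by (rule acyclic_over_iso[OF fV poset_iso_inv[OF g_iso[OF VL']] V(2)])
  then have "acyclic_over TYPE('k) ?M"
    by (rule acyclic_over_up[OF M rG[unfolded I(2)]])
  then show ?thesis
    by (rule acyclic_over_down[OF M rU[unfolded I(1)]])
qed

end

section \<open>Monomial ideals\<close>

interpretation mpoly: module "(*) :: ('v, 'k::field) mpoly \<Rightarrow> ('v, 'k) mpoly \<Rightarrow> ('v, 'k) mpoly"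
  by unfold_locales (auto simp: algebra_simps)

definition monoms :: "('v, 'k::field) mpoly set \<Rightarrow> 'v monom set" where
  "monoms N = {t. Poly_Mapping.single t 1 \<in> N}"

lemma mpoly_sum_monomials:
  fixes f :: "('v, 'k::field) mpoly"
  shows "f = (\<Sum>t\<in>Poly_Mapping.keys f. Poly_Mapping.single t (Poly_Mapping.lookup f t))"
  by (rule poly_mapping_eqI) (simp add: lookup_sum_apply lookup_single when_def in_keys_iff)

lemma span_monomials:
  fixes M :: "'v monom set"
  shows "mpoly.span ((\<lambda>m. Poly_Mapping.single m 1) ` M) =
    {f :: ('v, 'k::field) mpoly. \<forall>t\<in>Poly_Mapping.keys f. \<exists>m\<in>M. m \<le> t}" (is "?S = ?T")
proof (rule antisym)
  have "mpoly.subspace ?T"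
  proof (rule mpoly.subspaceI)
    fix x y assume "x \<in> ?T" "y \<in> ?T"
    then show "x + y \<in> ?T"
      using Poly_Mapping.keys_add[of x y] by blast
  next
    fix c x assume x: "x \<in> ?T"
    show "c * x \<in> ?T"
    proof (intro CollectI ballI)
      fix t assume "t \<in> Poly_Mapping.keys (c * x)"
      then obtain a b where ab: "t = a + b" "b \<in> Poly_Mapping.keys x"
        using keys_mult[of c x] by blast
      then obtain m where "m \<in> M" "m \<le> b"
        using x by blast
      moreover have "b \<le> t"
        using ab by (simp add: le_fun_def)
      ultimately show "\<exists>m\<in>M. m \<le> t"
        using order_trans by blast
    qed
  qed simp
  then show "?S \<subseteq> ?T"
    by (intro mpoly.span_minimal) auto
  show "?T \<subseteq> ?S"
  proof
    fix f assume f: "f \<in> ?T"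
    have "Poly_Mapping.single t (Poly_Mapping.lookup f t) \<in> ?S" if "t \<in> Poly_Mapping.keys f" for t
    proof -
      obtain m where m: "m \<in> M" "m \<le> t"
        using f \<open>t \<in> _\<close> by blast
      have "t - m + m = t"
        using m(2) by (auto simp: fun_eq_iff le_fun_def)
      then have "Poly_Mapping.single t (Poly_Mapping.lookup f t) =
          Poly_Mapping.single (t - m) (Poly_Mapping.lookup f t) * Poly_Mapping.single m 1"
        by (simp add: mult_single)
      also have "\<dots> \<in> ?S"
        by (intro mpoly.span_scale mpoly.span_base) (use m in auto)
      finally show ?thesis .
    qed
    then have "(\<Sum>t\<in>Poly_Mapping.keys f. Poly_Mapping.single t (Poly_Mapping.lookup f t)) \<in> ?S"
      by (rule mpoly.span_sum)
    then show "f \<in> ?S"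
      using mpoly_sum_monomials[of f] by simp
  qed
qed

lemma monomial_ideal_eq:
  fixes N :: "('v, 'k::field) mpoly set"
  assumes "monomial_ideal N"
  shows "N = {f. \<forall>t\<in>Poly_Mapping.keys f. t \<in> monoms N}"
    and "\<And>s t. s \<in> monoms N \<Longrightarrow> s \<le> t \<Longrightarrow> t \<in> monoms N"
proof -
  obtain M where M: "N = {f. \<forall>t\<in>Poly_Mapping.keys f. \<exists>m\<in>M. m \<le> t}"
    using assms unfolding monomial_ideal_def span_monomials by blast
  have "monoms N = {t. \<exists>m\<in>M. m \<le> t}"
    by (simp add: monoms_def M)
  then show "N = {f. \<forall>t\<in>Poly_Mapping.keys f. t \<in> monoms N}"
    and "\<And>s t. s \<in> monoms N \<Longrightarrow> s \<le> t \<Longrightarrow> t \<in> monoms N"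
    using M by (auto intro: order_trans)
qed

text \<open>Among the monomials of the ideal dividing \<open>t\<close>, one of least total degree is
  minimal in the whole ideal.\<close>

lemma min_gens_below:
  fixes N :: "('v::finite, 'k::field) mpoly set"
  assumes "t \<in> monoms N"
  obtains m where "m \<in> min_gens N" "m \<le> t"
proof -
  let ?d = "\<lambda>m::'v monom. \<Sum>v\<in>UNIV. m v"
  obtain m where m: "m \<in> monoms N \<and> m \<le> t" "\<forall>m'. m' \<in> monoms N \<and> m' \<le> t \<longrightarrow> ?d m \<le> ?d m'"
    using ex_has_least_nat[of "\<lambda>m. m \<in> monoms N \<and> m \<le> t" t ?d] assms by blast
  have "m' = m" if m': "Poly_Mapping.single m' 1 \<in> N" "m' \<le> m" for m'
  proof -
    have "m' \<in> monoms N \<and> m' \<le> t"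
      using m' m(1) order_trans by (auto simp: monoms_def)
    then have "?d m \<le> ?d m'"
      using m(2) by blast
    moreover have "?d m' \<le> ?d m"
      using m'(2) by (intro sum_mono) (auto simp: le_fun_def)
    ultimately have "?d m' = ?d m" by simp
    then have "m' v = m v" for v
      using m'(2) by (intro sum_mono_inv[of m' UNIV m]) (auto simp: le_fun_def)
    then show ?thesis by blast
  qed
  then have "m \<in> min_gens N"
    using m(1) by (auto simp: min_gens_def monoms_def)
  then show thesis
    using that m(1) by blast
qed

lemma Sup_monom_upper: "finite X \<Longrightarrow> m \<in> X \<Longrightarrow> m \<le> (Sup X :: 'v monom)"
  by (auto simp: le_fun_def Sup_nat_def)

text \<open>Suprema of natural numbers obey the usual rule on nonempty sets; for the empty set the
  value is 0, which is below everything.\<close>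

lemma Sup_monom_least: "(\<And>m. m \<in> X \<Longrightarrow> m \<le> t) \<Longrightarrow> (Sup X :: 'v monom) \<le> t"
proof (rule le_funI)
  fix v assume *: "\<And>m. m \<in> X \<Longrightarrow> m \<le> t"
  show "Sup X v \<le> t v"
  proof (cases "X = {}")
    case False
    then show ?thesis
      unfolding Sup_apply using * by (intro cSup_least) (auto simp: le_fun_def)
  qed (simp add: Sup_nat_def)
qed

lemma Sup_monom_empty: "(Sup {} :: 'v monom) = 0"
  by (simp add: fun_eq_iff Sup_nat_def)

lemma Sup_monom_singleton: "(Sup {m} :: 'v monom) = m"
  by (simp add: fun_eq_iff)

section \<open>The lcm-lattice and the monomials of the ideal\<close>

context
  fixes N :: "('v::finite, 'k::field) mpoly set" and \<Lambda>
  assumes N: "monomial_ideal N" and \<Lambda>: "\<Lambda> = lcm_lattice N" and fin: "finite \<Lambda>"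
begin

lemma min_gens_lcm_lattice: "min_gens N \<subseteq> \<Lambda>"
proof
  fix m assume "m \<in> min_gens N"
  then show "m \<in> \<Lambda>"
    unfolding \<Lambda> lcm_lattice_def by (intro image_eqI[of m Sup "{m}"]) (simp_all only: Sup_monom_singleton, blast)
qed

lemma finite_min_gens: "finite (min_gens N)"
  using min_gens_lcm_lattice fin finite_subset by blast

lemma lcm_lattice_pointed: "finite_pointed \<Lambda>" "pbot \<Lambda> = 0"
proof -
  have 0: "0 \<in> \<Lambda>"
    unfolding \<Lambda> lcm_lattice_def by (intro image_eqI[of 0 Sup "{}"]) (simp_all only: Sup_monom_empty, blast)
  then show "finite_pointed \<Lambda>"
    unfolding finite_pointed_def using fin by (intro conjI bexI[of _ 0]) (auto simp: le_fun_def)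
  show "pbot \<Lambda> = 0"
    using 0 by (rule pbot_eqI) (simp add: le_fun_def)
qed

lemma lcm_lattice_le_monoms:
  assumes "u \<in> proper \<Lambda>" "u \<le> t"
  shows "t \<in> monoms N"
proof -
  obtain X where X: "X \<subseteq> min_gens N" "u = Sup X"
    using assms(1) unfolding proper_def \<Lambda> lcm_lattice_def by auto
  have "X \<noteq> {}"
    using assms(1) X(2) lcm_lattice_pointed(2) Sup_monom_empty[where 'v='v] by (auto simp: proper_def)
  then obtain m where m: "m \<in> X" by blast
  then have "m \<le> t"
    using Sup_monom_upper[OF finite_subset[OF X(1) finite_min_gens]] X(2) assms(2) order_trans by blast
  moreover have "m \<in> monoms N"
    using m X(1) by (auto simp: min_gens_def monoms_def)
  ultimately show ?thesis
    using monomial_ideal_eq(2)[OF N] by blast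
qed

text \<open>A one-element lcm-lattice also belongs to the unit ideal. A further element excludes
  this: if 1 were in the ideal, it would be the only minimal generator.\<close>

lemma zero_notin_monoms:
  assumes "proper \<Lambda> \<noteq> {}"
  shows "0 \<notin> monoms N"
proof
  assume 0: "0 \<in> monoms N"
  obtain u where u: "u \<in> proper \<Lambda>"
    using assms by blast
  obtain X where X: "X \<subseteq> min_gens N" "u = Sup X"
    using u unfolding proper_def \<Lambda> lcm_lattice_def by auto
  have "m = 0" if "m \<in> X" for m
  proof -
    have "0 \<le> m"
      by (simp add: le_fun_def)
    then have "0 = m"
      using that X(1) 0 unfolding min_gens_def monoms_def by blast
    then show ?thesis ..
  qed
  then have "Sup X \<le> 0"
    by (intro Sup_monom_least) auto
  then have "u = pbot \<Lambda>"
    unfolding X(2) lcm_lattice_pointed(2) by (simp add: fun_eq_iff le_fun_def)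
  then show False
    using u by (simp add: proper_def)
qed

text \<open>The witness is the least common multiple of the minimal generators dividing
  \<open>t\<close>. It is not 1, since some generator divides \<open>t\<close> and 1 is not in the
  ideal.\<close>

lemma lcm_below_monomial:
  assumes "t \<in> monoms N" "proper \<Lambda> \<noteq> {}"
  obtains x where "x \<in> proper \<Lambda>" "\<And>u. u \<in> \<Lambda> \<Longrightarrow> u \<le> t \<longleftrightarrow> u \<le> x"
proof
  define X where "X = {m \<in> min_gens N. m \<le> t}"
  have X: "finite X"
    using finite_min_gens by (simp add: X_def)
  have x\<Lambda>: "Sup X \<in> \<Lambda>"
    unfolding \<Lambda> lcm_lattice_def by (rule imageI) (auto simp: X_def)
  obtain m where m: "m \<in> X"
    using min_gens_below[OF assms(1)] by (auto simp: X_def)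
  have "m \<noteq> 0"
    using m zero_notin_monoms[OF assms(2)] by (auto simp: X_def min_gens_def monoms_def)
  moreover have "m = 0" if "Sup X = 0"
    using Sup_monom_upper[OF X m] unfolding that by (simp add: le_fun_def fun_eq_iff)
  ultimately have "Sup X \<noteq> 0"
    by blast
  then show "Sup X \<in> proper \<Lambda>"
    using x\<Lambda> by (simp add: proper_eq[OF lcm_lattice_pointed(1)] lcm_lattice_pointed(2))
  have "Sup X \<le> t"
    by (rule Sup_monom_least) (simp add: X_def)
  moreover have "u \<le> Sup X" if u: "u \<in> \<Lambda>" "u \<le> t" for u
  proof -
    obtain Y where Y: "Y \<subseteq> min_gens N" "u = Sup Y"
      using u(1) unfolding \<Lambda> lcm_lattice_def by auto
    show ?thesis
      unfolding Y(2)
    proof (rule Sup_monom_least)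
      fix m assume m: "m \<in> Y"
      then have "m \<le> t"
        using Sup_monom_upper[OF finite_subset[OF Y(1) finite_min_gens]] u(2) Y(2) order_trans by blast
      then have "m \<in> X"
        using m Y(1) by (auto simp: X_def)
      then show "m \<le> Sup X"
        by (rule Sup_monom_upper[OF X])
    qed
  qed
  ultimately show "\<And>u. u \<in> \<Lambda> \<Longrightarrow> u \<le> t \<longleftrightarrow> u \<le> Sup X"
    using order_trans by blast
qed

end

section \<open>Rigid deformations of atomic lattices\<close>

text \<open>An element of \<open>B(P)\<close> is labelled by the monomial that
  \<open>\<theta>\<close> assigns to its image in \<open>B(L)\<close>. Leaving the retraction
  arbitrary lets the same statement resolve the rigid ideal itself, through the identity of its
  lcm-lattice.\<close>

lemma strandwise_minimal_via_retraction:
  fixes I :: "('v::finite, 'k::field) mpoly set"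
  assumes "retraction P L f g" and rigid: "rigid TYPE('k) P"
    and betti: "\<And>i. betti TYPE('k) P i = betti TYPE('k) L i" and ne: "proper P \<noteq> {}"
    and I: "monomial_ideal I" "finite (lcm_lattice I)"
    and \<theta>: "poset_iso (betti_poset TYPE('k) L) (betti_poset TYPE('k) (lcm_lattice I)) \<theta>"
  shows "strandwise_minimal (poset_complex (betti_poset TYPE('k) P) (\<theta> \<circ> f) ::
      (_, 'v, 'k) based_complex) (monoms I)"
    and "mono_on (betti_poset TYPE('k) P) (\<theta> \<circ> f)"
    and "(\<theta> \<circ> f) (pbot (betti_poset TYPE('k) P)) = 0"
proof -
  interpret retraction P L f g by fact
  define Q where "Q = betti_poset TYPE('k) P"
  define B where "B = betti_poset TYPE('k) L"
  define \<Lambda> where "\<Lambda> = lcm_lattice I"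
  define BI where "BI = betti_poset TYPE('k) \<Lambda>"
  obtain r where r: "rigid_poset TYPE('k) Q r"
    using rigid_imp_rigid_poset[OF P rigid] unfolding Q_def by blast
  interpret rigid_poset "TYPE('k)" Q r by fact
  interpret betti_retraction P L f g "TYPE('k)" Q r
    by unfold_locales (use Q_def betti in auto)
  have fin: "finite \<Lambda>"
    using I(2) by (simp add: \<Lambda>_def)
  note pt = lcm_lattice_pointed[OF I(1) \<Lambda>_def fin]
  have pB: "finite_pointed B" "pbot B = pbot L" and pBI: "finite_pointed BI" "pbot BI = 0"
    using betti_poset_pointed[OF L B_def] betti_poset_pbot[OF L B_def]
      betti_poset_pointed[OF pt(1) BI_def] betti_poset_pbot[OF pt(1) BI_def] pt(2) by auto
  have BI\<Lambda>: "BI \<subseteq> \<Lambda>" "proper BI \<subseteq> proper \<Lambda>"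
    using betti_poset_subset[OF pt(1) BI_def] betti_poset_proper[OF pt(1) BI_def] by auto
  have iso: "poset_iso B BI \<theta>"
    using \<theta> by (simp add: B_def BI_def \<Lambda>_def)
  have \<theta>0: "\<theta> (pbot L) = 0"
    using finite_pointed_iso(2)[OF pB(1) iso] pB(2) pBI(2) by simp
  have pbQ: "pbot Q = pbot P"
    by (rule betti_poset_pbot[OF P Q_def])
  have fB: "f q \<in> B" if "q \<in> Q" for q
  proof (cases "q = pbot Q")
    case True
    then show ?thesis
      using f_pbot pbQ pB finite_pointedD(2) by metis
  next
    case False
    then have "q \<in> proper Q"
      using that by (simp add: proper_eq[OF pointed])
    then show ?thesis
      unfolding B_def by (rule f_betti)
  qed
  have fpB: "f q \<in> proper B" if "q \<in> proper Q" for q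
    using that fB f_proper[of q] Q_proper proper_mem(1)
    unfolding proper_def pB(2) by blast
  have \<theta>p: "\<theta> (f q) \<in> proper BI" if "q \<in> proper Q" for q
    using proper_iso(1)[OF pB(1) iso] fpB[OF that] by blast
  \<comment> \<open>A minimal proper element has an empty interval below it and so belongs to the
    Betti poset.\<close>
  have neQ: "proper Q \<noteq> {}"
  proof -
    obtain x where x: "x \<in> proper P" "\<And>z. z \<in> proper P \<Longrightarrow> \<not> z < x"
      using finite_minimal_exists[OF finite_proper[OF P] ne] by metis
    then have "below P x = {}"
      by (auto simp: below_eq)
    then have "hdim TYPE('k) (Delta P x) (-1) \<noteq> 0"
      unfolding Delta_below using hdim_empty_nonzero[where 'k='k] by metis
    then have "x \<in> Q"
      using x(1) by (auto simp: Q_def betti_poset_def proper_def)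
    then show ?thesis
      using x(1) betti_poset_proper[OF P Q_def] by blast
  qed
  have ne\<Lambda>: "proper \<Lambda> \<noteq> {}"
    using neQ \<theta>p BI\<Lambda>(2) by blast
  have mono: "mono_on Q (\<theta> \<circ> f)"
  proof (rule mono_onI)
    fix x y assume xy: "x \<in> Q" "y \<in> Q" "x \<le> y"
    have "x \<in> P" "y \<in> P"
      using xy betti_poset_subset[OF P Q_def] by auto
    then have "f x \<le> f y"
      using f_mono xy(3) by blast
    then show "(\<theta> \<circ> f) x \<le> (\<theta> \<circ> f) y"
      using poset_isoD(3)[OF iso fB[OF xy(1)] fB[OF xy(2)]] by simp
  qed
  have bot: "(\<theta> \<circ> f) (pbot Q) = 0"
    by (simp add: pbQ f_pbot \<theta>0)
  have "strandwise_minimal (poset_complex Q (\<theta> \<circ> f) :: (_, 'v, 'k) based_complex) (monoms I)"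
  proof (rule poset_complex_strandwise_minimal[OF refl mono bot neQ])
    fix t assume t: "t \<in> monoms I"
    obtain x where x: "x \<in> proper \<Lambda>" "\<And>u. u \<in> \<Lambda> \<Longrightarrow> u \<le> t \<longleftrightarrow> u \<le> x"
      using lcm_below_monomial[OF I(1) \<Lambda>_def fin t ne\<Lambda>] by metis
    \<comment> \<open>In the lcm-lattice, dividing \<open>t\<close> means lying below
      \<open>x\<close>, so acyclicity there is that of a closed interval. In \<open>B(L)\<close>
      only a down-set is left of it, and its preimage needs the general transfer from
      down-sets.\<close>
    define V where "V = {v \<in> proper B. \<theta> v \<le> x}"
    define V' where "V' = {u \<in> proper BI. u \<le> x}"
    have "acyclic_over TYPE('k) V'"
      unfolding V'_def by (rule acyclic_betti_le[OF pt(1) BI_def x(1)])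
    moreover have "\<theta> ` V = V'"
      using proper_iso(1)[OF pB(1) iso] by (auto simp: V_def V'_def)
    then have "poset_iso V V' \<theta>"
      using poset_iso_subset[OF iso, of V] by (auto simp: V_def proper_def)
    moreover have "finite V'"
      using finite_proper[OF pBI(1)] by (simp add: V'_def)
    ultimately have "acyclic_over TYPE('k) V"
      using acyclic_over_iso by blast
    moreover have "down_closed (proper B) V"
      unfolding down_closed_def V_def
      using poset_isoD(3)[OF iso] by (auto simp: proper_def intro: order_trans)
    ultimately have "acyclic_over TYPE('k) {q \<in> proper Q. f q \<in> V}"
      unfolding B_def by (intro acyclic_preimage_betti)
    moreover have "{q \<in> proper Q. f q \<in> V} = {q \<in> proper Q. (\<theta> \<circ> f) q \<le> t}"
    proof -
      have "\<theta> (f q) \<in> \<Lambda>" if "q \<in> proper Q" for q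
        using \<theta>p[OF that] BI\<Lambda>(2) by (auto simp: proper_def)
      then show ?thesis
        using fpB x(2) by (auto simp: V_def)
    qed
    ultimately show "acyclic_over TYPE('k) {q \<in> proper Q. (\<theta> \<circ> f) q \<le> t}"
      by simp
  next
    fix t q assume q: "q \<in> proper Q" and le: "(\<theta> \<circ> f) q \<le> t"
    then show "t \<in> monoms I"
      using lcm_lattice_le_monoms[OF I(1) \<Lambda>_def fin, of "\<theta> (f q)" t] \<theta>p BI\<Lambda>(2) by auto
  next
    show "0 \<notin> monoms I"
      by (rule zero_notin_monoms[OF I(1) \<Lambda>_def fin ne\<Lambda>])
  next
    fix p q assume pq: "p \<in> proper Q" "q \<in> proper Q" "p < q" "r q = Suc (r p)" "co q p \<noteq> 0"
    then have "f p \<noteq> f q"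
      using co_eq_0_if_same_image by blast
    moreover have "f p \<in> B" "f q \<in> B"
      using fB pq(1,2) by (auto simp: proper_def)
    ultimately show "(\<theta> \<circ> f) p \<noteq> (\<theta> \<circ> f) q"
      using poset_isoD(1)[OF iso] by (auto dest: inj_onD)
  qed
  then show "strandwise_minimal (poset_complex (betti_poset TYPE('k) P) (\<theta> \<circ> f) ::
      (_, 'v, 'k) based_complex) (monoms I)"
    and "mono_on (betti_poset TYPE('k) P) (\<theta> \<circ> f)"
    and "(\<theta> \<circ> f) (pbot (betti_poset TYPE('k) P)) = 0"
    using mono bot by (simp_all add: Q_def)
qed

section \<open>From maps of atomic lattices to retractions\<close>

lemma finite_lattice_pointed:
  assumes "finite_lattice L"
  shows "finite_pointed L"
proof -
  have L: "finite L" "L \<noteq> {}"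
    and meet: "\<And>x y. x \<in> L \<Longrightarrow> y \<in> L \<Longrightarrow> \<exists>m. isGlb L {x, y} m"
    using assms by (auto simp: finite_lattice_def)
  obtain m where m: "m \<in> L" "\<And>x. x \<in> L \<Longrightarrow> \<not> x < m"
    using finite_minimal_exists[OF L] by metis
  have "m \<le> y" if y: "y \<in> L" for y
  proof -
    obtain z where "isGlb L {m, y} z"
      using meet[OF m(1) y] by blast
    then have "z \<in> L" "z \<le> m" "z \<le> y"
      by (auto simp: isGlb_def greatestP_def isLb_def setge_def setle_def)
    then show ?thesis
      using m(2)[of z] by (auto simp: order_le_less)
  qed
  then show ?thesis
    unfolding finite_pointed_def using L m(1) by blast
qed

lemma isLub_iff: "isLub L X j \<longleftrightarrow> j \<in> L \<and> (\<forall>x\<in>X. x \<le> j) \<and> (\<forall>u\<in>L. (\<forall>x\<in>X. x \<le> u) \<longrightarrow> j \<le> u)"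
  by (auto simp: isLub_def leastP_def isUb_def setle_def setge_def)

text \<open>A maximal element mapped below \<open>y\<close> is the largest one, since its joins with
  other such elements are mapped below \<open>y\<close> too. That \<open>f\<close> retracts
  \<open>g\<close> rests on atoms: \<open>y\<close> is a join of atoms of \<open>L\<close>, and each
  lifts to an atom of \<open>P\<close> below \<open>g y\<close>.\<close>

lemma retraction_exists:
  assumes L: "atom_ordered_lattice n L aL" and P: "atom_ordered_lattice n P aP"
    and ge: "lat_ge n P aP L aL"
  shows "\<exists>f g. retraction P L f g"
proof -
  have fal: "finite_atomic_lattice L" "finite_atomic_lattice P"
    and atL: "aL ` {..<n} = atoms L" and atP: "aP ` {..<n} = atoms P"
    using L P by (auto simp: atom_ordered_lattice_def bij_betw_def)
  have pL: "finite_pointed L" and pP: "finite_pointed P"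
    using fal finite_lattice_pointed by (auto simp: finite_atomic_lattice_def)
  obtain f where f: "join_preserving P L f" "\<And>i. i < n \<Longrightarrow> f (aP i) = aL i"
    using ge by (auto simp: lat_ge_def)
  have fm: "f x \<in> L" if "x \<in> P" for x
    using f(1) that by (auto simp: join_preserving_def)
  have fl: "isLub L (f ` X) (f j)" if "X \<subseteq> P" "isLub P X j" for X j
    using f(1) that by (auto simp: join_preserving_def)
  have fmono: "f x \<le> f y" if "x \<in> P" "y \<in> P" "x \<le> y" for x y
    using fl[of "{x, y}" y] that by (auto simp: isLub_iff)
  have "\<exists>j\<in>P. \<forall>x\<in>P. x \<le> j \<longleftrightarrow> f x \<le> y" if y: "y \<in> L" for y
  proof -
    let ?S = "{x \<in> P. f x \<le> y}"
    have "isLub P {} (pbot P)"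
      using finite_pointedD[OF pP] by (auto simp: isLub_iff)
    then have "f (pbot P) \<le> y"
      using fl[of "{}" "pbot P"] y by (auto simp: isLub_iff)
    then have "?S \<noteq> {}" "finite ?S"
      using finite_pointedD[OF pP] by auto
    then obtain j where j: "j \<in> ?S" "\<And>x. x \<in> ?S \<Longrightarrow> \<not> j < x"
      using finite_maximal_exists[of ?S] by metis
    have "x \<le> j" if x: "x \<in> P" "f x \<le> y" for x
    proof -
      obtain s where s: "isLub P {x, j} s"
        using fal(2) x(1) j(1) unfolding finite_atomic_lattice_def finite_lattice_def by blast
      then have "isLub L {f x, f j} (f s)"
        using fl[of "{x, j}" s] x(1) j(1) by auto
      then have "f s \<le> y"
        using x(2) j(1) y by (auto simp: isLub_iff)
      then have "s \<in> ?S" "j \<le> s" "x \<le> s"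
        using s by (auto simp: isLub_iff)
      then show ?thesis
        using j(2)[of s] by (auto simp: order_le_less)
    qed
    moreover have "f x \<le> y" if "x \<in> P" "x \<le> j" for x
      using fmono[OF that(1) _ that(2)] j(1) by (auto intro: order_trans)
    ultimately show ?thesis
      using j(1) by blast
  qed
  then obtain g where g: "\<And>y. y \<in> L \<Longrightarrow> g y \<in> P" "\<And>x y. y \<in> L \<Longrightarrow> x \<in> P \<Longrightarrow> x \<le> g y \<longleftrightarrow> f x \<le> y"
    by metis
  have atom_lift: "\<exists>b\<in>atoms P. f b = a" if a: "a \<in> atoms L" for a
    using a f(2) unfolding atL[symmetric] atP[symmetric] by auto
  have atomP: "b \<in> P" if "b \<in> atoms P" for b
    using that by (auto simp: atoms_def covers_def)
  have "retraction P L f g"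
  proof
    fix y assume y: "y \<in> L"
    have "f (g y) \<le> y"
      using g(2)[OF y g(1)[OF y]] by simp
    moreover have "y \<le> f (g y)"
    proof -
      obtain A where A: "A \<subseteq> atoms L" "isLub L A y"
        using fal(1) y by (auto simp: finite_atomic_lattice_def)
      have "a \<le> f (g y)" if a: "a \<in> A" for a
      proof -
        obtain b where b: "b \<in> atoms P" "f b = a"
          using atom_lift a A(1) by blast
        have "f b \<le> y"
          using A(2) a b(2) by (auto simp: isLub_iff)
        then have "b \<le> g y"
          using g(2)[OF y atomP[OF b(1)]] by simp
        then show ?thesis
          using fmono[OF atomP[OF b(1)] g(1)[OF y]] b(2) by simp
      qed
      then show ?thesis
        using A(2) fm[OF g(1)[OF y]] by (auto simp: isLub_iff)
    qed
    ultimately show "f (g y) = y" by (rule order_antisym)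
  next
    fix x assume x: "x \<in> P" "f x = pbot L"
    obtain A where A: "A \<subseteq> atoms P" "isLub P A x"
      using fal(2) x(1) by (auto simp: finite_atomic_lattice_def)
    \<comment> \<open>An atom below \<open>x\<close> would be mapped to an atom of \<open>L\<close>
      below the minimum, so \<open>x\<close> is an empty join.\<close>
    have "A = {}"
    proof (rule ccontr)
      assume "A \<noteq> {}"
      then obtain b where b: "b \<in> A" by blast
      then obtain i where i: "i < n" "b = aP i"
        using A(1) unfolding atP[symmetric] by auto
      have "f b \<in> atoms L"
        unfolding atL[symmetric] using i f(2) by auto
      then have "pbot L < f b"
        by (auto simp: atoms_def covers_def)
      moreover have "f b \<le> f x"
        using fmono[of b x] A b x(1) atomP by (auto simp: isLub_iff)
      ultimately show False
        using x(2) by simp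
    qed
    then have "x \<le> pbot P"
      using A(2) finite_pointedD(2)[OF pP] by (auto simp: isLub_iff)
    then show "x = pbot P"
      using finite_pointedD(3)[OF pP x(1)] by simp
  qed (use pL pP fm g in auto)
  then show ?thesis by blast
qed

text \<open>Strictness excludes the one-element lattice: without atoms in \<open>P\<close> there are
  none in \<open>L\<close>, and then both are trivial and equal in the sense of
  \<open>lat_eq\<close>.\<close>

lemma lat_gt_proper_nonempty:
  assumes L: "atom_ordered_lattice n L aL" and P: "atom_ordered_lattice n P aP"
    and gt: "lat_gt n P aP L aL"
  shows "proper P \<noteq> {}"
proof
  assume e: "proper P = {}"
  have fal: "finite_atomic_lattice L" "finite_atomic_lattice P"
    and bL: "bij_betw aL {..<n} (atoms L)" and bP: "bij_betw aP {..<n} (atoms P)"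
    using L P by (auto simp: atom_ordered_lattice_def)
  have pL: "finite_pointed L" and pP: "finite_pointed P"
    using fal finite_lattice_pointed by (auto simp: finite_atomic_lattice_def)
  have P1: "P = {pbot P}"
    using e finite_pointedD(2)[OF pP] by (auto simp: proper_eq[OF pP])
  have "atoms P = {}"
    using e by (auto simp: atoms_def covers_def proper_def)
  then have n: "n = 0"
    using bP by (auto simp: bij_betw_def)
  then have "atoms L = {}"
    using bL by (auto simp: bij_betw_def)
  then have "isLub L {} x" if "x \<in> L" for x
    using fal(1) that unfolding finite_atomic_lattice_def by auto
  then have "x \<le> pbot L" if "x \<in> L" for x
    using that finite_pointedD(2)[OF pL] by (simp add: isLub_iff)
  then have "x = pbot L" if "x \<in> L" for x
    using that finite_pointedD(3)[OF pL] by (meson order_antisym)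
  then have L1: "L = {pbot L}"
    using finite_pointedD(2)[OF pL] by blast
  have "poset_iso {pbot P} {pbot L} (\<lambda>_. pbot L)"
    by (auto simp: poset_iso_def bij_betw_def)
  then have "lat_eq n P aP L aL"
    unfolding lat_eq_def n using P1 L1 by auto
  then show False
    using gt by (simp add: lat_gt_def)
qed

text \<open>Allows \<open>P\<close> to be replaced by an lcm-lattice isomorphic to it.\<close>

lemma retraction_iso:
  assumes "retraction P L f g" "finite_pointed A" "poset_iso A P e"
  shows "retraction A L (f \<circ> e) (inv_into A e \<circ> g)"
proof -
  interpret retraction P L f g by fact
  note iso = poset_isoD[OF assms(3)]
  have inv: "inv_into A e y \<in> A" "e (inv_into A e y) = y" if "y \<in> P" for y
    using that iso(2) by (auto intro: inv_into_into f_inv_into_f)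
  have eP: "e x \<in> P" if "x \<in> A" for x
    using that iso(2) by blast
  show ?thesis
  proof
    fix x y assume x: "x \<in> A" and y: "y \<in> L"
    have "x \<le> inv_into A e (g y) \<longleftrightarrow> e x \<le> e (inv_into A e (g y))"
      using iso(3)[OF x inv(1)[OF g_mem[OF y]]] by simp
    also have "\<dots> \<longleftrightarrow> f (e x) \<le> y"
      unfolding inv(2)[OF g_mem[OF y]] by (rule adj[OF eP[OF x] y])
    finally show "x \<le> (inv_into A e \<circ> g) y \<longleftrightarrow> (f \<circ> e) x \<le> y"
      by simp
  next
    fix x assume x: "x \<in> A" "(f \<circ> e) x = pbot L"
    then have "e x = e (pbot A)"
      using f_pbot_only[OF eP[OF x(1)]] finite_pointed_iso(2)[OF assms(2,3)] by simp
    then show "x = pbot A"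
      using iso(1) x(1) finite_pointedD(2)[OF assms(2)] by (auto dest: inj_onD)
  qed (use assms(2) L f_mem g_mem eP inv f_g in auto)
qed

lemma poset_iso_comp:
  assumes "poset_iso A B e" "poset_iso B C h"
  shows "poset_iso A C (h \<circ> e)"
  using assms unfolding poset_iso_def by (auto intro: bij_betw_trans dest: bij_betwE)

lemma retraction_id: "finite_pointed A \<Longrightarrow> retraction A A id id"
  by unfold_locales auto

theorem corollary2p10:
  fixes L :: "'a::order set" and P :: "'b::order set" and L' :: "'c::order set"
    and aL :: "nat \<Rightarrow> 'a" and aP :: "nat \<Rightarrow> 'b" and n :: nat
  assumes "atom_ordered_lattice n L aL"
    and "atom_ordered_lattice n P aP"
    and "lat_gt n P aP L aL"
    and "rigid TYPE('k::field) P"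
    and "\<forall>i. betti TYPE('k) P i = betti TYPE('k) L i"
    and "finite_atomic_lattice L'"
    and "poset_isomorphic (betti_poset TYPE('k) L) (betti_poset TYPE('k) L')"
  shows "\<forall>I :: ('v::finite, 'k) mpoly set.
    monomial_ideal I \<and> poset_isomorphic (lcm_lattice I) L' \<longrightarrow>
      supported_on I (betti_poset TYPE('k) P) \<and>
      (\<forall>J :: ('w::finite, 'k) mpoly set.
        monomial_ideal J \<and> poset_isomorphic (lcm_lattice J) P \<longrightarrow> rigid_deformation J I)"
proof (intro allI impI conjI; elim conjE)
  fix I :: "('v, 'k) mpoly set"
  assume I: "monomial_ideal I" and "poset_isomorphic (lcm_lattice I) L'"
  then obtain \<kappa> where \<kappa>: "poset_iso (lcm_lattice I) L' \<kappa>"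
    by (auto simp: poset_isomorphic_def)
  obtain f g where fg: "retraction P L f g"
    using retraction_exists[OF assms(1,2)] assms(3) by (auto simp: lat_gt_def)
  interpret retraction P L f g by fact
  have L': "finite_pointed L'"
    using assms(6) finite_lattice_pointed by (auto simp: finite_atomic_lattice_def)
  have neP: "proper P \<noteq> {}"
    by (rule lat_gt_proper_nonempty[OF assms(1-3)])
  note inv\<kappa> = poset_iso_inv[OF \<kappa>]
  have finI: "finite (lcm_lattice I)"
    using finite_pointedD(1)[OF finite_pointed_iso(1)[OF L' inv\<kappa>]] .
  obtain h where h: "poset_iso (betti_poset TYPE('k) L) (betti_poset TYPE('k) L') h"
    using assms(7) by (auto simp: poset_isomorphic_def)
  \<comment> \<open>\<open>B(L)\<close> is matched with \<open>B(L')\<close> by hypothesis, and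
    \<open>B(L')\<close> with the Betti poset of the lcm-lattice through the isomorphism of
    lattices.\<close>
  define \<theta> where "\<theta> = inv_into (lcm_lattice I) \<kappa> \<circ> h"
  have \<theta>: "poset_iso (betti_poset TYPE('k) L) (betti_poset TYPE('k) (lcm_lattice I)) \<theta>"
    unfolding \<theta>_def by (rule poset_iso_comp[OF h betti_poset_iso[OF L' inv\<kappa>]])
  have betti: "betti TYPE('k) P i = betti TYPE('k) L i" for i
    using assms(5) by blast
  show "supported_on I (betti_poset TYPE('k) P)"
    unfolding supported_on_def
  proof (intro exI[of _ "\<theta> \<circ> f"] conjI)
    note * = strandwise_minimal_via_retraction[OF fg assms(4) betti neP I finI \<theta>]
    show "mono_on (betti_poset TYPE('k) P) (\<theta> \<circ> f)" "(\<theta> \<circ> f) (pbot (betti_poset TYPE('k) P)) = 0"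
      by (rule *(2,3))+
    show "minimal_free_resolution (poset_complex (betti_poset TYPE('k) P) (\<theta> \<circ> f)) I"
      by (rule strandwise_minimal_imp_resolution[OF *(1) monomial_ideal_eq(1)[OF I]])
  qed
  fix J :: "('w, 'k) mpoly set"
  assume J: "monomial_ideal J" and "poset_isomorphic (lcm_lattice J) P"
  define A where "A = lcm_lattice J"
  define Q where "Q = betti_poset TYPE('k) A"
  obtain e where e: "poset_iso A P e"
    using \<open>poset_isomorphic (lcm_lattice J) P\<close> by (auto simp: poset_isomorphic_def A_def)
  note inve = poset_iso_inv[OF e]
  have pA: "finite_pointed A"
    by (rule finite_pointed_iso(1)[OF P inve])
  have finJ: "finite (lcm_lattice J)"
    using finite_pointedD(1)[OF pA] by (simp add: A_def)
  have rA: "rigid TYPE('k) A"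
    by (rule rigid_iso[OF P inve assms(4)])
  have neA: "proper A \<noteq> {}"
    using proper_iso(1)[OF P inve] neP by blast
  have bA: "betti TYPE('k) A i = betti TYPE('k) L i" for i
    using sum_proper_iso[OF pA e, of "int i - 2", where 'k='k] betti[of i]
    by (simp add: betti_def proper_eq[OF pA] proper_eq[OF P] split: if_splits)
  have idA: "poset_iso Q (betti_poset TYPE('k) (lcm_lattice J)) id"
    by (simp add: Q_def A_def poset_iso_def)
  \<comment> \<open>The relabelling: a monomial of the lcm-lattice of \<open>J\<close> is read in
    \<open>P\<close>, mapped to \<open>L\<close> and turned into a monomial of
    \<open>I\<close>.\<close>
  define \<gamma> where "\<gamma> = \<theta> \<circ> (f \<circ> e)"
  note * = strandwise_minimal_via_retraction[OF retraction_iso[OF fg pA e] rA bA neA I finI \<theta>,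
      folded Q_def \<gamma>_def]
  \<comment> \<open>For the identity retraction each element is its own label, a monomial in the
    ring of \<open>J\<close>.\<close>
  note ** = strandwise_minimal_via_retraction[OF retraction_id[OF pA] rA refl neA J finJ idA[unfolded Q_def],
      folded Q_def, simplified]
  let ?G = "poset_complex Q (\<lambda>x. x) :: (_, 'w, 'k) based_complex"
  let ?G' = "poset_complex Q \<gamma> :: (_, 'v, 'k) based_complex"
  define S where "S = (\<Union>i. gens ?G i)"
  have "countable S"
    unfolding S_def using **(1) by (intro countable_UN) (auto simp: strandwise_minimal_def id_def intro: countable_finite)
  then have inj: "inj_on (to_nat_on S) S"
    by (rule inj_on_to_nat_on)
  \<comment> \<open>Generators and matrix entries do not depend on labels, so a single numbering of
    the basis serves both resolutions.\<close>
  have gens: "gens ?G' = gens ?G"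
    by (simp add: poset_complex_def)
  have rel: "relabel \<gamma> (reindex (to_nat_on S) ?G) = reindex (to_nat_on S) ?G'"
    unfolding relabel_def reindex_def gens
    by (simp add: poset_complex_def split_beta)
  have "minimal_free_resolution (reindex (to_nat_on S) ?G) J"
    by (rule strandwise_minimal_imp_resolution[OF strandwise_minimal_reindex monomial_ideal_eq(1)[OF J]])
      (use ** inj in \<open>auto simp: S_def id_def\<close>)
  moreover have "minimal_free_resolution (relabel \<gamma> (reindex (to_nat_on S) ?G)) I"
    unfolding rel
    by (rule strandwise_minimal_imp_resolution[OF strandwise_minimal_reindex monomial_ideal_eq(1)[OF I]])
      (use * inj in \<open>auto simp: S_def gens\<close>)
  ultimately show "rigid_deformation J I"
    unfolding rigid_deformation_def using rA *(2) by (auto simp: A_def Q_def)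
qed

end
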